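(* Let $X$ be a Hilbert space, $(P,d)$ a metric space, $f\colon X\times P\to X$, and $g\colon X\times P\to(-\infty,\infty]$ lower semicontinuous. Let $\bar x\in S(\bar v,\bar p)$, put $\hat v:=\bar v-f(\bar x,\bar p)$, and suppose that the assumptions (A1), (A2), (A3) given in the context hold. Consider the statements: (i) $\bar x$ is a Hölderian fully stable solution of the parametric variational system $v\in f(x,p)+\partial_xg(x,p)$ corresponding to $(\bar v,\bar p)$, with moduli $\kappa,\ell>0$. (ii) There exist $\eta,\kappa_0>0$ such that whenever $(u,p,v)\in\mathrm{gph}\,\partial_xg\cap\mathbb B_\eta(\bar x,\bar p,\hat v)$ we have $$\langle\nabla_xf(\bar x,\bar p)w,w\rangle+\langle z,w\rangle\ge\kappa_0\|w\|^2\quad\text{for all } z\in(\widehat D^*\partial g_p)(u,v)(w),\ w\in X.\qquad( * )$$ Then (i) implies (ii), where $\kappa_0$ can be chosen smaller than but arbitrarily close to $\kappa$. Conversely, (ii) implies (i), where $\kappa$ can be chosen smaller than but arbitrarily close to $\kappa_0$. Consequently, condition (ii) implies that the solution map $S$ admits a single-valued and Hölder continuous localization $\vartheta$ relative to some neighborhood $V\times Q\times U$ of $(\bar v,\bar p,\bar x)$: with the moduli $\kappa,\ell>0$ of (i), for all $(v_1,p_1),(v_2,p_2)\in V\times Q$, $$\|\vartheta(v_1,p_1)-\vartheta(v_2,p_2)\|\le\frac1\kappa\|v_1-v_2\|+\frac{\ell}{2\kappa}d(p_1,p_2)^{1/2}.$$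
   Context: $X$ is a real Hilbert space identified with its dual. $\mathbb B$ is the closed unit ball; $\mathbb B_\eta(\cdot)$ denotes closed balls of radius $\eta$, and $\mathbb B_\eta(x,p,v)=\mathbb B_\eta(x)\times\mathbb B_\eta(p)\times\mathbb B_\eta(v)$. Subdifferentials. For lower semicontinuous $\varphi\colon X\to(-\infty,\infty]$ and $\varphi(\bar x)<\infty$: $\widehat\partial\varphi(\bar x)=\{v:\liminf_{x\to\bar x}[\varphi(x)-\varphi(\bar x)-\langle v,x-\bar x\rangle]/\|x-\bar x\|\ge0\}$; the limiting subdifferential $\partial\varphi(\bar x)$ is the set of $v$ for which there are sequences $x_k\to\bar x$ with $\varphi(x_k)\to\varphi(\bar x)$ and $v_k\in\widehat\partial\varphi(x_k)$ converging weakly to $v$. With $g_p:=g(\cdot,p)$, put $\partial_xg(x,p):=\partial g_p(x)$ and $\mathrm{gph}\,\partial_xg=\{(x,p,v):v\in\partial_xg(x,p)\}$. Regular coderivative. $\widehat N_\Omega(\bar z)=\{\zeta:\limsup_{z\to\bar z,\,z\in\Omega}\langle\zeta,z-\bar z\rangle/\|z-\bar z\|\le0\}$; for $F\colon X\rightrightarrows X$, $(u,v)\in\mathrm{gph}\,F$, $\widehat D^*F(u,v)(w)=\{z:(z,-w)\in\widehat N_{\mathrm{gph}F}(u,v)\}$. $(\widehat D^*\partial g_p)(u,v)$ is the regular coderivative of $\partial g_p\colon X\rightrightarrows X$ at $(u,v)$. Solution map. $S(v,p)=\{x\in X:v\in f(x,p)+\partial_xg(x,p)\}$. A single-valued localization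 of $S$ relative to a neighborhood $V\times Q\times U$ of $(\bar v,\bar p,\bar x)$ is a single-valued mapping $\vartheta\colon V\times Q\to U$, defined on all of $V\times Q$, with $\mathrm{gph}\,\vartheta=\mathrm{gph}\,S\cap(V\times Q\times U)$. Hölderian full stability. $\bar x\in S(\bar v,\bar p)$ is a Hölderian fully stable solution corresponding to $(\bar v,\bar p)$ with moduli $\kappa,\ell>0$ if $S$ admits a single-valued localization $\vartheta$ relative to some neighborhood $V\times Q\times U$ of $(\bar v,\bar p,\bar x)$ such that for all $(v_1,p_1),(v_2,p_2)\in V\times Q$: $\|(v_1-v_2)-2\kappa[\vartheta(v_1,p_1)-\vartheta(v_2,p_2)]\|\le\|v_1-v_2\|+\ell\,d(p_1,p_2)^{1/2}$. Lipschitz-like property. $F\colon P\rightrightarrows Y$ ($Y$ normed) is Lipschitz-like around $(\bar p,\bar y)\in\mathrm{gph}\,F$ if there are neighborhoods $Q$ of $\bar p$, $W$ of $\bar y$ and $\ell>0$ with $F(p)\cap W\subset F(q)+\ell d(p,q)\mathbb B$ for all $p,q\in Q$. Assumptions (with $\hat v=\bar v-f(\bar x,\bar p)\in\partial_xg(\bar x,\bar p)$): (A1) $f$ is differentiable with respect to $x$ at all points $(x,p)$ around $(\bar x,\bar p)$ and $\nabla_xf$ is continuous at $(\bar x,\bar p)$; moreover there are a neighborhood $U\times Q$ of $(\bar x,\bar p)$ and $L>0$ with $\|f(x,p_1)-f(x,p_2)\|\le Ld(p_1,p_2)$ for all $x\in U$, $p_1,p_2\in Q$. (A2) $g$ is parametrically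 continuously prox-regular at $(\bar x,\bar p)$ for $\hat v$, i.e.: there are neighborhoods $U$ of $\bar x$, $V$ of $\hat v$, $Q$ of $\bar p$ and $\varepsilon,r>0$ such that $g(x,p)\ge g(u,p)+\langle v,x-u\rangle-\frac r2\|x-u\|^2$ for all $x\in U$ whenever $v\in\partial_xg(u,p)\cap V$, $u\in U$, $p\in Q$, $g(u,p)\le g(\bar x,\bar p)+\varepsilon$; and the mapping $(x,p,v)\mapsto g(x,p)$ is continuous relative to $\mathrm{gph}\,\partial_xg$ at $(\bar x,\bar p,\hat v)$. (A3) The mapping $p\mapsto\mathrm{epi}\,g(\cdot,p)$ is Lipschitz-like around $(\bar p,(\bar x,g(\bar x,\bar p)))$. *)

theory Defs
  imports "HOL-Analysis.Analysis"
begin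

text \<open>
  Throughout, a neighborhood of a point is any set having the point in its interior.
  A set-valued mapping from \<open>'a\<close> to \<open>'b\<close> is a function of type \<open>'a \<Rightarrow> 'b set\<close>.
\<close>

definition gph :: "('a \<Rightarrow> 'b set) \<Rightarrow> ('a \<times> 'b) set"
  where "gph F = {(x, y). y \<in> F x}"

text \<open>The filter \<open>at x\<close> is punctured; if \<open>x\<close> is isolated then \<open>Liminf\<close> is \<open>\<infinity>\<close>.\<close>

definition lower_semicontinuous :: "('a::topological_space \<Rightarrow> ereal) \<Rightarrow> bool"
  where "lower_semicontinuous \<phi> \<longleftrightarrow> (\<forall>x. \<phi> x \<le> Liminf (at x) \<phi>)"

text \<open>
  The subdifferentials are meant for functions that never take the value \<open>-\<infinity>\<close>;
  they are empty at points where the function is infinite.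
\<close>

definition regular_subdiff :: "('x::real_inner \<Rightarrow> ereal) \<Rightarrow> 'x \<Rightarrow> 'x set"
  where "regular_subdiff \<phi> xb =
    {v. \<phi> xb < \<infinity> \<and>
        0 \<le> Liminf (at xb) (\<lambda>x. (\<phi> x - \<phi> xb - ereal (v \<bullet> (x - xb))) / ereal (norm (x - xb)))}"

definition weakly_converges :: "(nat \<Rightarrow> 'x::real_inner) \<Rightarrow> 'x \<Rightarrow> bool"
  where "weakly_converges vs v \<longleftrightarrow> (\<forall>y. (\<lambda>k. vs k \<bullet> y) \<longlonglongrightarrow> v \<bullet> y)"

definition limiting_subdiff :: "('x::real_inner \<Rightarrow> ereal) \<Rightarrow> 'x \<Rightarrow> 'x set"
  where "limiting_subdiff \<phi> xb =
    {v. \<phi> xb < \<infinity> \<and>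
        (\<exists>xs vs. xs \<longlonglongrightarrow> xb \<and> (\<lambda>k. \<phi> (xs k)) \<longlonglongrightarrow> \<phi> xb \<and>
                 (\<forall>k. vs k \<in> regular_subdiff \<phi> (xs k)) \<and> weakly_converges vs v)}"

definition partial_subdiff :: "('x::real_inner \<Rightarrow> 'p \<Rightarrow> ereal) \<Rightarrow> 'x \<Rightarrow> 'p \<Rightarrow> 'x set"
  where "partial_subdiff g x p = limiting_subdiff (\<lambda>y. g y p) x"

definition gph_partial_subdiff :: "('x::real_inner \<Rightarrow> 'p \<Rightarrow> ereal) \<Rightarrow> ('x \<times> 'p \<times> 'x) set"
  where "gph_partial_subdiff g = {(x, p, v). v \<in> partial_subdiff g x p}"

text \<open>At an isolated point of \<open>\<Omega>\<close> the \<open>Limsup\<close> is \<open>-\<infinity>\<close> and every \<open>\<zeta>\<close> is a regular normal.\<close>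

definition regular_normal_cone :: "('z::real_inner) set \<Rightarrow> 'z \<Rightarrow> 'z set"
  where "regular_normal_cone \<Omega> zb =
    {\<zeta>. zb \<in> \<Omega> \<and>
         Limsup (at zb within \<Omega>) (\<lambda>z. ereal (\<zeta> \<bullet> (z - zb) / norm (z - zb))) \<le> 0}"

definition regular_coderivative ::
    "('x::real_inner \<Rightarrow> 'y::real_inner set) \<Rightarrow> 'x \<Rightarrow> 'y \<Rightarrow> 'y \<Rightarrow> 'x set"
  where "regular_coderivative F u v w = {z. (z, - w) \<in> regular_normal_cone (gph F) (u, v)}"

definition solution_map ::
    "('x::real_inner \<Rightarrow> 'p \<Rightarrow> 'x) \<Rightarrow> ('x \<Rightarrow> 'p \<Rightarrow> ereal) \<Rightarrow> 'x \<Rightarrow> 'p \<Rightarrow> 'x set"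
  where "solution_map f g v p = {x. v \<in> (\<lambda>s. f x p + s) ` partial_subdiff g x p}"

text \<open>The values of \<open>\<theta>\<close> outside \<open>V \<times> Q\<close> are irrelevant.\<close>

definition single_valued_localization ::
    "('x::topological_space \<Rightarrow> 'p::topological_space \<Rightarrow> 'x set) \<Rightarrow> 'x \<Rightarrow> 'p \<Rightarrow> 'x \<Rightarrow>
     'x set \<Rightarrow> 'p set \<Rightarrow> 'x set \<Rightarrow> ('x \<Rightarrow> 'p \<Rightarrow> 'x) \<Rightarrow> bool"
  where "single_valued_localization S vb pb xb V Q U \<theta> \<longleftrightarrow>
    vb \<in> interior V \<and> pb \<in> interior Q \<and> xb \<in> interior U \<and>
    (\<forall>v\<in>V. \<forall>p\<in>Q. \<theta> v p \<in> U) \<and>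
    {(v, p, x). v \<in> V \<and> p \<in> Q \<and> x = \<theta> v p} = {(v, p, x). x \<in> S v p} \<inter> V \<times> Q \<times> U"

definition hoelderian_fully_stable ::
    "('x::real_inner \<Rightarrow> 'p::metric_space \<Rightarrow> 'x set) \<Rightarrow> 'x \<Rightarrow> 'p \<Rightarrow> 'x \<Rightarrow> real \<Rightarrow> real \<Rightarrow> bool"
  where "hoelderian_fully_stable S vb pb xb \<kappa> l \<longleftrightarrow>
    xb \<in> S vb pb \<and> \<kappa> > 0 \<and> l > 0 \<and>
    (\<exists>V Q U \<theta>. single_valued_localization S vb pb xb V Q U \<theta> \<and>
      (\<forall>v1\<in>V. \<forall>p1\<in>Q. \<forall>v2\<in>V. \<forall>p2\<in>Q.
        norm ((v1 - v2) - (2 * \<kappa>) *\<^sub>R (\<theta> v1 p1 - \<theta> v2 p2))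
          \<le> norm (v1 - v2) + l * sqrt (dist p1 p2)))"

definition lipschitz_like ::
    "('p::metric_space \<Rightarrow> 'y::real_normed_vector set) \<Rightarrow> 'p \<Rightarrow> 'y \<Rightarrow> bool"
  where "lipschitz_like F pb yb \<longleftrightarrow>
    yb \<in> F pb \<and>
    (\<exists>Q W l. pb \<in> interior Q \<and> yb \<in> interior W \<and> l > 0 \<and>
      (\<forall>p\<in>Q. \<forall>q\<in>Q. F p \<inter> W \<subseteq> {y + (l * dist p q) *\<^sub>R b | y b. y \<in> F q \<and> b \<in> cball 0 1}))"

definition epi :: "('x \<Rightarrow> ereal) \<Rightarrow> ('x \<times> real) set"
  where "epi \<phi> = {(x, \<alpha>). \<phi> x \<le> ereal \<alpha>}"

text \<open>
  The partial Frechet derivative as a bounded linear operator, so that its continuity in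
  \<open>(x, p)\<close> refers to the operator norm. Meaningful only where \<open>f(\<cdot>, p)\<close> is differentiable.
\<close>

definition partial_grad ::
    "('x::real_normed_vector \<Rightarrow> 'p \<Rightarrow> 'x) \<Rightarrow> 'x \<Rightarrow> 'p \<Rightarrow> 'x \<Rightarrow>\<^sub>L 'x"
  where "partial_grad f x p = Blinfun (frechet_derivative (\<lambda>y. f y p) (at x))"

definition assumption_A1 ::
    "('x::real_inner \<Rightarrow> 'p::metric_space \<Rightarrow> 'x) \<Rightarrow> 'x \<Rightarrow> 'p \<Rightarrow> bool"
  where "assumption_A1 f xb pb \<longleftrightarrow>
    (\<forall>\<^sub>F (x, p) in nhds (xb, pb). (\<lambda>y. f y p) differentiable (at x)) \<and>
    isCont (\<lambda>(x, p). partial_grad f x p) (xb, pb) \<and>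
    (\<exists>U Q L. xb \<in> interior U \<and> pb \<in> interior Q \<and> L > 0 \<and>
      (\<forall>x\<in>U. \<forall>p1\<in>Q. \<forall>p2\<in>Q. norm (f x p1 - f x p2) \<le> L * dist p1 p2))"

definition parametrically_continuously_prox_regular ::
    "('x::real_inner \<Rightarrow> 'p::metric_space \<Rightarrow> ereal) \<Rightarrow> 'x \<Rightarrow> 'p \<Rightarrow> 'x \<Rightarrow> bool"
  where "parametrically_continuously_prox_regular g xb pb vh \<longleftrightarrow>
    (\<exists>U V Q \<epsilon> r. xb \<in> interior U \<and> vh \<in> interior V \<and> pb \<in> interior Q \<and> \<epsilon> > 0 \<and> r > 0 \<and>
      (\<forall>u p v. v \<in> partial_subdiff g u p \<inter> V \<and> u \<in> U \<and> p \<in> Q \<and> g u p \<le> g xb pb + ereal \<epsilon> \<longrightarrow>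
        (\<forall>x\<in>U. g x p \<ge> g u p + ereal (v \<bullet> (x - u)) - ereal (r / 2 * (norm (x - u))\<^sup>2)))) \<and>
    continuous (at (xb, pb, vh) within gph_partial_subdiff g) (\<lambda>(x, p, v). g x p)"

text \<open>
  The base point uses the real number \<open>g(xb, pb)\<close>, so this is meant for finite \<open>g(xb, pb)\<close>,
  which holds whenever \<open>xb\<close> is a solution.
\<close>

definition assumption_A3 ::
    "('x::real_inner \<Rightarrow> 'p::metric_space \<Rightarrow> ereal) \<Rightarrow> 'x \<Rightarrow> 'p \<Rightarrow> bool"
  where "assumption_A3 g xb pb \<longleftrightarrow>
    lipschitz_like (\<lambda>p. epi (\<lambda>x. g x p)) pb (xb, real_of_ereal (g xb pb))"

text \<open>
  The derivative of \<open>f\<close> is frozen at the base point; only the coderivative is taken at the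
  nearby graph points.
\<close>

definition coderivative_condition ::
    "('x::real_inner \<Rightarrow> 'p::metric_space \<Rightarrow> 'x) \<Rightarrow> ('x \<Rightarrow> 'p \<Rightarrow> ereal) \<Rightarrow>
     'x \<Rightarrow> 'p \<Rightarrow> 'x \<Rightarrow> real \<Rightarrow> real \<Rightarrow> bool"
  where "coderivative_condition f g xb pb vh \<eta> \<kappa>0 \<longleftrightarrow>
    (\<forall>(u, p, v) \<in> gph_partial_subdiff g \<inter> cball xb \<eta> \<times> cball pb \<eta> \<times> cball vh \<eta>.
      \<forall>w. \<forall>z \<in> regular_coderivative (\<lambda>x. partial_subdiff g x p) u v w.
        blinfun_apply (partial_grad f xb pb) w \<bullet> w + z \<bullet> w \<ge> \<kappa>0 * (norm w)\<^sup>2)"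

end

theory Submission
  imports Defs
begin

text \<open>
  Write \<open>F p = f(\<cdot>, p) + \<partial>g(\<cdot>, p)\<close>. Both conditions of the theorem say that, near the reference
  point and uniformly in \<open>p\<close>, \<open>F p\<close> is strongly monotone with a modulus close to \<open>\<kappa>\<close>. Indeed for
  equal parameters the stability estimate \<open>norm (a - 2\<kappa> b) \<le> norm a\<close>, with \<open>a = v1 - v2\<close> and
  \<open>b = \<theta>(v1) - \<theta>(v2)\<close>, becomes \<open>\<kappa> norm b ^ 2 \<le> a \<bullet> b\<close> after squaring
  (\<open>stable_iff_strongly_monotone\<close>).
  
  From stability to the coderivative bound (\<open>coderivative_bound_of_stable_inverse\<close>): let
  \<open>z\<close> belong to the coderivative of \<open>\<partial>g(\<cdot>, p)\<close> at \<open>(u, v)\<close> in direction \<open>w\<close>, and let \<open>\<zeta>\<close>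
  represent \<open>q \<mapsto> z \<bullet> q + w \<bullet> D q\<close>, where \<open>D\<close> is the derivative of \<open>f(\<cdot>, p)\<close> at \<open>u\<close>. Moving \<open>v\<close>
  along \<open>h = \<zeta> - 2\<kappa> w\<close>, following the solution and inserting the resulting graph points into the
  normal cone inequality gives \<open>norm h \<le> norm \<zeta>\<close>, and squaring this yields
  \<open>\<kappa> norm w ^ 2 \<le> \<zeta> \<bullet> w\<close>. Replacing \<open>D\<close> by the derivative at the reference point costs an
  arbitrarily small part of \<open>\<kappa>\<close>.
  
  From the coderivative bound to stability there are three steps.
  
  \<^item> Existence (\<open>localizes_prox\<close>). Prox-regularity makes \<open>g(\<cdot>, p) + (\<mu>/2) norm ^ 2\<close> behave like a strongly
  convex function around its critical points when \<open>\<mu>\<close> is large, and the Lipschitz-like epigraphs keep its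
  minimizers over a small ball close to \<open>xb\<close>. In infinite dimensions a lower semicontinuous function need
  not attain its minimum on a ball, but the sum of it and a suitable small linear-quadratic function does
  (\<open>smooth_variational_principle\<close>). So \<open>y \<in> \<mu> x + \<partial>g(x, p)\<close> is solvable for a dense set of \<open>y\<close>, hence for
  all \<open>y\<close> near the reference value, because strong monotonicity makes the solutions converge. The solution is Lipschitz in \<open>y\<close> and, because the
  monotonicity inequality for two different parameters only has an error proportional to
  \<open>dist p1 p2\<close>, it is Hoelder continuous with exponent one half in \<open>p\<close>.
  
  \<^item> Sharp modulus (\<open>inverse_strongly_monotone_if_coderivative_bound\<close>). A Banach fixed point argument
  (\<open>localizes_perturb\<close>) adds \<open>f\<close> and gives the Lipschitz inverse \<open>K\<close> of
  \<open>\<phi> + \<partial>g(\<cdot>, p)\<close>, where \<open>\<phi> x = \<mu> x + f(x, p)\<close>. For every \<open>\<zeta>\<close>, a proximal subgradient \<open>a\<close> of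
  \<open>\<zeta> \<bullet> K\<close> produces a coderivative element of \<open>\<partial>g(\<cdot>, p)\<close> in direction \<open>- a\<close>, so that the hypothesis
  reads \<open>c norm a ^ 2 \<le> \<zeta> \<bullet> a\<close> with \<open>c = \<mu> + \<kappa>\<close>. This says that all proximal subgradients of
  \<open>\<zeta> \<bullet> (2c K - id)\<close> have norm at most \<open>norm \<zeta>\<close>. A continuous function with bounded proximal
  subgradients is Lipschitz (\<open>lipschitz_if_proximal_subgradients_bounded\<close>), so \<open>2c K - id\<close> is
  nonexpansive, which is strong monotonicity of \<open>\<phi> + \<partial>g(\<cdot>, p)\<close> with modulus \<open>\<mu> + \<kappa>\<close>.
  
  \<^item> Removing \<open>\<mu>\<close>. Now \<open>K\<close> has Lipschitz modulus \<open>1 / (\<mu> + \<kappa>)\<close>, and subtracting \<open>\<mu> x\<close> is again a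
  contraction perturbation, because \<open>\<mu> / (\<mu> + \<kappa>) < 1\<close>. It leaves the inverse of \<open>F p\<close>, strongly
  monotone with modulus \<open>\<kappa>\<close>, and Hoelder continuity in \<open>p\<close> is preserved.
\<close>

section \<open>A smooth variational principle\<close>

lemma geometric_steps_converge:
  fixes s :: "nat \<Rightarrow> 'a::{real_normed_vector, complete_space}"
  assumes step: "\<And>k. norm (s (Suc k) - s k) \<le> M * (1/2)^k"
  shows "norm (s k - s 0) \<le> 2 * M" and "convergent s"
proof -
  have M: "0 \<le> M" using step[of 0] norm_ge_zero[of "s (Suc 0) - s 0"] by (simp del: norm_ge_zero)
  have bd: "norm (s (m + j) - s m) \<le> 2 * M * (1/2)^m * (1 - (1/2)^j)" for m j
  proof (induction j)
    case (Suc j)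
    have "norm (s (m + Suc j) - s m) \<le> norm (s (Suc (m + j)) - s (m + j)) + norm (s (m + j) - s m)"
      by (metis add_Suc_right diff_add_cancel add_diff_eq norm_triangle_ineq)
    also have "\<dots> \<le> M * (1/2)^(m + j) + 2 * M * (1/2)^m * (1 - (1/2)^j)"
      using step[of "m + j"] Suc by linarith
    also have "\<dots> = 2 * M * (1/2)^m * (1 - (1/2)^Suc j)"
      by (simp add: power_add algebra_simps)
    finally show ?case .
  qed simp
  have bd': "norm (s (m + j) - s m) \<le> 2 * M * (1/2)^m" for m j
  proof -
    have "2 * M * (1/2)^m * (1 - (1/2)^j) \<le> 2 * M * (1/2)^m * 1"
      using M by (intro mult_left_mono) auto
    then show ?thesis using bd[of m j] by simp
  qed
  show "norm (s k - s 0) \<le> 2 * M" using bd'[of 0 k] by simp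
  have "Cauchy s"
  proof (rule metric_CauchyI)
    fix e :: real assume e: "0 < e"
    have "(\<lambda>m. 2 * M * (1/2)^m) \<longlonglongrightarrow> 2 * M * 0"
      by (intro tendsto_intros) auto
    then have "eventually (\<lambda>m. 2 * M * (1/2)^m < e / 2) sequentially"
      using e by (intro order_tendstoD) auto
    then obtain m where m: "2 * M * (1/2)^m < e / 2" by (auto simp: eventually_sequentially)
    have "dist (s i) (s m) < e / 2" if "i \<ge> m" for i
      using bd'[of m "i - m"] m that by (simp add: dist_norm)
    then show "\<exists>N. \<forall>i\<ge>N. \<forall>j\<ge>N. dist (s i) (s j) < e"
      using dist_triangle_half_l by metis
  qed
  then show "convergent s" by (rule Cauchy_convergent)
qed

lemma near_minimizer:
  fixes H :: "'a \<Rightarrow> real"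
  assumes "E \<noteq> {}" and "\<And>z. z \<in> E \<Longrightarrow> m \<le> H z" and "0 < \<delta>"
  shows "\<exists>z\<in>E. \<forall>z'\<in>E. H z \<le> H z' + \<delta>"
proof -
  have bb: "bdd_below (H ` E)" using assms(2) by (intro bdd_belowI2) auto
  have "Inf (H ` E) < Inf (H ` E) + \<delta>" using assms(3) by simp
  then obtain z where z: "z \<in> E" "H z < Inf (H ` E) + \<delta>"
    using cInf_lessD[of "H ` E"] assms(1) by (metis (no_types, lifting) image_iff image_is_empty)
  show ?thesis
  proof (intro bexI ballI)
    fix z' assume "z' \<in> E"
    then have "Inf (H ` E) \<le> H z'" using bb by (intro cInf_lower) auto
    then show "H z \<le> H z' + \<delta>" using z by simp
  qed (use z in auto)
qed

lemma norm_square_shift: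
  fixes x y z :: "'a::real_inner"
  shows "(norm (z - x))\<^sup>2 = (norm (z - y))\<^sup>2 + 2 * ((y - x) \<bullet> (z - y)) + (norm (y - x))\<^sup>2"
  by (simp add: power2_norm_eq_inner inner_diff_left inner_diff_right inner_commute algebra_simps)

text \<open>
  The Hilbert space form of the principle of Borwein and Preiss, for a closed set \<open>E\<close> that plays the part
  of an epigraph. Each step adds a small multiple of \<open>norm (x' - x k) ^ 2\<close> and passes to a near minimizer of
  the new function. Since a sum of such squares is a single square plus a linear function, only the slope
  \<open>b k\<close> and the coefficient \<open>c k\<close> have to be carried along.
\<close>

lemma smooth_variational_principle:
  fixes E :: "('x::{real_inner, complete_space} \<times> real) set"
  assumes cl: "closed E" and ne: "E \<noteq> {}"
    and below: "\<And>x \<alpha>. (x, \<alpha>) \<in> E \<Longrightarrow> m \<le> \<alpha>" and eps: "0 < \<epsilon>"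
  obtains x \<alpha> b where "(x, \<alpha>) \<in> E" and "norm b \<le> \<epsilon>"
    and "\<And>x' \<alpha>'. (x', \<alpha>') \<in> E \<Longrightarrow> \<alpha> \<le> \<alpha>' + b \<bullet> (x' - x) + \<epsilon> * (norm (x' - x))\<^sup>2"
proof -
  \<comment> \<open>The accuracy must decay faster than the increments of \<open>c\<close>, which control the squared step:
    with these choices \<open>norm (x (Suc k) - x k)\<close> is at most \<open>(1/2)^k / 4\<close>, and \<open>b\<close> stays in the
    ball of radius \<open>\<epsilon>\<close>.\<close>
  define \<delta> :: "nat \<Rightarrow> real" where "\<delta> k = \<epsilon> / 64 * (1/8)^k" for k
  define c :: "nat \<Rightarrow> real" where "c k = \<epsilon> * (1 - (1/2)^k)" for k
  have \<delta>pos: "0 < \<delta> k" for k using eps by (simp add: \<delta>_def)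
  have \<delta>Suc: "\<delta> (Suc k) = \<delta> k / 8" for k by (simp add: \<delta>_def)
  have cSuc: "c (Suc k) - c k = \<epsilon> / 2 * (1/2)^k" for k by (simp add: c_def algebra_simps)
  have c_le: "c k \<le> \<epsilon>" and c_nonneg: "0 \<le> c k" for k
    using eps by (auto simp: c_def algebra_simps power_le_one)
  define Inv where "Inv k t \<longleftrightarrow> (case t of (x, \<alpha>, b) \<Rightarrow>
      (k = 0 \<longrightarrow> b = 0) \<and> (x, \<alpha>) \<in> E \<and>
      (\<forall>(x', \<alpha>')\<in>E. \<alpha> \<le> \<alpha>' + b \<bullet> (x' - x) + c k * (norm (x' - x))\<^sup>2 + \<delta> k))"
    for k :: nat and t :: "'x \<times> real \<times> 'x"
  define Rel where "Rel k t t' \<longleftrightarrow> (case (t, t') of ((x, \<alpha>, b), (x', \<alpha>', b')) \<Rightarrow>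
      b' = b + (2 * c (Suc k)) *\<^sub>R (x' - x) \<and>
      \<alpha>' + b \<bullet> (x' - x) + c (Suc k) * (norm (x' - x))\<^sup>2 \<le> \<alpha> + \<delta> (Suc k))"
    for k :: nat and t t' :: "'x \<times> real \<times> 'x"
  have start: "\<exists>t. Inv 0 t"
  proof -
    obtain z where "z \<in> E" "\<forall>z'\<in>E. snd z \<le> snd z' + \<delta> 0"
      using near_minimizer[OF ne, of m snd "\<delta> 0"] below \<delta>pos by (metis prod.collapse)
    then have "Inv 0 (fst z, snd z, 0)" by (auto simp: Inv_def c_def)
    then show ?thesis ..
  qed
  have next_step: "\<exists>t'. Inv (Suc k) t' \<and> Rel k t t'" if "Inv k t" for k t
  proof -
    obtain x \<alpha> b where t: "t = (x, \<alpha>, b)" by (cases t)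
    define H where "H z = snd z + b \<bullet> (fst z - x) + c (Suc k) * (norm (fst z - x))\<^sup>2" for z
    have inE: "(x, \<alpha>) \<in> E" and
      inv: "\<And>x' \<alpha>'. (x', \<alpha>') \<in> E \<Longrightarrow> \<alpha> \<le> \<alpha>' + b \<bullet> (x' - x) + c k * (norm (x' - x))\<^sup>2 + \<delta> k"
      using that by (auto simp: Inv_def t)
    have "c k \<le> c (Suc k)" using cSuc[of k] eps by (smt (verit) half_gt_zero mult_pos_pos zero_less_power)
    then have "\<alpha> - \<delta> k \<le> H z" if "z \<in> E" for z
      using inv[of "fst z" "snd z"] that mult_right_mono[of "c k" "c (Suc k)" "(norm (fst z - x))\<^sup>2"]
      by (simp add: H_def)
    from near_minimizer[OF ne this \<delta>pos[of "Suc k"]]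
    obtain z where z: "z \<in> E" "\<And>z'. z' \<in> E \<Longrightarrow> H z \<le> H z' + \<delta> (Suc k)" by metis
    define b' where "b' = b + (2 * c (Suc k)) *\<^sub>R (fst z - x)"
    have "snd z \<le> \<alpha>' + b' \<bullet> (x' - fst z) + c (Suc k) * (norm (x' - fst z))\<^sup>2 + \<delta> (Suc k)"
      if "(x', \<alpha>') \<in> E" for x' \<alpha>'
    proof -
      have "H z \<le> H (x', \<alpha>') + \<delta> (Suc k)" using z that by blast
      moreover have "b \<bullet> (x' - x) = b \<bullet> (x' - fst z) + b \<bullet> (fst z - x)"
        by (simp add: inner_diff_right)
      moreover have "b' \<bullet> (x' - fst z) = b \<bullet> (x' - fst z) + 2 * c (Suc k) * ((fst z - x) \<bullet> (x' - fst z))"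
        by (simp add: b'_def inner_add_left)
      ultimately show ?thesis
        unfolding H_def using norm_square_shift[of x' x "fst z"] by (simp add: algebra_simps)
    qed
    then have "Inv (Suc k) (fst z, snd z, b')" using z(1) by (auto simp: Inv_def)
    moreover have "Rel k t (fst z, snd z, b')"
      using z(2)[OF inE] by (simp add: Rel_def t b'_def H_def)
    ultimately show ?thesis by blast
  qed
  obtain s where s: "\<And>k. Inv k (s k)" "\<And>k. Rel k (s k) (s (Suc k))"
    using dependent_nat_choice[of Inv Rel, OF start next_step] by blast
  define x where "x k = fst (s k)" for k
  define \<alpha> where "\<alpha> k = fst (snd (s k))" for k
  define b where "b k = snd (snd (s k))" for k
  have sk: "s k = (x k, \<alpha> k, b k)" for k by (simp add: x_def \<alpha>_def b_def)
  have b0: "b 0 = 0" and inE: "(x k, \<alpha> k) \<in> E" and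
    inv: "(x', \<alpha>') \<in> E \<Longrightarrow> \<alpha> k \<le> \<alpha>' + b k \<bullet> (x' - x k) + c k * (norm (x' - x k))\<^sup>2 + \<delta> k" for k x' \<alpha>'
    using s(1)[of 0] s(1)[of k] by (auto simp: Inv_def sk)
  have bSuc: "b (Suc k) - b k = (2 * c (Suc k)) *\<^sub>R (x (Suc k) - x k)"
    and dec: "\<alpha> (Suc k) + b k \<bullet> (x (Suc k) - x k) + c (Suc k) * (norm (x (Suc k) - x k))\<^sup>2
      \<le> \<alpha> k + \<delta> (Suc k)" for k
    using s(2)[of k] by (auto simp: Rel_def sk)
  \<comment> \<open>Compare the near optimality of step \<open>k\<close>, tested at the new point, with that of step
    \<open>Suc k\<close>, tested at the old one.\<close>
  have dx: "norm (x (Suc k) - x k) \<le> 1/4 * (1/2)^k" for k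
  proof -
    let ?d = "(norm (x (Suc k) - x k))\<^sup>2"
    have "(c (Suc k) - c k) * ?d \<le> \<delta> k + \<delta> (Suc k)"
      using inv[OF inE[of "Suc k"], of k] dec[of k] by (simp add: algebra_simps)
    also have "\<dots> \<le> 2 * \<delta> k" using \<delta>pos[of k] by (simp add: \<delta>Suc)
    finally have "\<epsilon> / 2 * (1/2)^k * ?d \<le> \<epsilon> / 2 * (1/2)^k * (1/4 * (1/2)^k)\<^sup>2"
      unfolding cSuc \<delta>_def by (simp add: power2_eq_square power_divide field_simps flip: power_mult_distrib)
    then have "?d \<le> (1/4 * (1/2)^k)\<^sup>2"
      using eps by (subst (asm) mult_le_cancel_left_pos) auto
    then show ?thesis by (rule power2_le_imp_le) simp
  qed
  have db: "norm (b (Suc k) - b k) \<le> \<epsilon> / 2 * (1/2)^k" for k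
  proof -
    have "norm (b (Suc k) - b k) = 2 * c (Suc k) * norm (x (Suc k) - x k)"
      unfolding bSuc using c_nonneg[of "Suc k"] by simp
    also have "\<dots> \<le> 2 * \<epsilon> * (1/4 * (1/2)^k)"
      using c_le[of "Suc k"] c_nonneg[of "Suc k"] eps dx[of k] by (intro mult_mono) auto
    finally show ?thesis by simp
  qed
  have b_le: "norm (b k) \<le> \<epsilon>" for k
    using geometric_steps_converge(1)[OF db, of k] b0 by simp
  have d\<alpha>: "norm (\<alpha> (Suc k) - \<alpha> k) \<le> \<epsilon> * (1/2)^k" for k
  proof -
    let ?D = "x (Suc k) - x k"
    have "\<bar>b k \<bullet> ?D\<bar> \<le> norm (b k) * norm ?D" by (rule Cauchy_Schwarz_ineq2)
    also have "\<dots> \<le> \<epsilon> * (1/4 * (1/2)^k)" using b_le[of k] dx[of k] eps by (intro mult_mono) auto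
    finally have 1: "\<bar>b k \<bullet> ?D\<bar> \<le> \<epsilon> / 4 * (1/2)^k" by simp
    have "norm ?D * norm ?D \<le> (1/4 * (1/2)^k) * (1/4 * 1)"
      using dx[of k] power_le_one[of "1/2::real" k] by (intro mult_mono) auto
    then have q: "(norm ?D)\<^sup>2 \<le> 1/16 * (1/2)^k" by (simp add: power2_eq_square)
    have 2: "c j * (norm ?D)\<^sup>2 \<le> \<epsilon> / 16 * (1/2)^k" for j
      using mult_mono[OF c_le[of j] q] eps by simp
    have 22: "0 \<le> c j * (norm ?D)\<^sup>2" for j using c_nonneg by simp
    have "(1/8::real)^k \<le> (1/2)^k" by (intro power_mono) auto
    then have 3: "\<delta> k \<le> \<epsilon> / 64 * (1/2)^k" using eps by (simp add: \<delta>_def)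
    have "0 \<le> \<epsilon> * (1/2)^k" using eps by simp
    then show ?thesis
      using inv[OF inE[of "Suc k"], of k] dec[of k, unfolded \<delta>Suc] 1 2[of k] 22[of "Suc k"] 3 \<delta>pos[of k]
      unfolding real_norm_def abs_le_iff by (intro conjI; linarith)
  qed
  obtain x0 \<alpha>0 bl where lims: "x \<longlonglongrightarrow> x0" "\<alpha> \<longlonglongrightarrow> \<alpha>0" "b \<longlonglongrightarrow> bl"
    using geometric_steps_converge(2)[OF dx] geometric_steps_converge(2)[OF d\<alpha>]
      geometric_steps_converge(2)[OF db] unfolding convergent_def by blast
  have "(\<lambda>k. (1/2::real)^k) \<longlonglongrightarrow> 0" "(\<lambda>k. (1/8::real)^k) \<longlonglongrightarrow> 0"
    by (intro LIMSEQ_power_zero; simp)+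
  note powers = this
  have cl': "c \<longlonglongrightarrow> \<epsilon> * (1 - 0)" and dl: "\<delta> \<longlonglongrightarrow> \<epsilon> / 64 * 0"
    unfolding c_def[abs_def] \<delta>_def[abs_def] by (intro tendsto_intros powers)+
  show thesis
  proof
    have "(\<lambda>k. (x k, \<alpha> k)) \<longlonglongrightarrow> (x0, \<alpha>0)" using lims by (intro tendsto_Pair)
    then show "(x0, \<alpha>0) \<in> E" using closed_sequentially[OF cl, of "\<lambda>k. (x k, \<alpha> k)"] inE by blast
    show "norm bl \<le> \<epsilon>" using LIMSEQ_le_const2[OF tendsto_norm[OF lims(3)], of \<epsilon>] b_le by blast
    fix x' \<alpha>' assume z: "(x', \<alpha>') \<in> E"
    have "(\<lambda>k. \<alpha>' + b k \<bullet> (x' - x k) + c k * (norm (x' - x k))\<^sup>2 + \<delta> k) \<longlonglongrightarrow>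
      \<alpha>' + bl \<bullet> (x' - x0) + \<epsilon> * (1 - 0) * (norm (x' - x0))\<^sup>2 + \<epsilon> / 64 * 0"
      by (intro tendsto_intros lims cl' dl)
    from LIMSEQ_le[OF lims(2) this] inv[OF z]
    show "\<alpha>0 \<le> \<alpha>' + bl \<bullet> (x' - x0) + \<epsilon> * (norm (x' - x0))\<^sup>2" by auto
  qed
qed

text \<open>
  The variational principle applied to \<open>norm x ^ 2 / 2 - \<phi> x\<close>: at the point it provides, the slope of the
  quadratic part is \<open>x + b\<close>, and a linear function bounded above by \<open>(x + b) \<bullet> q\<close> up to a
  quadratic term in \<open>q\<close> equals \<open>(x + b) \<bullet> q\<close>.
\<close>

lemma riesz_representation:
  fixes \<phi> :: "'x::{real_inner, complete_space} \<Rightarrow> real"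
  assumes "bounded_linear \<phi>"
  obtains z where "\<And>x. \<phi> x = z \<bullet> x"
proof -
  interpret bounded_linear \<phi> by fact
  obtain K where K: "\<And>x. norm (\<phi> x) \<le> norm x * K" using nonneg_bounded by blast
  define E where "E = {(x, \<alpha>). (norm x)\<^sup>2 / 2 - \<phi> x \<le> \<alpha>}"
  have "continuous_on UNIV \<phi>" by (simp add: linear_continuous_on local.bounded_linear_axioms)
  then have "closed E"
    unfolding E_def case_prod_beta'
    by (intro closed_Collect_le continuous_intros continuous_on_compose2[of UNIV \<phi> _ fst]) auto
  moreover have "- (K\<^sup>2 / 2) \<le> \<alpha>" if "(x, \<alpha>) \<in> E" for x \<alpha>
  proof -
    have "0 \<le> (norm x - K)\<^sup>2" by simp
    then show ?thesis using K[of x] that by (simp add: E_def power2_diff algebra_simps)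
  qed
  moreover have "(0, 0) \<in> E" by (simp add: E_def)
  ultimately obtain x \<alpha> b where xE: "(x, \<alpha>) \<in> E" and
    min: "\<And>x' \<alpha>'. (x', \<alpha>') \<in> E \<Longrightarrow> \<alpha> \<le> \<alpha>' + b \<bullet> (x' - x) + 1 * (norm (x' - x))\<^sup>2"
    using smooth_variational_principle[of E _ 1] by (metis empty_iff zero_less_one)
  have up: "\<phi> q \<le> (x + b) \<bullet> q + 3 / 2 * (norm q)\<^sup>2" for q
  proof -
    have "(x + q, (norm (x + q))\<^sup>2 / 2 - \<phi> (x + q)) \<in> E" by (simp add: E_def)
    from min[OF this] xE show ?thesis
      using norm_square_shift[of "x + q" 0 x] by (simp add: E_def add inner_add_left add_divide_distrib)
  qed
  \<comment> \<open>Scaling \<open>q\<close> by a small \<open>t\<close> makes the quadratic term negligible.\<close>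
  have le: "\<phi> q \<le> (x + b) \<bullet> q" for q
  proof (rule field_le_epsilon)
    fix e :: real assume e: "0 < e"
    define t where "t = e / (3 / 2 * (norm q)\<^sup>2 + 1)"
    have t: "0 < t" using e by (simp add: t_def add_nonneg_pos)
    have "t * \<phi> q \<le> t * ((x + b) \<bullet> q + 3 / 2 * t * (norm q)\<^sup>2)"
      using up[of "t *\<^sub>R q"] t by (simp add: scaleR power_mult_distrib power2_eq_square algebra_simps)
    then have "\<phi> q \<le> (x + b) \<bullet> q + 3 / 2 * t * (norm q)\<^sup>2" using t by simp
    moreover have "t * (3 / 2 * (norm q)\<^sup>2 + 1) = e" by (simp add: t_def add_nonneg_eq_0_iff)
    ultimately show "\<phi> q \<le> (x + b) \<bullet> q + e" using t by (simp add: algebra_simps)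
  qed
  have "\<phi> q = (x + b) \<bullet> q" for q
    using le[of q] le[of "- q"] by (simp add: neg)
  then show thesis using that by blast
qed

section \<open>Proximal subgradients and Lipschitz continuity\<close>

text \<open>
  The square of the positive part has a Lipschitz derivative although it is not twice differentiable. This
  and the next lemma make the penalty below proximally smooth.
\<close>

lemma squared_positive_part_upper:
  fixes s d :: real
  shows "(max 0 (s + d))\<^sup>2 \<le> (max 0 s)\<^sup>2 + 2 * max 0 s * d + d\<^sup>2"
proof (cases "0 \<le> s")
  case True
  then have "(max 0 (s + d))\<^sup>2 \<le> (s + d)\<^sup>2" by (auto simp: max_def)
  then show ?thesis using True by (simp add: power2_sum algebra_simps)
next
  case False
  then have "(max 0 (s + d))\<^sup>2 \<le> d\<^sup>2"
    by (cases "0 \<le> s + d") (auto simp: max_def intro!: power_mono)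
  then show ?thesis using False by simp
qed

text \<open>
  Equivalent to \<open>0 \<le> (norm x' - norm x) ^ 2\<close>.
\<close>

lemma norm_quadratic_upper:
  fixes x x' :: "'a::real_inner"
  assumes "x \<noteq> 0"
  shows "norm x' - norm x \<le> (1 / norm x) * (x \<bullet> (x' - x)) + (norm (x' - x))\<^sup>2 / (2 * norm x)"
proof -
  have pos: "0 < norm x" using assms by simp
  have "0 \<le> (norm x' - norm x)\<^sup>2" by simp
  then have "2 * norm x * (norm x' - norm x) \<le> (norm x')\<^sup>2 - (norm x)\<^sup>2"
    by (simp add: power2_diff power2_eq_square algebra_simps)
  also have "\<dots> = 2 * (x \<bullet> (x' - x)) + (norm (x' - x))\<^sup>2"
    using norm_square_shift[of x' 0 x] by simp
  finally show ?thesis using pos by (simp add: field_simps)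
qed

text \<open>
  Suppose \<open>h\<close> drops from \<open>y2\<close> to \<open>y1\<close> with a slope larger than \<open>L\<close>. Adding a penalty \<open>\<theta> (norm (y - y2))\<close>
  whose slope is at least some \<open>L' > L\<close> still leaves the value at \<open>y1\<close> below the one at \<open>y2\<close>. So
  a minimizer differs from \<open>y2\<close>, the penalty is smooth near it, and \<open>h\<close> has a proximal
  subgradient of norm at least \<open>L'\<close> there. The minimizer comes from the variational principle, with a
  perturbation smaller than \<open>L' - L\<close>.
\<close>

lemma lipschitz_if_proximal_subgradients_bounded:
  fixes h :: "'x::{real_inner, complete_space} \<Rightarrow> real"
  assumes cont: "continuous_on (cball y0 R) h"
    and below: "\<And>y. y \<in> cball y0 R \<Longrightarrow> B \<le> h y"
    and R: "0 < R" and L: "0 \<le> L"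
    and sub: "\<And>y a M r. y \<in> ball y0 R \<Longrightarrow> 0 < r \<Longrightarrow>
      (\<And>y'. y' \<in> ball y r \<Longrightarrow> h y + a \<bullet> (y' - y) - M * (norm (y' - y))\<^sup>2 \<le> h y') \<Longrightarrow> norm a \<le> L"
    and y1: "y1 \<in> ball y0 (R / 5)" and y2: "y2 \<in> ball y0 (R / 5)"
  shows "h y2 - h y1 \<le> L * norm (y2 - y1)"
proof (rule ccontr)
  assume neg: "\<not> h y2 - h y1 \<le> L * norm (y2 - y1)"
  define t0 where "t0 = norm (y2 - y1)"
  have t0: "0 < t0" "t0 < R / 2"
    using neg y1 y2 R dist_triangle2[of y2 y1 y0] by (auto simp: t0_def dist_norm norm_minus_commute)
  have "L < (h y2 - h y1) / t0" using neg t0 by (simp add: t0_def field_simps)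
  then obtain L' where L': "L < L'" "L' < (h y2 - h y1) / t0" using dense by blast
  \<comment> \<open>The gain of \<open>y1\<close> over \<open>y2\<close> that survives the penalty.\<close>
  define \<gamma> where "\<gamma> = h y2 - h y1 - L' * t0"
  have \<gamma>: "0 < \<gamma>" using L'(2) t0 by (simp add: \<gamma>_def field_simps)
  \<comment> \<open>The second part of the penalty vanishes at \<open>y1\<close> and prevents minimizers on the sphere of
    radius \<open>R / 2\<close>.\<close>
  define N where "N = (\<bar>h y2 - B\<bar> + 1) / (R / 2 - t0)\<^sup>2"
  have N: "0 < N" "N * (R / 2 - t0)\<^sup>2 = \<bar>h y2 - B\<bar> + 1" using t0 by (auto simp: N_def)
  define \<theta> where "\<theta> t = L' * t + N * (max 0 (t - t0))\<^sup>2" for t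
  have \<theta>_nonneg: "0 \<le> \<theta> t" if "0 \<le> t" for t using that L' L N by (simp add: \<theta>_def)
  have sub_ball: "cball y2 (R / 2) \<subseteq> ball y0 R"
  proof
    fix y assume "y \<in> cball y2 (R / 2)"
    then show "y \<in> ball y0 R" using y2 R dist_triangle[of y0 y y2] by (auto simp: dist_commute)
  qed
  define E where "E = {(y, \<alpha>). y \<in> cball y2 (R / 2) \<and> h y + \<theta> (norm (y - y2)) \<le> \<alpha>}"
  have "closed E"
  proof -
    have "continuous_on (cball y2 (R / 2)) h"
      using cont sub_ball by (meson ball_subset_cball continuous_on_subset order_trans)
    then have "continuous_on (cball y2 (R / 2) \<times> UNIV) (\<lambda>z. h (fst z))"
      by (rule continuous_on_compose2) (auto intro!: continuous_intros)
    then have "continuous_on (cball y2 (R / 2) \<times> UNIV)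
        (\<lambda>z. h (fst z) + \<theta> (norm (fst z - y2)) - snd z)"
      unfolding \<theta>_def by (intro continuous_intros)
    then have "closed ((cball y2 (R / 2) \<times> UNIV) \<inter>
        (\<lambda>z. h (fst z) + \<theta> (norm (fst z - y2)) - snd z) -` {..0})"
      by (rule continuous_closed_preimage) (auto intro: closed_Times)
    moreover have "E = (cball y2 (R / 2) \<times> UNIV) \<inter>
        (\<lambda>z. h (fst z) + \<theta> (norm (fst z - y2)) - snd z) -` {..0}"
      by (auto simp: E_def)
    ultimately show ?thesis by simp
  qed
  moreover have y1E: "(y1, h y1 + L' * t0) \<in> E"
    using t0 by (auto simp: E_def \<theta>_def t0_def dist_norm norm_minus_commute)
  moreover have "B \<le> \<alpha>" if "(y, \<alpha>) \<in> E" for y \<alpha>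
  proof -
    have "y \<in> cball y0 R" using that sub_ball by (auto simp: E_def)
    then show ?thesis using below[of y] \<theta>_nonneg[of "norm (y - y2)"] that by (auto simp: E_def)
  qed
  moreover define \<epsilon> where "\<epsilon> = min (\<gamma> / (2 * (R + R\<^sup>2))) ((L' - L) / 2)"
  moreover have den: "0 < 2 * (R + R\<^sup>2)" using R by (simp add: add_pos_pos)
  then have \<epsilon>: "0 < \<epsilon>" "\<epsilon> \<le> \<gamma> / (2 * (R + R\<^sup>2))" "\<epsilon> < L' - L"
    using \<gamma> L'(1) den unfolding \<epsilon>_def by (simp_all add: min_less_iff_disj)
  ultimately obtain x \<alpha> b where xE: "(x, \<alpha>) \<in> E" and b: "norm b \<le> \<epsilon>" and
    min: "\<And>x' \<alpha>'. (x', \<alpha>') \<in> E \<Longrightarrow> \<alpha> \<le> \<alpha>' + b \<bullet> (x' - x) + \<epsilon> * (norm (x' - x))\<^sup>2"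
    using smooth_variational_principle[of E B \<epsilon>] by (metis empty_iff)
  define t where "t = norm (x - y2)"
  have x: "t \<le> R / 2" "h x + \<theta> t \<le> \<alpha>"
    using xE by (auto simp: E_def t_def dist_norm norm_minus_commute)
  have "\<alpha> < h y2"
  proof -
    have d: "norm (y1 - x) \<le> R"
      using x(1) t0(2) norm_triangle_ineq[of "y1 - y2" "y2 - x"] R
      by (simp add: t_def t0_def norm_minus_commute)
    have "b \<bullet> (y1 - x) \<le> norm b * norm (y1 - x)" by (rule norm_cauchy_schwarz)
    also have "\<dots> \<le> \<epsilon> * R" using b d \<epsilon> by (intro mult_mono) auto
    finally have 1: "b \<bullet> (y1 - x) \<le> \<epsilon> * R" .
    have 2: "\<epsilon> * (norm (y1 - x))\<^sup>2 \<le> \<epsilon> * R\<^sup>2" using d \<epsilon> by (intro mult_left_mono power_mono) auto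
    have "\<epsilon> * (2 * (R + R\<^sup>2)) \<le> \<gamma>" using \<epsilon>(2) den by (simp add: pos_le_divide_eq)
    then show ?thesis using min[OF y1E] 1 2 \<gamma> by (simp add: \<gamma>_def algebra_simps)
  qed
  then have lt: "h x + \<theta> t < h y2" using x by simp
  have xB: "x \<in> ball y0 R" using xE sub_ball by (auto simp: E_def)
  have tpos: "0 < t" using lt t0 by (auto simp: t_def \<theta>_def)
  have tlt: "t < R / 2"
  proof (rule ccontr)
    assume "\<not> t < R / 2"
    then have "t = R / 2" using x by simp
    then have "max 0 (t - t0) = R / 2 - t0" "0 \<le> L' * t" using t0 L L' R by auto
    then have "\<theta> t \<ge> \<bar>h y2 - B\<bar> + 1" using N by (simp add: \<theta>_def)
    then show False using lt below[of x] xB by simp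
  qed
  \<comment> \<open>\<open>k\<close> is the derivative of \<open>\<theta>\<close> at \<open>t\<close>.\<close>
  define k where "k = L' + 2 * N * max 0 (t - t0)"
  have k: "L' \<le> k" using N by (simp add: k_def)
  then have kpos: "0 < k" using L L'(1) by linarith
  define u where "u = (1 / t) *\<^sub>R (x - y2)"
  have u: "norm u = 1" using tpos by (simp add: u_def t_def)
  have "norm (- (k *\<^sub>R u + b)) \<le> L"
  proof (rule sub[OF xB, of "R / 2 - t" _ "N + k / (2 * t) + \<epsilon>"])
    fix y' assume y': "y' \<in> ball x (R / 2 - t)"
    let ?d = "norm (y' - x)" and ?t' = "norm (y' - y2)"
    have t'd: "?t' \<le> ?d + t" "t \<le> ?d + ?t'"
      using norm_triangle_ineq[of "y' - x" "x - y2"] norm_triangle_ineq[of "x - y'" "y' - y2"]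
      by (simp_all add: t_def norm_minus_commute)
    have "(y', h y' + \<theta> ?t') \<in> E"
      using y' t'd by (auto simp: E_def dist_norm norm_minus_commute)
    from min[OF this] x have 1: "h x + \<theta> t \<le> h y' + \<theta> ?t' + b \<bullet> (y' - x) + \<epsilon> * ?d\<^sup>2" by simp
    have "N * (max 0 ((t - t0) + (?t' - t)))\<^sup>2
        \<le> N * ((max 0 (t - t0))\<^sup>2 + 2 * max 0 (t - t0) * (?t' - t) + (?t' - t)\<^sup>2)"
      using N by (intro mult_left_mono squared_positive_part_upper) auto
    then have 2: "\<theta> ?t' \<le> \<theta> t + k * (?t' - t) + N * (?t' - t)\<^sup>2"
      by (simp add: \<theta>_def k_def algebra_simps)
    have 3: "N * (?t' - t)\<^sup>2 \<le> N * ?d\<^sup>2"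
      using t'd N by (intro mult_left_mono) (auto simp: abs_le_square_iff[symmetric] abs_le_iff)
    have "?t' - t \<le> (1 / t) * ((x - y2) \<bullet> (y' - x)) + ?d\<^sup>2 / (2 * t)"
      using norm_quadratic_upper[of "x - y2" "y' - y2"] tpos by (simp add: t_def)
    then have "?t' - t \<le> u \<bullet> (y' - x) + ?d\<^sup>2 / (2 * t)" by (simp add: u_def)
    then have "k * (?t' - t) \<le> k * (u \<bullet> (y' - x) + ?d\<^sup>2 / (2 * t))"
      using kpos by (intro mult_left_mono) auto
    then show "h x + - (k *\<^sub>R u + b) \<bullet> (y' - x) - (N + k / (2 * t) + \<epsilon>) * ?d\<^sup>2 \<le> h y'"
      using 1 2 3 by (simp add: inner_add_left inner_diff_left algebra_simps)
  qed (use tlt in simp)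
  moreover have "k \<le> norm (k *\<^sub>R u + b) + norm b"
    using norm_triangle_ineq4[of "k *\<^sub>R u + b" b] u kpos by simp
  ultimately show False using k b \<epsilon> unfolding norm_minus_cancel by linarith
qed

section \<open>Subdifferentials, normal cones and epigraphs\<close>

lemma regular_subdiff_if_quadratic_minorant:
  fixes \<phi> :: "'x::real_inner \<Rightarrow> ereal"
  assumes \<phi>x: "\<phi> x = ereal \<gamma>" and r: "0 < r"
    and minorant: "\<And>x'. x' \<in> ball x r \<Longrightarrow>
      ereal (\<gamma> + s \<bullet> (x' - x) - M * (norm (x' - x))\<^sup>2) \<le> \<phi> x'"
  shows "s \<in> regular_subdiff \<phi> x"
proof -
  have "0 \<le> Liminf (at x) (\<lambda>x'. (\<phi> x' - \<phi> x - ereal (s \<bullet> (x' - x))) / ereal (norm (x' - x)))"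
    unfolding le_Liminf_iff
  proof (intro allI impI)
    fix y :: ereal assume y: "y < 0"
    then obtain c where c: "y < ereal c" "c < 0" using ereal_dense2[OF y] by auto
    define d where "d = min r (- c / (\<bar>M\<bar> + 1))"
    have d: "0 < d" "d \<le> r" "d * (\<bar>M\<bar> + 1) \<le> - c"
      using r c(2) by (auto simp: d_def min_le_iff_disj divide_neg_pos simp flip: pos_le_divide_eq)
    have "y < (\<phi> x' - \<phi> x - ereal (s \<bullet> (x' - x))) / ereal (norm (x' - x))"
      if x': "x' \<noteq> x" "dist x' x < d" for x'
    proof -
      let ?n = "norm (x' - x)"
      have n: "0 < ?n" "?n < d" using x' by (auto simp: dist_norm)
      have "?n * (\<bar>M\<bar> + 1) \<le> d * (\<bar>M\<bar> + 1)" using n by (intro mult_right_mono) auto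
      moreover have "M * ?n \<le> ?n * (\<bar>M\<bar> + 1)" using n(1)
        using mult_right_mono[OF abs_ge_self[of M] less_imp_le[OF n(1)]] n(1)
        unfolding distrib_left mult_1_right mult.commute[of ?n "\<bar>M\<bar>"] by linarith
      ultimately have "c \<le> - (M * ?n)" using d(3) by linarith
      then have q: "c * ?n \<le> - M * ?n\<^sup>2"
        using mult_right_mono[of c "- (M * ?n)" ?n] n by (simp add: power2_eq_square)
      have m: "ereal (\<gamma> + s \<bullet> (x' - x) - M * ?n\<^sup>2) \<le> \<phi> x'"
        using x' d by (intro minorant) (auto simp: dist_commute)
      show ?thesis
      proof (cases "\<phi> x'")
        case (real v)
        have "c \<le> (v - \<gamma> - s \<bullet> (x' - x)) / ?n" using m q n real by (simp add: pos_le_divide_eq)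
        then show ?thesis using c real \<phi>x n by (auto intro: less_le_trans)
      next
        case PInf
        then show ?thesis using n c y by (auto simp: \<phi>x)
      qed (use m in auto)
    qed
    then show "\<forall>\<^sub>F x' in at x. y < (\<phi> x' - \<phi> x - ereal (s \<bullet> (x' - x))) / ereal (norm (x' - x))"
      using d(1) unfolding eventually_at by blast
  qed
  then show ?thesis by (simp add: regular_subdiff_def \<phi>x)
qed

lemma limiting_subdiff_if_quadratic_minorant:
  fixes \<phi> :: "'x::real_inner \<Rightarrow> ereal"
  assumes "\<phi> x = ereal \<gamma>" and "0 < r"
    and "\<And>x'. x' \<in> ball x r \<Longrightarrow>
      ereal (\<gamma> + s \<bullet> (x' - x) - M * (norm (x' - x))\<^sup>2) \<le> \<phi> x'"
  shows "s \<in> limiting_subdiff \<phi> x"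
proof -
  have "s \<in> regular_subdiff \<phi> x"
    using assms by (rule regular_subdiff_if_quadratic_minorant)
  then show ?thesis
    unfolding limiting_subdiff_def weakly_converges_def using assms(1)
    by (intro CollectI conjI exI[of _ "\<lambda>k. x"] exI[of _ "\<lambda>k. s"]) auto
qed

lemma regular_normal_cone_iff:
  "\<zeta> \<in> regular_normal_cone \<Omega> zb \<longleftrightarrow>
    zb \<in> \<Omega> \<and> (\<forall>e>0. \<exists>d>0. \<forall>z\<in>\<Omega>. dist z zb < d \<longrightarrow> \<zeta> \<bullet> (z - zb) \<le> e * norm (z - zb))"
  (is "_ \<longleftrightarrow> _ \<and> ?R")
proof -
  have "Limsup (at zb within \<Omega>) (\<lambda>z. ereal (\<zeta> \<bullet> (z - zb) / norm (z - zb))) \<le> 0 \<longleftrightarrow> ?R"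
    (is "?L \<longleftrightarrow> _")
  proof
    assume ?L
    show ?R
    proof (intro allI impI)
      fix e :: real assume "0 < e"
      then have "\<forall>\<^sub>F z in at zb within \<Omega>. ereal (\<zeta> \<bullet> (z - zb) / norm (z - zb)) < ereal e"
        using \<open>?L\<close> unfolding Limsup_le_iff by (metis ereal_less(2))
      then obtain d where d: "0 < d"
        "\<And>z. z \<in> \<Omega> \<Longrightarrow> z \<noteq> zb \<Longrightarrow> dist z zb < d \<Longrightarrow> \<zeta> \<bullet> (z - zb) / norm (z - zb) < e"
        unfolding eventually_at by auto
      have "\<zeta> \<bullet> (z - zb) \<le> e * norm (z - zb)" if "z \<in> \<Omega>" "dist z zb < d" for z
        using d(2)[OF that(1) _ that(2)] by (cases "z = zb") (auto simp: divide_simps)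
      then show "\<exists>d>0. \<forall>z\<in>\<Omega>. dist z zb < d \<longrightarrow> \<zeta> \<bullet> (z - zb) \<le> e * norm (z - zb)"
        using d(1) by blast
    qed
  next
    assume R: ?R
    show ?L
      unfolding Limsup_le_iff
    proof (intro allI impI)
      fix y :: ereal assume y: "0 < y"
      then obtain e where e: "ereal e < y" "0 < e" using ereal_dense2[OF y] by auto
      from R e(2) obtain d where d: "0 < d"
        "\<And>z. z \<in> \<Omega> \<Longrightarrow> dist z zb < d \<Longrightarrow> \<zeta> \<bullet> (z - zb) \<le> e * norm (z - zb)" by blast
      have "ereal (\<zeta> \<bullet> (z - zb) / norm (z - zb)) < y"
        if "z \<in> \<Omega>" "z \<noteq> zb" "dist z zb < d" for z
      proof -
        have "\<zeta> \<bullet> (z - zb) / norm (z - zb) \<le> e"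
          using d(2)[OF that(1,3)] that(2) by (simp add: divide_simps)
        then show ?thesis using e(1) by (meson ereal_less_eq(3) le_less_trans)
      qed
      then show "\<forall>\<^sub>F z in at zb within \<Omega>. ereal (\<zeta> \<bullet> (z - zb) / norm (z - zb)) < y"
        unfolding eventually_at using d(1) by blast
    qed
  qed
  then show ?thesis by (simp add: regular_normal_cone_def)
qed

text \<open>
  Lower semicontinuity for a fixed parameter, in the form in which inequalities along a convergent sequence
  pass to the limit.
\<close>

lemma closed_epi_slice:
  fixes g :: "'x::real_normed_vector \<Rightarrow> 'p::metric_space \<Rightarrow> ereal"
  assumes lsc: "lower_semicontinuous (\<lambda>(x, p). g x p)"
  shows "closed (epi (\<lambda>x. g x p))"
  unfolding closed_sequential_limits
proof (intro allI impI, elim conjE)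
  fix z :: "nat \<Rightarrow> 'x \<times> real" and l
  assume z: "\<forall>n. z n \<in> epi (\<lambda>x. g x p)" "z \<longlonglongrightarrow> l"
  obtain x \<alpha> where l: "l = (x, \<alpha>)" by (cases l)
  show "l \<in> epi (\<lambda>x. g x p)"
  proof (rule ccontr)
    assume "l \<notin> epi (\<lambda>x. g x p)"
    then have "ereal \<alpha> < g x p" by (auto simp: epi_def l)
    then obtain c where c: "\<alpha> < c" "ereal c < g x p" using ereal_dense2 by (metis ereal_less_eq(3) not_le)
    have "g x p \<le> Liminf (at (x, p)) (\<lambda>(x, p). g x p)"
      using lsc unfolding lower_semicontinuous_def by force
    then have "\<forall>\<^sub>F w in at (x, p). ereal c < (case w of (x, p) \<Rightarrow> g x p)"
      using c(2) unfolding le_Liminf_iff by blast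
    then have "\<forall>\<^sub>F w in nhds (x, p). ereal c < (case w of (x, p) \<Rightarrow> g x p)"
      using c(2) by (auto simp: eventually_at_filter elim!: eventually_mono)
    moreover have "(\<lambda>n. (fst (z n), p)) \<longlonglongrightarrow> (x, p)"
      using tendsto_fst[OF z(2)] by (auto simp: l intro!: tendsto_intros)
    ultimately have "\<forall>\<^sub>F n in sequentially. ereal c < g (fst (z n)) p"
      by (auto simp: filterlim_iff)
    moreover have "\<forall>\<^sub>F n in sequentially. snd (z n) < c"
      using tendsto_snd[OF z(2)] c(1) by (auto simp: l intro: order_tendstoD)
    ultimately have "\<forall>\<^sub>F n in sequentially. False"
    proof eventually_elim
      case (elim n)
      then have "ereal (snd (z n)) < g (fst (z n)) p" by (meson ereal_less_eq(3) le_less_trans less_imp_le)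
      then show False using z(1)[rule_format, of n] by (auto simp: epi_def case_prod_beta')
    qed
    then show False by simp
  qed
qed

section \<open>Localizations of inverse mappings and their perturbation\<close>

text \<open>
  Around \<open>(yb, pb, xb)\<close>, \<open>\<theta>\<close> is the localized inverse of \<open>x \<mapsto> M x p + T x p\<close>, with Lipschitz modulus \<open>L\<close> in
  \<open>y\<close> and Hoelder modulus \<open>C\<close> in \<open>p\<close>. The set-valued part \<open>T\<close> and the single-valued part \<open>M\<close> are kept
  apart because \<open>T = \<partial>g\<close> never changes while \<open>M\<close> runs through \<open>\<mu> x\<close>, \<open>\<mu> x + f(x, p)\<close> and
  \<open>f(x, p)\<close>.
\<close>

definition localizes ::
    "('x::real_normed_vector \<Rightarrow> 'p::metric_space \<Rightarrow> 'x set) \<Rightarrow> ('x \<Rightarrow> 'p \<Rightarrow> 'x) \<Rightarrow> 'x \<Rightarrow> 'p \<Rightarrow> 'x \<Rightarrow>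
     real \<Rightarrow> real \<Rightarrow> ('x \<Rightarrow> 'p \<Rightarrow> 'x) \<Rightarrow> real \<Rightarrow> real \<Rightarrow> bool"
  where "localizes T M xb pb yb s \<rho> \<theta> L C \<longleftrightarrow>
    0 < s \<and> 0 < \<rho> \<and> 0 \<le> L \<and> 0 \<le> C \<and> \<theta> yb pb = xb \<and>
    (\<forall>y\<in>ball yb \<rho>. \<forall>p\<in>ball pb \<rho>. \<theta> y p \<in> ball xb s \<and>
      (\<forall>x\<in>ball xb s. y - M x p \<in> T x p \<longleftrightarrow> x = \<theta> y p)) \<and>
    (\<forall>y\<in>ball yb \<rho>. \<forall>y'\<in>ball yb \<rho>. \<forall>p\<in>ball pb \<rho>. \<forall>p'\<in>ball pb \<rho>.
      norm (\<theta> y p - \<theta> y' p') \<le> L * norm (y - y') + C * sqrt (dist p p'))"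

lemma localizesD:
  assumes "localizes T M xb pb yb s \<rho> \<theta> L C"
  shows "0 < s" and "0 < \<rho>" and "0 \<le> L" and "0 \<le> C" and "\<theta> yb pb = xb"
    and "\<And>y p. y \<in> ball yb \<rho> \<Longrightarrow> p \<in> ball pb \<rho> \<Longrightarrow> \<theta> y p \<in> ball xb s"
    and "\<And>y p x. y \<in> ball yb \<rho> \<Longrightarrow> p \<in> ball pb \<rho> \<Longrightarrow> x \<in> ball xb s \<Longrightarrow>
      y - M x p \<in> T x p \<longleftrightarrow> x = \<theta> y p"
    and "\<And>y y' p p'. y \<in> ball yb \<rho> \<Longrightarrow> y' \<in> ball yb \<rho> \<Longrightarrow> p \<in> ball pb \<rho> \<Longrightarrow> p' \<in> ball pb \<rho> \<Longrightarrow>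
      norm (\<theta> y p - \<theta> y' p') \<le> L * norm (y - y') + C * sqrt (dist p p')"
  using assms unfolding localizes_def by blast+

lemma small_radius:
  fixes F :: "real \<Rightarrow> real"
  assumes "(F \<longlongrightarrow> 0) (at_right 0)" and "0 < e" and "0 < \<rho>0"
  obtains \<rho> where "0 < \<rho>" and "\<rho> \<le> \<rho>0" and "F \<rho> < e"
proof -
  have "\<forall>\<^sub>F \<rho> in at_right 0. F \<rho> < e" using assms by (intro order_tendstoD)
  moreover have "\<forall>\<^sub>F \<rho>::real in at_right 0. \<rho> \<in> {0<..<\<rho>0}"
    using assms(3) by (rule eventually_at_right_real)
  ultimately have "\<forall>\<^sub>F \<rho> in at_right 0. F \<rho> < e \<and> \<rho> \<in> {0<..<\<rho>0}"
    by (rule eventually_conj)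
  then obtain \<rho> where "F \<rho> < e" "\<rho> \<in> {0<..<\<rho>0}"
    using eventually_happens'[OF trivial_limit_at_right_real] by blast
  then show thesis using that[of \<rho>] by simp
qed

text \<open>
  Continuity of \<open>\<theta>\<close> at the reference point allows the neighborhood of \<open>xb\<close> to shrink, at the price of smaller
  neighborhoods of \<open>yb\<close> and \<open>pb\<close>.
\<close>

lemma localizes_shrink:
  assumes loc: "localizes T M xb pb yb s \<rho> \<theta> L C" and s': "0 < s'" "s' \<le> s" and \<rho>0: "0 < \<rho>0"
  obtains \<rho>' where "\<rho>' \<le> \<rho>" and "\<rho>' \<le> \<rho>0" and "localizes T M xb pb yb s' \<rho>' \<theta> L C"
proof -
  note D = localizesD[OF loc]
  have "((\<lambda>\<rho>. L * \<rho> + C * sqrt \<rho>) \<longlongrightarrow> L * 0 + C * sqrt 0) (at_right 0)"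
    by (intro tendsto_intros)
  then obtain \<rho>' where \<rho>': "0 < \<rho>'" "\<rho>' \<le> min \<rho> \<rho>0" "L * \<rho>' + C * sqrt \<rho>' < s'"
    using small_radius[of "\<lambda>\<rho>. L * \<rho> + C * sqrt \<rho>" s' "min \<rho> \<rho>0"] s' \<rho>0 D(2) by auto
  have sub: "y \<in> ball yb \<rho>" if "y \<in> ball yb \<rho>'" for y using that \<rho>' by simp
  have subp: "p \<in> ball pb \<rho>" if "p \<in> ball pb \<rho>'" for p using that \<rho>' by simp
  have in_ball: "\<theta> y p \<in> ball xb s'" if "y \<in> ball yb \<rho>'" "p \<in> ball pb \<rho>'" for y p
  proof -
    have "norm (\<theta> y p - \<theta> yb pb) \<le> L * norm (y - yb) + C * sqrt (dist p pb)"
      using that D(2) sub subp by (intro D(8)) auto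
    also have "\<dots> \<le> L * \<rho>' + C * sqrt \<rho>'"
      using that D(3,4) by (intro add_mono mult_left_mono) (auto simp: dist_norm norm_minus_commute dist_commute)
    finally show ?thesis using \<rho>'(3) D(5) by (simp add: dist_norm norm_minus_commute)
  qed
  have "localizes T M xb pb yb s' \<rho>' \<theta> L C"
    unfolding localizes_def using s' \<rho>'(1) D(3-5,8) in_ball D(7) sub subp by auto
  then show thesis by (intro that[of \<rho>']) (use \<rho>'(2) in auto)
qed

text \<open>
  The equation \<open>y \<in> M x p + N x p + T x p\<close> is the fixed point equation
  \<open>x = \<theta> (y - N x p) p\<close>, a contraction with factor \<open>L * m\<close>.
\<close>

lemma localizes_perturb:
  fixes T :: "'x::{real_normed_vector, complete_space} \<Rightarrow> 'p::metric_space \<Rightarrow> 'x set"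
  assumes loc: "localizes T M xb pb yb s \<rho> \<theta> L C"
    and s0: "0 < s0" and m: "0 \<le> m" "L * m < 1" and l: "0 \<le> l"
    and Nx: "\<And>x x' p. x \<in> ball xb s0 \<Longrightarrow> x' \<in> ball xb s0 \<Longrightarrow> p \<in> ball pb s0 \<Longrightarrow>
      norm (N x p - N x' p) \<le> m * norm (x - x')"
    and Np: "\<And>x p p'. x \<in> ball xb s0 \<Longrightarrow> p \<in> ball pb s0 \<Longrightarrow> p' \<in> ball pb s0 \<Longrightarrow>
      norm (N x p - N x p') \<le> l * dist p p'"
  obtains s' \<rho>' \<theta>' C' where
    "localizes T (\<lambda>x p. M x p + N x p) xb pb (yb + N xb pb) s' \<rho>' \<theta>' (L / (1 - L * m)) C'"
proof -
  note D = localizesD[OF loc]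
  \<comment> \<open>\<open>m * s' < \<rho> / 2\<close> keeps \<open>y - N x p\<close> in the domain of \<open>\<theta>\<close>; the bound \<open>e\<close> on the remaining terms
    makes the iteration map \<open>cball xb s'\<close> into the open ball, so that fixed points in either coincide.\<close>
  define s' where "s' = min (min s s0 / 2) (\<rho> / (2 * (m + 1)))"
  have s': "0 < s'" "s' < s" "s' < s0" and "s' \<le> \<rho> / (2 * (m + 1))"
    using D(1,2) s0 m unfolding s'_def by (auto simp: min_less_iff_disj)
  then have "s' * (2 * (m + 1)) \<le> \<rho>" using m by (subst (asm) pos_le_divide_eq) auto
  then have ms': "m * s' < \<rho> / 2" using s' by (simp add: algebra_simps)
  define e where "e = min (\<rho> / 2 - m * s') ((1 - L * m) * s')"
  have e: "0 < e" using ms' m s' by (simp add: e_def)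
  have "((\<lambda>\<rho>'. max ((1 + l) * \<rho>') (L * ((1 + l) * \<rho>') + C * sqrt \<rho>')) \<longlongrightarrow>
      max ((1 + l) * 0) (L * ((1 + l) * 0) + C * sqrt 0)) (at_right 0)"
    by (intro tendsto_intros)
  then obtain \<rho>' where \<rho>': "0 < \<rho>'" "\<rho>' \<le> min (min \<rho> s0) (1/2)"
    and \<rho>'e: "(1 + l) * \<rho>' < e" "L * ((1 + l) * \<rho>') + C * sqrt \<rho>' < e"
    using small_radius[of "\<lambda>\<rho>'. max ((1 + l) * \<rho>') (L * ((1 + l) * \<rho>') + C * sqrt \<rho>')" e "min (min \<rho> s0) (1/2)"]
      e D(2) s0 by auto
  let ?yb = "yb + N xb pb"
  have p_in: "p \<in> ball pb \<rho>" "p \<in> ball pb s0" if "p \<in> ball pb \<rho>'" for p using that \<rho>' by auto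
  have x_in: "x \<in> ball xb s" "x \<in> ball xb s0" if "x \<in> cball xb s'" for x using that s' by auto
  have dev: "norm (y - N x p - yb) \<le> (1 + l) * \<rho>' + m * s'"
    if "y \<in> ball ?yb \<rho>'" "p \<in> ball pb \<rho>'" "x \<in> cball xb s'" for y p x
  proof -
    have "y - N x p - yb = (y - ?yb) + ((N xb p - N x p) + (N xb pb - N xb p))" by simp
    then have "norm (y - N x p - yb) \<le> norm (y - ?yb) + (norm (N xb p - N x p) + norm (N xb pb - N xb p))"
      by (metis norm_triangle_le add_left_mono norm_triangle_ineq)
    moreover have "norm (N xb p - N x p) \<le> m * norm (xb - x)"
      using that s' by (intro Nx x_in p_in) auto
    moreover have "m * norm (xb - x) \<le> m * s'"
      using that m by (intro mult_left_mono) (auto simp: dist_norm)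
    moreover have "norm (N xb pb - N xb p) \<le> l * dist pb p"
      using that s' \<rho>' by (intro Np x_in p_in) auto
    moreover have "l * dist pb p \<le> l * \<rho>'" using that l by (intro mult_left_mono) auto
    ultimately show ?thesis using that by (simp add: algebra_simps dist_norm norm_minus_commute)
  qed
  have y_in: "y - N x p \<in> ball yb \<rho>"
    if "y \<in> ball ?yb \<rho>'" "p \<in> ball pb \<rho>'" "x \<in> cball xb s'" for y p x
  proof -
    have "(1 + l) * \<rho>' + m * s' < \<rho>" using \<rho>'e ms' D(2) by (simp add: e_def)
    then show ?thesis using dev[OF that] by (simp add: dist_norm norm_minus_commute)
  qed
  have fix_ex: "\<exists>!x. x \<in> cball xb s' \<and> \<theta> (y - N x p) p = x"
    and fix_in: "x \<in> cball xb s' \<Longrightarrow> \<theta> (y - N x p) p \<in> ball xb s'"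
    if y: "y \<in> ball ?yb \<rho>'" and p: "p \<in> ball pb \<rho>'" for y p x
  proof -
    show self: "\<theta> (y - N x p) p \<in> ball xb s'" if x: "x \<in> cball xb s'" for x
    proof -
      have "norm (\<theta> (y - N x p) p - \<theta> yb pb) \<le> L * norm (y - N x p - yb) + C * sqrt (dist p pb)"
        using y_in[OF y p x] p_in[OF p] D(2) by (intro D(8)) auto
      also have "\<dots> \<le> L * ((1 + l) * \<rho>' + m * s') + C * sqrt \<rho>'"
        using dev[OF y p x] p D(3,4) by (intro add_mono mult_left_mono) (auto simp: dist_commute)
      also have "\<dots> < s'" using \<rho>'e(2) by (simp add: e_def algebra_simps)
      finally show ?thesis by (simp add: D(5) dist_norm norm_minus_commute)
    qed
    have "\<exists>!x\<in>cball xb s'. \<theta> (y - N x p) p = x"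
    proof (rule Banach_fix)
      show "complete (cball xb s')" by (simp add: complete_eq_closed)
      show "cball xb s' \<noteq> {}" "0 \<le> L * m" "L * m < 1" using s' D(3) m by auto
      show "(\<lambda>x. \<theta> (y - N x p) p) ` cball xb s' \<subseteq> cball xb s'" using self by (force simp: less_imp_le)
      fix x x' assume x: "x \<in> cball xb s'" "x' \<in> cball xb s'"
      have "norm (\<theta> (y - N x p) p - \<theta> (y - N x' p) p)
          \<le> L * norm ((y - N x p) - (y - N x' p)) + C * sqrt (dist p p)"
        using x y p by (intro D(8) y_in p_in)
      also have "norm ((y - N x p) - (y - N x' p)) = norm (N x' p - N x p)" by simp
      also have "L * norm (N x' p - N x p) + C * sqrt (dist p p) \<le> L * (m * norm (x' - x))"
        using Nx[of x' x p] x p D(3) by (simp add: mult_left_mono x_in p_in del: mem_ball)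
      finally show "dist (\<theta> (y - N x p) p) (\<theta> (y - N x' p) p) \<le> L * m * dist x x'"
        by (simp add: dist_norm norm_minus_commute mult.assoc)
    qed
    then show "\<exists>!x. x \<in> cball xb s' \<and> \<theta> (y - N x p) p = x" by blast
  qed
  define \<theta>' where "\<theta>' y p = (THE x. x \<in> cball xb s' \<and> \<theta> (y - N x p) p = x)" for y p
  have \<theta>': "\<theta>' y p \<in> cball xb s'" "\<theta> (y - N (\<theta>' y p) p) p = \<theta>' y p"
    if "y \<in> ball ?yb \<rho>'" "p \<in> ball pb \<rho>'" for y p
    using theI'[OF fix_ex[OF that]] unfolding \<theta>'_def by auto
  have \<theta>'_eq: "\<theta>' y p = x"
    if "y \<in> ball ?yb \<rho>'" "p \<in> ball pb \<rho>'" "x \<in> cball xb s'" "\<theta> (y - N x p) p = x" for y p x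
    using fix_ex[OF that(1,2)] \<theta>'[OF that(1,2)] that(3,4) by blast
  define C' where "C' = (L * l + C) / (1 - L * m)"
  have "localizes T (\<lambda>x p. M x p + N x p) xb pb ?yb s' \<rho>' \<theta>' (L / (1 - L * m)) C'"
    unfolding localizes_def
  proof (intro conjI ballI)
    show "\<theta>' ?yb pb = xb" using s' \<rho>' D(5) by (intro \<theta>'_eq) auto
    show "0 \<le> L / (1 - L * m)" "0 \<le> C'" using D(3,4) l m by (auto simp: C'_def)
    show "\<theta>' y p \<in> ball xb s'" if "y \<in> ball ?yb \<rho>'" "p \<in> ball pb \<rho>'" for y p
      using fix_in[OF that \<theta>'(1)[OF that]] \<theta>'(2)[OF that] by simp
    show "y - (M x p + N x p) \<in> T x p \<longleftrightarrow> x = \<theta>' y p"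
      if y: "y \<in> ball ?yb \<rho>'" and p: "p \<in> ball pb \<rho>'" and x: "x \<in> ball xb s'" for y p x
    proof -
      have x': "x \<in> cball xb s'" using x by simp
      have "y - (M x p + N x p) = (y - N x p) - M x p" by simp
      then show ?thesis
        using D(7)[OF y_in[OF y p x'] p_in(1)[OF p] x_in(1)[OF x']] \<theta>'_eq[OF y p x'] \<theta>'(2)[OF y p]
        by metis
    qed
    show "norm (\<theta>' y p - \<theta>' y' p') \<le> L / (1 - L * m) * norm (y - y') + C' * sqrt (dist p p')"
      if y: "y \<in> ball ?yb \<rho>'" and y': "y' \<in> ball ?yb \<rho>'" and p: "p \<in> ball pb \<rho>'" and p': "p' \<in> ball pb \<rho>'"
      for y y' p p'
    proof -
      let ?x = "\<theta>' y p" and ?x' = "\<theta>' y' p'"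
      have "norm (\<theta> (y - N ?x p) p - \<theta> (y' - N ?x' p') p')
          \<le> L * norm ((y - N ?x p) - (y' - N ?x' p')) + C * sqrt (dist p p')"
        using y p y' p' by (intro D(8) y_in p_in \<theta>')
      then have 1: "norm (?x - ?x') \<le> L * norm ((y - N ?x p) - (y' - N ?x' p')) + C * sqrt (dist p p')"
        by (simp add: \<theta>'(2)[OF y p] \<theta>'(2)[OF y' p'])
      have "(y - N ?x p) - (y' - N ?x' p') = (y - y') + ((N ?x' p - N ?x p) + (N ?x' p' - N ?x' p))"
        by simp
      then have "norm ((y - N ?x p) - (y' - N ?x' p')) \<le>
          norm (y - y') + (norm (N ?x' p - N ?x p) + norm (N ?x' p' - N ?x' p))"
        by (metis norm_triangle_le add_left_mono norm_triangle_ineq)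
      moreover have "norm (N ?x' p - N ?x p) \<le> m * norm (?x' - ?x)"
        using y p y' p' by (intro Nx x_in p_in \<theta>')
      moreover have "norm (N ?x' p' - N ?x' p) \<le> l * dist p' p"
        using y p y' p' by (intro Np x_in p_in \<theta>')
      \<comment> \<open>Parameters at distance at most one: a Lipschitz error is also a Hoelder error.\<close>
      moreover have "dist p p' \<le> sqrt (dist p p')"
      proof -
        have "dist p p' \<le> 1"
          using dist_triangle2[of p p' pb] p p' \<rho>'(2) by (auto simp: dist_commute)
        then have "(dist p p')\<^sup>2 \<le> dist p p'" by (simp add: power2_eq_square mult_left_le)
        then show ?thesis by (rule real_le_rsqrt)
      qed
      then have "l * dist p' p \<le> l * sqrt (dist p p')" using l by (simp add: mult_left_mono dist_commute)
      ultimately have "norm ((y - N ?x p) - (y' - N ?x' p')) \<le>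
          norm (y - y') + m * norm (?x - ?x') + l * sqrt (dist p p')"
        by (simp add: norm_minus_commute)
      then have "L * norm ((y - N ?x p) - (y' - N ?x' p')) \<le>
          L * (norm (y - y') + m * norm (?x - ?x') + l * sqrt (dist p p'))"
        using D(3) by (rule mult_left_mono)
      with 1 have "(1 - L * m) * norm (?x - ?x') \<le> L * norm (y - y') + (L * l + C) * sqrt (dist p p')"
        by (simp add: algebra_simps)
      then have "norm (?x - ?x') \<le> (L * norm (y - y') + (L * l + C) * sqrt (dist p p')) / (1 - L * m)"
        using m by (subst pos_le_divide_eq) (auto simp: mult.commute)
      then show ?thesis by (simp add: C'_def add_divide_distrib[of "L * norm (y - y')"])
    qed
  qed (use s' \<rho>' in auto)
  then show thesis by (rule that)
qed

section \<open>Consequences of prox-regularity and of Lipschitz-like epigraphs\<close>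

text \<open>
  Parametric prox-regularity and the Lipschitz-like property of the epigraphs, on common balls and with
  \<open>gb = g(xb, pb)\<close>. Continuity of \<open>g\<close> relative to the graph of its subdifferential appears as
  \<open>\<bar>\<gamma> - gb\<bar> < \<tau>\<close>: it turns the restriction to small function values in prox-regularity into a consequence,
  and it puts the epigraph points \<open>(u, \<gamma>)\<close> into the region where the Lipschitz-like property holds.
\<close>

definition prox_bounds ::
    "('x::real_inner \<Rightarrow> 'p::metric_space \<Rightarrow> ereal) \<Rightarrow> 'x \<Rightarrow> 'p \<Rightarrow> 'x \<Rightarrow> real \<Rightarrow> real \<Rightarrow> real \<Rightarrow> real \<Rightarrow> real \<Rightarrow> bool"
  where "prox_bounds g xb pb vh gb r l \<sigma> \<tau> \<longleftrightarrow>
    0 < r \<and> 0 < l \<and> 0 < \<sigma> \<and> 0 < \<tau> \<and> g xb pb = ereal gb \<and> vh \<in> partial_subdiff g xb pb \<and>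
    (\<forall>u\<in>ball xb \<sigma>. \<forall>p\<in>ball pb \<sigma>. \<forall>v\<in>ball vh \<sigma>. v \<in> partial_subdiff g u p \<longrightarrow>
      (\<exists>\<gamma>. g u p = ereal \<gamma> \<and> \<bar>\<gamma> - gb\<bar> < \<tau> \<and>
        (\<forall>x\<in>ball xb \<sigma>. ereal (\<gamma> + v \<bullet> (x - u) - r / 2 * (norm (x - u))\<^sup>2) \<le> g x p))) \<and>
    (\<forall>p\<in>ball pb \<sigma>. \<forall>q\<in>ball pb \<sigma>. \<forall>x\<in>ball xb \<sigma>. \<forall>\<alpha>. \<bar>\<alpha> - gb\<bar> < \<tau> \<and> g x p \<le> ereal \<alpha> \<longrightarrow>
      (\<exists>x'. g x' q \<le> ereal (\<alpha> + l * dist p q) \<and> norm (x' - x) \<le> l * dist p q))"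

lemma prox_boundsD:
  assumes "prox_bounds g xb pb vh gb r l \<sigma> \<tau>"
  shows "0 < r" and "0 < l" and "0 < \<sigma>" and "0 < \<tau>" and "g xb pb = ereal gb"
    and "vh \<in> partial_subdiff g xb pb"
    and "\<And>u p v. u \<in> ball xb \<sigma> \<Longrightarrow> p \<in> ball pb \<sigma> \<Longrightarrow> v \<in> ball vh \<sigma> \<Longrightarrow> v \<in> partial_subdiff g u p \<Longrightarrow>
      \<exists>\<gamma>. g u p = ereal \<gamma> \<and> \<bar>\<gamma> - gb\<bar> < \<tau> \<and>
        (\<forall>x\<in>ball xb \<sigma>. ereal (\<gamma> + v \<bullet> (x - u) - r / 2 * (norm (x - u))\<^sup>2) \<le> g x p)"
    and "\<And>p q x \<alpha>. p \<in> ball pb \<sigma> \<Longrightarrow> q \<in> ball pb \<sigma> \<Longrightarrow> x \<in> ball xb \<sigma> \<Longrightarrow> \<bar>\<alpha> - gb\<bar> < \<tau> \<Longrightarrow>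
      g x p \<le> ereal \<alpha> \<Longrightarrow> \<exists>x'. g x' q \<le> ereal (\<alpha> + l * dist p q) \<and> norm (x' - x) \<le> l * dist p q"
  using assms unfolding prox_bounds_def by blast+

lemma prox_bounds_exist:
  fixes g :: "'x::real_inner \<Rightarrow> 'p::metric_space \<Rightarrow> ereal"
  assumes g_not_MInfty: "\<And>x p. g x p \<noteq> -\<infinity>"
    and vh: "vh \<in> partial_subdiff g xb pb"
    and A2: "parametrically_continuously_prox_regular g xb pb vh"
    and A3: "assumption_A3 g xb pb"
  obtains gb r l \<sigma> \<tau> where "prox_bounds g xb pb vh gb r l \<sigma> \<tau>"
proof -
  have "g xb pb < \<infinity>" using vh by (auto simp: partial_subdiff_def limiting_subdiff_def)
  then obtain gb where gb: "g xb pb = ereal gb" using g_not_MInfty[of xb pb] by (cases "g xb pb") auto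
  obtain Q W l where Q: "pb \<in> interior Q" and W: "(xb, gb) \<in> interior W" and l: "0 < l" and
    lip: "\<And>p q. p \<in> Q \<Longrightarrow> q \<in> Q \<Longrightarrow> epi (\<lambda>x. g x p) \<inter> W \<subseteq>
      {y + (l * dist p q) *\<^sub>R b | y b. y \<in> epi (\<lambda>x. g x q) \<and> b \<in> cball 0 1}"
    using A3 unfolding assumption_A3_def lipschitz_like_def gb by auto
  obtain U' V' Q' \<epsilon> r where U': "xb \<in> interior U'" "vh \<in> interior V'" "pb \<in> interior Q'"
    and \<epsilon>: "0 < \<epsilon>" and r: "0 < r"
    and prox: "\<And>u p v x. v \<in> partial_subdiff g u p \<inter> V' \<Longrightarrow> u \<in> U' \<Longrightarrow> p \<in> Q' \<Longrightarrow>
      g u p \<le> g xb pb + ereal \<epsilon> \<Longrightarrow> x \<in> U' \<Longrightarrow>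
      g x p \<ge> g u p + ereal (v \<bullet> (x - u)) - ereal (r / 2 * (norm (x - u))\<^sup>2)"
    and cont: "continuous (at (xb, pb, vh) within gph_partial_subdiff g) (\<lambda>(x, p, v). g x p)"
    using A2 unfolding parametrically_continuously_prox_regular_def by blast
  obtain e where e: "0 < e" "ball (xb, gb) e \<subseteq> W" using W by (auto simp: mem_interior)
  obtain eQ where eQ: "0 < eQ" "ball pb eQ \<subseteq> Q" using Q by (auto simp: mem_interior)
  obtain e1 e2 e3 where e': "0 < e1" "ball xb e1 \<subseteq> U'" "0 < e2" "ball vh e2 \<subseteq> V'" "0 < e3" "ball pb e3 \<subseteq> Q'"
    using U' by (auto simp: mem_interior)
  define \<tau> where "\<tau> = min (e / 2) \<epsilon>"
  have \<tau>: "0 < \<tau>" "\<tau> \<le> e / 2" "\<tau> \<le> \<epsilon>" using e \<epsilon> by (auto simp: \<tau>_def)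
  have "((\<lambda>(x, p, v). g x p) \<longlongrightarrow> ereal gb) (at (xb, pb, vh) within gph_partial_subdiff g)"
    using cont by (simp add: continuous_within gb)
  then have "\<forall>\<^sub>F (x, p, v) in at (xb, pb, vh) within gph_partial_subdiff g.
      ereal (gb - \<tau>) < g x p \<and> g x p < ereal (gb + \<tau>)"
    using \<tau> order_tendstoD[of _ "ereal gb" _ "ereal (gb - \<tau>)"] order_tendstoD[of _ "ereal gb" _ "ereal (gb + \<tau>)"]
    by (auto simp: eventually_conj_iff case_prod_beta')
  then obtain d where d: "0 < d" and near: "\<And>x p v. (x, p, v) \<in> gph_partial_subdiff g \<Longrightarrow>
      (x, p, v) \<noteq> (xb, pb, vh) \<Longrightarrow> dist (x, p, v) (xb, pb, vh) < d \<Longrightarrow>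
      ereal (gb - \<tau>) < g x p \<and> g x p < ereal (gb + \<tau>)"
    unfolding eventually_at case_prod_beta' by (metis fst_conv snd_conv)
  define \<sigma> where "\<sigma> = Min {e / 2, eQ, e1, e2, e3, d / 3}"
  have \<sigma>: "0 < \<sigma>" "\<sigma> \<le> e / 2" "\<sigma> \<le> eQ" "\<sigma> \<le> e1" "\<sigma> \<le> e2" "\<sigma> \<le> e3" "\<sigma> \<le> d / 3"
    using e eQ e' d by (auto simp: \<sigma>_def)
  have "\<exists>\<gamma>. g u p = ereal \<gamma> \<and> \<bar>\<gamma> - gb\<bar> < \<tau> \<and>
        (\<forall>x\<in>ball xb \<sigma>. ereal (\<gamma> + v \<bullet> (x - u) - r / 2 * (norm (x - u))\<^sup>2) \<le> g x p)"
    if u: "u \<in> ball xb \<sigma>" and p: "p \<in> ball pb \<sigma>" and v: "v \<in> ball vh \<sigma>" and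
      sub: "v \<in> partial_subdiff g u p" for u p v
  proof -
    have "dist (u, p, v) (xb, pb, vh) \<le> dist u xb + (dist p pb + dist v vh)"
      unfolding dist_Pair_Pair
      by (rule order_trans[OF sqrt_sum_squares_le_sum]) (auto intro!: add_left_mono sqrt_sum_squares_le_sum)
    also have "\<dots> < d" using u p v \<sigma> by (simp add: dist_commute)
    finally have "ereal (gb - \<tau>) < g u p \<and> g u p < ereal (gb + \<tau>)"
      using near[of u p v] sub \<tau> gb by (cases "(u, p, v) = (xb, pb, vh)") (auto simp: gph_partial_subdiff_def)
    then obtain \<gamma> where \<gamma>: "g u p = ereal \<gamma>" "gb - \<tau> < \<gamma>" "\<gamma> < gb + \<tau>" by (cases "g u p") auto
    have "ereal (\<gamma> + v \<bullet> (x - u) - r / 2 * (norm (x - u))\<^sup>2) \<le> g x p" if x: "x \<in> ball xb \<sigma>" for x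
    proof -
      have "u \<in> U'" "x \<in> U'"
        by (rule subsetD[OF e'(2)]; use u x \<sigma>(4) in simp)+
      moreover have "p \<in> Q'" by (rule subsetD[OF e'(6)]) (use p \<sigma>(6) in simp)
      moreover have "v \<in> V'" by (rule subsetD[OF e'(4)]) (use v \<sigma>(5) in simp)
      ultimately have "u \<in> U'" "x \<in> U'" "p \<in> Q'" "v \<in> V'" by auto
      then show ?thesis using prox[of v u p x] sub \<gamma> gb \<tau> by simp
    qed
    then show ?thesis using \<gamma> by (intro exI[of _ \<gamma>]) (auto simp: abs_less_iff)
  qed
  moreover have "\<exists>x'. g x' q \<le> ereal (\<alpha> + l * dist p q) \<and> norm (x' - x) \<le> l * dist p q"
    if p: "p \<in> ball pb \<sigma>" and q: "q \<in> ball pb \<sigma>" and x: "x \<in> ball xb \<sigma>" and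
      \<alpha>: "\<bar>\<alpha> - gb\<bar> < \<tau>" and le: "g x p \<le> ereal \<alpha>" for p q x \<alpha>
  proof -
    have "dist (x, \<alpha>) (xb, gb) \<le> dist x xb + dist \<alpha> gb"
      unfolding dist_Pair_Pair by (rule sqrt_sum_squares_le_sum) auto
    also have "\<dots> < e" using x \<alpha> \<sigma> \<tau> by (simp add: dist_commute dist_real_def)
    finally have "(x, \<alpha>) \<in> W" by (intro subsetD[OF e(2)]) (simp add: dist_commute)
    moreover have "p \<in> Q" "q \<in> Q"
      by (rule subsetD[OF eQ(2)]; use p q \<sigma>(3) in simp)+
    moreover have "(x, \<alpha>) \<in> epi (\<lambda>x. g x p)" using le by (simp add: epi_def)
    ultimately have "(x, \<alpha>) \<in> {y + (l * dist p q) *\<^sub>R b | y b. y \<in> epi (\<lambda>x. g x q) \<and> b \<in> cball 0 1}"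
      using lip[of p q] by blast
    then obtain x' \<alpha>' b1 b2 where xe: "g x' q \<le> ereal \<alpha>'" and b: "norm (b1, b2) \<le> 1"
      and eq: "x = x' + (l * dist p q) *\<^sub>R b1" "\<alpha> = \<alpha>' + l * dist p q * b2"
      by (auto simp: epi_def)
    have b': "norm b1 \<le> 1" "\<bar>b2\<bar> \<le> 1"
      using b norm_fst_le[of b1 b2] norm_snd_le[of b2 b1] by auto
    have ld: "0 \<le> l * dist p q" using l by simp
    have "norm (x' - x) = l * dist p q * norm b1" using l by (simp add: eq)
    then have "norm (x' - x) \<le> l * dist p q" using mult_left_le[OF b'(1) ld] by simp
    moreover have "- (l * dist p q) \<le> l * dist p q * b2" 
      using mult_left_mono[of "-1" b2, OF _ ld] b' by (simp add: abs_le_iff)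
    then have "\<alpha>' \<le> \<alpha> + l * dist p q" by (simp add: eq)
    then have "g x' q \<le> ereal (\<alpha> + l * dist p q)" using xe order_trans by fastforce
    ultimately show ?thesis by blast
  qed
  ultimately have "prox_bounds g xb pb vh gb r l \<sigma> \<tau>"
    unfolding prox_bounds_def using r l \<sigma>(1) \<tau>(1) gb vh by blast
  then show thesis by (rule that)
qed

text \<open>
  The prox-regularity inequality at \<open>(u1, p1)\<close> cannot be evaluated at \<open>(u2, p2)\<close> directly; it is evaluated
  at the point \<open>(u', p1)\<close> that the Lipschitz-like property provides near \<open>(u2, p2)\<close>.
\<close>

lemma prox_values_across_parameters:
  assumes pr: "prox_bounds g xb pb vh gb r l \<sigma> \<tau>"
    and u1: "u1 \<in> ball xb (\<sigma> / 2)" and u2: "u2 \<in> ball xb (\<sigma> / 2)"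
    and p1: "p1 \<in> ball pb \<sigma>" and p2: "p2 \<in> ball pb \<sigma>"
    and v1: "v1 \<in> ball vh \<sigma>" "v1 \<in> partial_subdiff g u1 p1" and g1: "g u1 p1 = ereal \<gamma>1"
    and g2: "g u2 p2 \<le> ereal \<gamma>2" and \<gamma>2: "\<bar>\<gamma>2 - gb\<bar> < \<tau>"
    and d: "l * dist p1 p2 \<le> \<sigma> / 2"
  shows "\<gamma>1 + v1 \<bullet> (u2 - u1) - r / 2 * (norm (u2 - u1))\<^sup>2
    - (1 + (norm vh + \<sigma>) + 3 * r / 2 * \<sigma>) * l * dist p1 p2 \<le> \<gamma>2"
proof -
  note D = prox_boundsD[OF pr]
  let ?d = "l * dist p1 p2"
  have d0: "0 \<le> ?d" using D(2) by simp
  have "u2 \<in> ball xb \<sigma>" using u2 D(3) by simp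
  from D(8)[OF p2 p1 this \<gamma>2 g2]
  obtain u' where u': "g u' p1 \<le> ereal (\<gamma>2 + ?d)" "norm (u' - u2) \<le> ?d" by (auto simp: dist_commute)
  have "u1 \<in> ball xb \<sigma>" using u1 D(3) by simp
  moreover have "u' \<in> ball xb \<sigma>"
    using u2 u'(2) d dist_triangle[of xb u' u2] by (auto simp: dist_norm norm_minus_commute)
  ultimately have "ereal (\<gamma>1 + v1 \<bullet> (u' - u1) - r / 2 * (norm (u' - u1))\<^sup>2) \<le> g u' p1"
    using D(7)[OF _ p1 v1] g1 by fastforce
  then have 1: "\<gamma>1 + v1 \<bullet> (u' - u1) - r / 2 * (norm (u' - u1))\<^sup>2 \<le> \<gamma>2 + ?d"
    using u'(1) order_trans by fastforce
  have "norm v1 \<le> norm vh + \<sigma>" using v1(1) norm_triangle_sub[of v1 vh] by (simp add: dist_norm norm_minus_commute)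
  then have "norm v1 * norm (u' - u2) \<le> (norm vh + \<sigma>) * ?d" using u'(2) D(3) by (intro mult_mono) auto
  moreover have "\<bar>v1 \<bullet> (u' - u2)\<bar> \<le> norm v1 * norm (u' - u2)" by (rule Cauchy_Schwarz_ineq2)
  ultimately have 2: "v1 \<bullet> (u' - u1) \<ge> v1 \<bullet> (u2 - u1) - (norm vh + \<sigma>) * ?d"
    by (simp add: inner_diff_right)
  have n: "norm (u2 - u1) \<le> \<sigma>"
    using u1 u2 dist_triangle2[of u2 u1 xb] by (simp add: dist_norm norm_minus_commute)
  have "norm (u' - u1) \<le> norm (u2 - u1) + ?d"
    using norm_triangle_ineq[of "u2 - u1" "u' - u2"] u'(2) by simp
  then have "(norm (u' - u1))\<^sup>2 \<le> (norm (u2 - u1) + ?d)\<^sup>2" by (rule power_mono) simp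
  also have "\<dots> = (norm (u2 - u1))\<^sup>2 + (2 * norm (u2 - u1) + ?d) * ?d"
    by (simp add: power2_eq_square algebra_simps)
  also have "\<dots> \<le> (norm (u2 - u1))\<^sup>2 + (3 * \<sigma>) * ?d"
    using n d d0 D(3) by (intro add_left_mono mult_right_mono) auto
  finally have 3: "r / 2 * (norm (u' - u1))\<^sup>2 \<le> r / 2 * ((norm (u2 - u1))\<^sup>2 + (3 * \<sigma>) * ?d)"
    using D(1) by (intro mult_left_mono) auto
  show ?thesis using 1 2 3 by (simp add: algebra_simps)
qed

text \<open>
  Adding the two inequalities between the values at \<open>(u1, p1)\<close> and \<open>(u2, p2)\<close> cancels the values. The error
  \<open>C * dist p1 p2\<close> stands next to squared norms, which is the origin of the Hoelder exponent one half.
\<close>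

lemma hypomonotone_across_parameters:
  assumes pr: "prox_bounds g xb pb vh gb r l \<sigma> \<tau>"
  obtains \<sigma>' C where "0 < \<sigma>'" and "\<sigma>' \<le> \<sigma>" and "0 \<le> C"
    and "\<And>u1 u2 p1 p2 v1 v2. u1 \<in> ball xb \<sigma>' \<Longrightarrow> u2 \<in> ball xb \<sigma>' \<Longrightarrow> p1 \<in> ball pb \<sigma>' \<Longrightarrow>
      p2 \<in> ball pb \<sigma>' \<Longrightarrow> v1 \<in> ball vh \<sigma>' \<Longrightarrow> v2 \<in> ball vh \<sigma>' \<Longrightarrow>
      v1 \<in> partial_subdiff g u1 p1 \<Longrightarrow> v2 \<in> partial_subdiff g u2 p2 \<Longrightarrow>
      - r * (norm (u1 - u2))\<^sup>2 - C * dist p1 p2 \<le> (v1 - v2) \<bullet> (u1 - u2)"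
proof -
  note D = prox_boundsD[OF pr]
  define \<sigma>' where "\<sigma>' = min (\<sigma> / 2) (\<sigma> / (4 * l))"
  have "\<sigma>' \<le> \<sigma> / (4 * l)" by (simp add: \<sigma>'_def)
  moreover have "0 < 4 * l" using D(2) by simp
  ultimately have "\<sigma>' * (4 * l) \<le> \<sigma>" by (simp only: pos_le_divide_eq)
  then have \<sigma>': "0 < \<sigma>'" "\<sigma>' \<le> \<sigma> / 2" "\<sigma>' * (4 * l) \<le> \<sigma>"
    using D(2,3) by (auto simp: \<sigma>'_def)
  define C where "C = (1 + (norm vh + \<sigma>) + 3 * r / 2 * \<sigma>) * l"
  have C: "0 \<le> C" using D(1-3) by (auto simp: C_def intro!: mult_nonneg_nonneg add_nonneg_nonneg)
  show thesis
  proof (rule that[of \<sigma>' "2 * C"])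
    fix u1 u2 p1 p2 v1 v2
    assume u: "u1 \<in> ball xb \<sigma>'" "u2 \<in> ball xb \<sigma>'" and p: "p1 \<in> ball pb \<sigma>'" "p2 \<in> ball pb \<sigma>'"
      and v: "v1 \<in> ball vh \<sigma>'" "v2 \<in> ball vh \<sigma>'"
      and sub: "v1 \<in> partial_subdiff g u1 p1" "v2 \<in> partial_subdiff g u2 p2"
    have u': "u1 \<in> ball xb (\<sigma> / 2)" "u2 \<in> ball xb (\<sigma> / 2)" "u1 \<in> ball xb \<sigma>" "u2 \<in> ball xb \<sigma>"
      and p': "p1 \<in> ball pb \<sigma>" "p2 \<in> ball pb \<sigma>" and v': "v1 \<in> ball vh \<sigma>" "v2 \<in> ball vh \<sigma>"
      using u p v \<sigma>' D(3) by auto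
    have "dist p1 p2 \<le> 2 * \<sigma>'" using dist_triangle2[of p1 p2 pb] p by (simp add: dist_commute)
    then have "l * dist p1 p2 \<le> l * (2 * \<sigma>')" using D(2) by (intro mult_left_mono) auto
    also have "\<dots> = \<sigma>' * (4 * l) / 2" by simp
    finally have d: "l * dist p1 p2 \<le> \<sigma> / 2" using \<sigma>'(3) by linarith
    obtain \<gamma>1 \<gamma>2 where g1: "g u1 p1 = ereal \<gamma>1" "\<bar>\<gamma>1 - gb\<bar> < \<tau>" and g2: "g u2 p2 = ereal \<gamma>2" "\<bar>\<gamma>2 - gb\<bar> < \<tau>"
      using D(7)[OF u'(3) p'(1) v'(1) sub(1)] D(7)[OF u'(4) p'(2) v'(2) sub(2)] by blast
    have "\<gamma>1 + v1 \<bullet> (u2 - u1) - r / 2 * (norm (u2 - u1))\<^sup>2 - C * dist p1 p2 \<le> \<gamma>2"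
      unfolding C_def using u' p' v' sub g1 g2 d by (intro prox_values_across_parameters[OF pr]) auto
    moreover have "\<gamma>2 + v2 \<bullet> (u1 - u2) - r / 2 * (norm (u1 - u2))\<^sup>2 - C * dist p2 p1 \<le> \<gamma>1"
      unfolding C_def using u' p' v' sub g1 g2 d
      by (intro prox_values_across_parameters[OF pr]) (auto simp: dist_commute)
    ultimately show "- r * (norm (u1 - u2))\<^sup>2 - 2 * C * dist p1 p2 \<le> (v1 - v2) \<bullet> (u1 - u2)"
      by (simp add: norm_minus_commute[of u2] dist_commute[of p2] inner_diff_left inner_diff_right algebra_simps)
  qed (use \<sigma>' C D(3) in auto)
qed

lemma prox_base_inequality:
  assumes pr: "prox_bounds g xb pb vh gb r l \<sigma> \<tau>" and x: "x \<in> ball xb \<sigma>"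
  shows "ereal (gb + vh \<bullet> (x - xb) - r / 2 * (norm (x - xb))\<^sup>2) \<le> g x pb"
proof -
  note D = prox_boundsD[OF pr]
  have "xb \<in> ball xb \<sigma>" "pb \<in> ball pb \<sigma>" "vh \<in> ball vh \<sigma>" using D(3) by auto
  from D(7)[OF this D(6)] obtain \<gamma> where "g xb pb = ereal \<gamma>"
    "\<forall>x\<in>ball xb \<sigma>. ereal (\<gamma> + vh \<bullet> (x - xb) - r / 2 * (norm (x - xb))\<^sup>2) \<le> g x pb" by blast
  with x D(5) show ?thesis by simp
qed

text \<open>
  The prox-regular minorant of \<open>g(\<cdot>, pb)\<close> at \<open>xb\<close> nearly persists for parameters close to \<open>pb\<close>: a point of the
  epigraph of \<open>g(\<cdot>, p)\<close> far below it would have a neighbor in the epigraph of \<open>g(\<cdot>, pb)\<close>.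
\<close>

lemma prox_lower_bound:
  assumes pr: "prox_bounds g xb pb vh gb r l \<sigma> \<tau>"
  obtains R where "0 < R" and "R \<le> \<sigma>" and "\<And>e. 0 < e \<Longrightarrow> \<exists>\<rho>>0. \<forall>p\<in>ball pb \<rho>. \<forall>x\<in>ball xb R.
      ereal (gb + vh \<bullet> (x - xb) - r / 2 * (norm (x - xb))\<^sup>2 - e) \<le> g x p"
proof -
  note D = prox_boundsD[OF pr]
  have "((\<lambda>R. norm vh * R + r / 2 * R\<^sup>2) \<longlongrightarrow> norm vh * 0 + r / 2 * 0\<^sup>2) (at_right 0)"
    by (intro tendsto_intros)
  \<comment> \<open>Small enough for the minorant to stay within \<open>\<tau>\<close> of \<open>gb\<close>, where the Lipschitz-like property
    applies.\<close>
  then obtain R where R: "0 < R" "R \<le> \<sigma> / 2" "norm vh * R + r / 2 * R\<^sup>2 < \<tau> / 4"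
    using small_radius[of "\<lambda>R. norm vh * R + r / 2 * R\<^sup>2" "\<tau> / 4" "\<sigma> / 2"] D(3,4) by auto
  show thesis
  proof (rule that[of R])
    fix e0 :: real assume e0: "0 < e0"
    define e where "e = min e0 (\<tau> / 4)"
    have e: "0 < e" "e \<le> e0" "e \<le> \<tau> / 4" using e0 D(4) by (auto simp: e_def)
    let ?F = "\<lambda>\<rho>. l * \<rho> * (1 + norm vh + r / 2 * (2 * R + l * \<rho>))"
    have "(?F \<longlongrightarrow> l * 0 * (1 + norm vh + r / 2 * (2 * R + l * 0))) (at_right 0)"
      by (intro tendsto_intros)
    then obtain \<rho> where \<rho>: "0 < \<rho>" "\<rho> \<le> min \<sigma> (\<sigma> / (2 * l))" "?F \<rho> < e"
      using small_radius[of ?F e "min \<sigma> (\<sigma> / (2 * l))"] e D(2,3) by auto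
    then have l\<rho>: "l * \<rho> \<le> \<sigma> / 2" using D(2) by (simp add: field_simps)
    have "ereal (gb + vh \<bullet> (x - xb) - r / 2 * (norm (x - xb))\<^sup>2 - e) \<le> g x p"
      if p: "p \<in> ball pb \<rho>" and x: "x \<in> ball xb R" for p x
    proof (rule ccontr)
      define \<beta> where "\<beta> = gb + vh \<bullet> (x - xb) - r / 2 * (norm (x - xb))\<^sup>2 - e"
      assume "\<not> ereal (gb + vh \<bullet> (x - xb) - r / 2 * (norm (x - xb))\<^sup>2 - e) \<le> g x p"
      then have gx: "g x p \<le> ereal \<beta>" by (simp add: \<beta>_def)
      have nx: "norm (x - xb) \<le> R" using x by (simp add: dist_norm norm_minus_commute)
      have a: "norm vh * norm (x - xb) \<le> norm vh * R" using nx by (intro mult_left_mono) auto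
      have a1: "vh \<bullet> (x - xb) \<le> norm vh * R"
        using norm_cauchy_schwarz[of vh "x - xb"] a by (rule order_trans)
      have a2: "- (vh \<bullet> (x - xb)) \<le> norm vh * R"
        using norm_cauchy_schwarz[of "- vh" "x - xb"] a by simp
      have a3: "r / 2 * (norm (x - xb))\<^sup>2 \<le> r / 2 * R\<^sup>2"
        using nx D(1) by (intro mult_left_mono power_mono) auto
      have a4: "0 \<le> r / 2 * (norm (x - xb))\<^sup>2" using D(1) by simp
      have a5: "0 \<le> r / 2 * R\<^sup>2" using D(1) by simp
      have "\<beta> - gb < \<tau>" using a1 a4 a5 R(3) e D(4) unfolding \<beta>_def by linarith
      moreover have "- (\<beta> - gb) < \<tau>" using a2 a3 R(3) e D(4) unfolding \<beta>_def by linarith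
      ultimately have \<beta>: "\<bar>\<beta> - gb\<bar> < \<tau>" by (rule abs_less_iff[THEN iffD2, OF conjI])
      have "p \<in> ball pb \<sigma>" "pb \<in> ball pb \<sigma>" "x \<in> ball xb \<sigma>"
        using p x \<rho> R D(3) by auto
      from D(8)[OF this \<beta> gx]
      obtain x' where x': "g x' pb \<le> ereal (\<beta> + l * dist p pb)" "norm (x' - x) \<le> l * dist p pb"
        by blast
      have "l * dist p pb \<le> l * \<rho>" using p D(2) by (simp add: dist_commute)
      then have "ereal (\<beta> + l * dist p pb) \<le> ereal (\<beta> + l * \<rho>)" by simp
      with x'(1) have "g x' pb \<le> ereal (\<beta> + l * \<rho>)" by (rule order_trans)
      moreover have "norm (x' - x) \<le> l * \<rho>" using x'(2) \<open>l * dist p pb \<le> l * \<rho>\<close> by linarith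
      ultimately have x'': "norm (x' - x) \<le> l * \<rho>" "g x' pb \<le> ereal (\<beta> + l * \<rho>)" by auto
      have "x' \<in> ball xb \<sigma>"
      proof -
        have "norm (x' - xb) \<le> norm (x' - x) + norm (x - xb)" by (rule norm_diff_triangle_ineq[of x' x x xb, simplified])
        then show ?thesis using x R(2) x''(1) l\<rho> by (simp add: dist_norm norm_minus_commute)
      qed
      then have "ereal (gb + vh \<bullet> (x' - xb) - r / 2 * (norm (x' - xb))\<^sup>2) \<le> g x' pb"
        by (rule prox_base_inequality[OF pr])
      then have "ereal (gb + vh \<bullet> (x' - xb) - r / 2 * (norm (x' - xb))\<^sup>2) \<le> ereal (\<beta> + l * \<rho>)"
        using x''(2) by (rule order_trans)
      then have 1: "gb + vh \<bullet> (x' - xb) - r / 2 * (norm (x' - xb))\<^sup>2 \<le> \<beta> + l * \<rho>"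
        by (simp only: ereal_less_eq)
      have "vh \<bullet> (x - x') \<le> norm vh * norm (x - x')" by (rule norm_cauchy_schwarz)
      also have "\<dots> \<le> norm vh * (l * \<rho>)"
        using x''(1) unfolding norm_minus_commute[of x' x] by (rule mult_left_mono) simp
      finally have 2: "vh \<bullet> (x' - xb) \<ge> vh \<bullet> (x - xb) - norm vh * (l * \<rho>)"
        unfolding inner_diff_right by linarith
      have "norm (x' - xb) \<le> norm (x - xb) + l * \<rho>"
        using norm_triangle_ineq[of "x - xb" "x' - x"] x''(1) by simp
      then have "(norm (x' - xb))\<^sup>2 \<le> (norm (x - xb) + l * \<rho>)\<^sup>2" by (rule power_mono) simp
      also have "\<dots> = (norm (x - xb))\<^sup>2 + (2 * norm (x - xb) + l * \<rho>) * (l * \<rho>)"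
        by (simp add: power2_eq_square algebra_simps)
      also have "\<dots> \<le> (norm (x - xb))\<^sup>2 + (2 * R + l * \<rho>) * (l * \<rho>)"
        using nx D(2) \<rho>(1) by (intro add_left_mono mult_right_mono) auto
      finally have "r / 2 * (norm (x' - xb))\<^sup>2 \<le> r / 2 * ((norm (x - xb))\<^sup>2 + (2 * R + l * \<rho>) * (l * \<rho>))"
        using D(1) by (intro mult_left_mono) auto
      then have "r / 2 * (norm (x' - xb))\<^sup>2 \<le>
          r / 2 * (norm (x - xb))\<^sup>2 + r / 2 * ((2 * R + l * \<rho>) * (l * \<rho>))"
        unfolding distrib_left .
      moreover have "?F \<rho> = l * \<rho> + norm vh * (l * \<rho>) + r / 2 * ((2 * R + l * \<rho>) * (l * \<rho>))"
        by (simp add: distrib_left distrib_right mult_ac)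
      ultimately show False using 1 2 \<rho>(3) unfolding \<beta>_def by linarith
    qed
    note bound = this
    have "ereal (gb + vh \<bullet> (x - xb) - r / 2 * (norm (x - xb))\<^sup>2 - e0) \<le> g x p"
      if "p \<in> ball pb \<rho>" "x \<in> ball xb R" for p x
      by (rule order_trans[OF _ bound[OF that]]) (use e(2) in simp)
    then show "\<exists>\<rho>>0. \<forall>p\<in>ball pb \<rho>. \<forall>x\<in>ball xb R.
      ereal (gb + vh \<bullet> (x - xb) - r / 2 * (norm (x - xb))\<^sup>2 - e0) \<le> g x p"
      by (intro exI[of _ \<rho>] conjI ballI \<rho>(1))
  qed (use R D(3) in auto)
qed

lemma prox_upper_bound:
  assumes pr: "prox_bounds g xb pb vh gb r l \<sigma> \<tau>" and e: "0 < e"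
  obtains \<rho> where "0 < \<rho>" and "\<And>p. p \<in> ball pb \<rho> \<Longrightarrow> \<exists>x. norm (x - xb) \<le> e \<and> g x p \<le> ereal (gb + e)"
proof -
  note D = prox_boundsD[OF pr]
  define \<rho> where "\<rho> = min \<sigma> (e / l)"
  have "\<rho> \<le> e / l" by (simp add: \<rho>_def)
  then have "\<rho> * l \<le> e" using D(2) by (simp only: pos_le_divide_eq)
  then have \<rho>: "0 < \<rho>" "\<rho> \<le> \<sigma>" "l * \<rho> \<le> e"
    using D(2,3) e by (auto simp: \<rho>_def mult.commute)
  show thesis
  proof (rule that[OF \<rho>(1)])
    fix p assume p: "p \<in> ball pb \<rho>"
    obtain x where x: "g x p \<le> ereal (gb + l * dist pb p)" "norm (x - xb) \<le> l * dist pb p"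
      using D(8)[of pb p xb gb] D(3,4,5) p \<rho>(2) by auto
    have "l * dist pb p \<le> l * \<rho>" using p D(2) by simp
    then have "l * dist pb p \<le> e" using \<rho>(3) by linarith
    then show "\<exists>x. norm (x - xb) \<le> e \<and> g x p \<le> ereal (gb + e)"
      using x by (intro exI[of _ x]) (auto intro: order_trans)
  qed
qed

section \<open>Solvability of the regularized subgradient inclusion\<close>

text \<open>
  The inclusion is the optimality condition for minimizing
  \<open>g x p + \<mu> / 2 * norm (x - xb) ^ 2 - v \<bullet> (x - xb)\<close> with \<open>v = y - \<mu> xb\<close>. Since \<open>\<mu> > r\<close>, the lower
  bound for \<open>g\<close> forces near minimizers over a ball to be interior, and the variational principle yields a
  minimizer of a perturbed problem; \<open>b\<close> accounts for the perturbation.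
\<close>

lemma prox_problem_nearly_solvable:
  fixes g :: "'x::{real_inner, complete_space} \<Rightarrow> 'p::metric_space \<Rightarrow> ereal"
  assumes g_not_MInfty: "\<And>x p. g x p \<noteq> -\<infinity>"
    and g_lsc: "lower_semicontinuous (\<lambda>(x, p). g x p)"
    and pr: "prox_bounds g xb pb vh gb r l \<sigma> \<tau>"
    and lam: "r < \<mu>" and s: "0 < s"
  obtains \<rho> where "0 < \<rho>" and "\<And>p y e. p \<in> ball pb \<rho> \<Longrightarrow> y \<in> ball (vh + \<mu> *\<^sub>R xb) \<rho> \<Longrightarrow> 0 < e \<Longrightarrow>
    \<exists>x b. x \<in> ball xb s \<and> norm b \<le> e \<and> y + b - \<mu> *\<^sub>R x \<in> partial_subdiff g x p"
proof -
  note D = prox_boundsD[OF pr]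
  obtain R0 where R0: "0 < R0" "R0 \<le> \<sigma>" and lower: "\<And>e. 0 < e \<Longrightarrow> \<exists>\<rho>>0. \<forall>p\<in>ball pb \<rho>. \<forall>x\<in>ball xb R0.
      ereal (gb + vh \<bullet> (x - xb) - r / 2 * (norm (x - xb))\<^sup>2 - e) \<le> g x p"
    using prox_lower_bound[OF pr] by blast
  define R where "R = min (R0 / 2) s"
  have R: "0 < R" "R < R0" "R \<le> s" using R0 s by (auto simp: R_def)
  define k where "k = (\<mu> - r) / 2"
  have k: "0 < k" using lam by (simp add: k_def)
  \<comment> \<open>The errors below add up to \<open>4 * \<epsilon>\<close>, which is less than the growth \<open>k * R\<^sup>2\<close> at the boundary.\<close>
  define \<epsilon> where "\<epsilon> = k * R\<^sup>2 / 8"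
  have \<epsilon>: "0 < \<epsilon>" using k R by (simp add: \<epsilon>_def)
  obtain \<rho>1 where \<rho>1: "0 < \<rho>1" and lb: "\<And>p x. p \<in> ball pb \<rho>1 \<Longrightarrow> x \<in> ball xb R0 \<Longrightarrow>
      ereal (gb + vh \<bullet> (x - xb) - r / 2 * (norm (x - xb))\<^sup>2 - \<epsilon>) \<le> g x p"
    using lower[OF \<epsilon>] by blast
  let ?F = "\<lambda>t. t + \<mu> / 2 * t\<^sup>2 + (norm vh + 1) * t"
  have "(?F \<longlongrightarrow> 0 + \<mu> / 2 * 0\<^sup>2 + (norm vh + 1) * 0) (at_right 0)" by (intro tendsto_intros)
  then obtain t where t: "0 < t" "t \<le> R" "?F t < \<epsilon>"
    using small_radius[of ?F \<epsilon> R] \<epsilon> R(1) by auto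
  obtain \<rho>2 where \<rho>2: "0 < \<rho>2" and ub: "\<And>p. p \<in> ball pb \<rho>2 \<Longrightarrow> \<exists>x. norm (x - xb) \<le> t \<and> g x p \<le> ereal (gb + t)"
    using prox_upper_bound[OF pr t(1)] by blast
  define \<rho> where "\<rho> = min (min \<rho>1 \<rho>2) (min 1 (\<epsilon> / R))"
  have "\<rho> \<le> \<epsilon> / R" by (simp add: \<rho>_def)
  then have \<rho>R: "\<rho> * R \<le> \<epsilon>" using R(1) by (simp only: pos_le_divide_eq)
  have \<rho>: "0 < \<rho>" "\<rho> \<le> \<rho>1" "\<rho> \<le> \<rho>2" "\<rho> \<le> 1" using \<rho>1 \<rho>2 \<epsilon> R(1) by (auto simp: \<rho>_def)
  show thesis
  proof (rule that[OF \<rho>(1)])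
    fix p y and e :: real
    assume p: "p \<in> ball pb \<rho>" and y: "y \<in> ball (vh + \<mu> *\<^sub>R xb) \<rho>" and e: "0 < e"
    define v where "v = y - \<mu> *\<^sub>R xb"
    have v: "norm (v - vh) < \<rho>" using y by (simp add: v_def dist_norm norm_minus_commute algebra_simps)
    define q where "q x = \<mu> / 2 * (norm (x - xb))\<^sup>2 - v \<bullet> (x - xb)" for x
    define e1 where "e1 = min e (\<epsilon> / (2 * R + (2 * R)\<^sup>2))"
    have den: "0 < 2 * R + (2 * R)\<^sup>2" using R(1) by (intro add_pos_pos) auto
    have e1: "0 < e1" "e1 \<le> e" using e \<epsilon> den by (auto simp: e1_def)
    have "e1 \<le> \<epsilon> / (2 * R + (2 * R)\<^sup>2)" by (simp add: e1_def)
    then have e1R: "e1 * (2 * R + (2 * R)\<^sup>2) \<le> \<epsilon>" using den by (simp only: pos_le_divide_eq)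
    define E where "E = {(x, \<alpha>). x \<in> cball xb R \<and> g x p \<le> ereal (\<alpha> - q x)}"
    have "closed E"
    proof -
      have "continuous_on UNIV (\<lambda>z::'x \<times> real. (fst z, snd z - q (fst z)))"
        unfolding q_def by (intro continuous_intros)
      then have "closed ((\<lambda>z. (fst z, snd z - q (fst z))) -` epi (\<lambda>x. g x p))"
        using closed_epi_slice[OF g_lsc] by (intro closed_vimage)
      moreover have "closed (cball xb R \<times> (UNIV :: real set))" by (intro closed_Times) auto
      moreover have "E = (cball xb R \<times> UNIV) \<inter> (\<lambda>z. (fst z, snd z - q (fst z))) -` epi (\<lambda>x. g x p)"
        by (auto simp: E_def epi_def)
      ultimately show ?thesis by (simp add: closed_Int)
    qed
    \<comment> \<open>On \<open>E\<close> the perturbed objective grows quadratically away from \<open>xb\<close>.\<close>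
    have growth: "gb + k * (norm (x - xb))\<^sup>2 - 2 * \<epsilon> \<le> \<alpha>" if "(x, \<alpha>) \<in> E" for x \<alpha>
    proof -
      have x: "norm (x - xb) \<le> R" "g x p \<le> ereal (\<alpha> - q x)"
        using that by (auto simp: E_def dist_norm norm_minus_commute)
      have "p \<in> ball pb \<rho>1" "x \<in> ball xb R0" using p \<rho> x(1) R by (auto simp: dist_norm norm_minus_commute)
      from order_trans[OF lb[OF this] x(2)]
      have "gb + vh \<bullet> (x - xb) - r / 2 * (norm (x - xb))\<^sup>2 - \<epsilon> \<le> \<alpha> - q x" by (simp only: ereal_less_eq)
      moreover have "(v - vh) \<bullet> (x - xb) \<le> \<epsilon>"
      proof -
        have "(v - vh) \<bullet> (x - xb) \<le> norm (v - vh) * norm (x - xb)" by (rule norm_cauchy_schwarz)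
        also have "\<dots> \<le> \<rho> * R" using v x(1) R(1) \<rho>(1) by (intro mult_mono) auto
        finally show ?thesis using \<rho>R by linarith
      qed
      moreover have "k * (norm (x - xb))\<^sup>2 = \<mu> / 2 * (norm (x - xb))\<^sup>2 - r / 2 * (norm (x - xb))\<^sup>2"
        by (simp add: k_def algebra_simps diff_divide_distrib)
      ultimately show ?thesis by (simp add: q_def inner_diff_left)
    qed
    have "p \<in> ball pb \<rho>2" using p \<rho> by simp
    from ub[OF this] obtain x0 where x0: "norm (x0 - xb) \<le> t" "g x0 p \<le> ereal (gb + t)" by blast
    have x0E: "(x0, gb + t + q x0) \<in> E" using x0 t(2) by (simp add: E_def dist_norm norm_minus_commute)
    have x0_le: "gb + t + q x0 \<le> gb + \<epsilon>"
    proof -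
      have "- (v \<bullet> (x0 - xb)) \<le> norm v * norm (x0 - xb)"
        using norm_cauchy_schwarz[of "- v" "x0 - xb"] by simp
      also have "\<dots> \<le> (norm vh + 1) * t"
      proof -
        have "norm v \<le> norm vh + 1" using v \<rho>(4) norm_triangle_sub[of v vh] by linarith
        then show ?thesis using x0 by (intro mult_mono) auto
      qed
      finally have "- (v \<bullet> (x0 - xb)) \<le> (norm vh + 1) * t" .
      moreover have "\<mu> / 2 * (norm (x0 - xb))\<^sup>2 \<le> \<mu> / 2 * t\<^sup>2"
        using x0 lam D(1) by (intro mult_left_mono power_mono) auto
      ultimately show ?thesis using t(3) unfolding q_def by linarith
    qed
    have below: "gb - 2 * \<epsilon> \<le> \<alpha>" if "(x, \<alpha>) \<in> E" for x \<alpha>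
    proof -
      have "0 \<le> k * (norm (x - xb))\<^sup>2" using k by simp
      then show ?thesis using growth[OF that] by linarith
    qed
    obtain x \<alpha> b where xE: "(x, \<alpha>) \<in> E" and b: "norm b \<le> e1" and
      min: "\<And>x' \<alpha>'. (x', \<alpha>') \<in> E \<Longrightarrow> \<alpha> \<le> \<alpha>' + b \<bullet> (x' - x) + e1 * (norm (x' - x))\<^sup>2"
      using smooth_variational_principle[OF \<open>closed E\<close> _ _ e1(1), of "gb - 2 * \<epsilon>"] x0E below
      by (metis empty_iff)
    have xR: "norm (x - xb) \<le> R" and gx: "g x p \<le> ereal (\<alpha> - q x)"
      using xE by (auto simp: E_def dist_norm norm_minus_commute)
    have "\<alpha> \<le> gb + 2 * \<epsilon>"
    proof -
      have d: "norm (x0 - x) \<le> 2 * R"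
        using norm_diff_triangle_le[of x0 xb R x R] x0(1) t(2) xR by (simp add: norm_minus_commute)
      have "b \<bullet> (x0 - x) \<le> norm b * norm (x0 - x)" by (rule norm_cauchy_schwarz)
      also have "\<dots> \<le> e1 * (2 * R)" using b d e1 by (intro mult_mono) auto
      finally have "b \<bullet> (x0 - x) \<le> e1 * (2 * R)" .
      moreover have "e1 * (norm (x0 - x))\<^sup>2 \<le> e1 * (2 * R)\<^sup>2"
        using d e1 by (intro mult_left_mono power_mono) auto
      ultimately show ?thesis using min[OF x0E] x0_le e1R unfolding distrib_left by linarith
    qed
    then have "k * (norm (x - xb))\<^sup>2 \<le> 4 * \<epsilon>" using growth[OF xE] by linarith
    also have "4 * \<epsilon> < k * R\<^sup>2" using k R(1) by (simp add: \<epsilon>_def)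
    finally have "(norm (x - xb))\<^sup>2 < R\<^sup>2" using k by simp
    then have xlt: "norm (x - xb) < R" using R(1) by (simp add: power2_less_imp_less)
    have "g x p \<noteq> \<infinity>" using gx by auto
    then obtain \<gamma> where \<gamma>: "g x p = ereal \<gamma>" using g_not_MInfty[of x p] by (cases "g x p") auto
    have \<gamma>_le: "\<gamma> + q x \<le> \<alpha>" using gx by (simp add: \<gamma>)
    have "v - \<mu> *\<^sub>R (x - xb) - b \<in> limiting_subdiff (\<lambda>x. g x p) x"
    proof (rule limiting_subdiff_if_quadratic_minorant[where M = "\<mu> / 2 + e1"])
      show "0 < R - norm (x - xb)" using xlt by simp
      fix x' assume x': "x' \<in> ball x (R - norm (x - xb))"
      have x'R: "x' \<in> cball xb R"
        using x' dist_triangle[of xb x' x] by (simp add: dist_norm norm_minus_commute)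
      show "ereal (\<gamma> + (v - \<mu> *\<^sub>R (x - xb) - b) \<bullet> (x' - x) - (\<mu> / 2 + e1) * (norm (x' - x))\<^sup>2) \<le> g x' p"
      proof (cases "g x' p")
        case (real \<gamma>')
        have "(x', \<gamma>' + q x') \<in> E" using x'R real by (simp add: E_def)
        from min[OF this] \<gamma>_le
        have "\<gamma> + q x \<le> \<gamma>' + q x' + b \<bullet> (x' - x) + e1 * (norm (x' - x))\<^sup>2" by linarith
        moreover have "q x' = q x + (\<mu> *\<^sub>R (x - xb) - v) \<bullet> (x' - x) + \<mu> / 2 * (norm (x' - x))\<^sup>2"
          unfolding q_def norm_square_shift[of x' xb x]
          by (simp add: algebra_simps inner_diff_left inner_diff_right)
        ultimately show ?thesis
          unfolding real by (simp add: algebra_simps inner_diff_left)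
      qed (use g_not_MInfty in auto)
    qed (fact \<gamma>)
    moreover have "v - \<mu> *\<^sub>R (x - xb) - b = y + (- b) - \<mu> *\<^sub>R x" by (simp add: v_def algebra_simps)
    ultimately have "y + (- b) - \<mu> *\<^sub>R x \<in> partial_subdiff g x p" by (simp add: partial_subdiff_def)
    moreover have "x \<in> ball xb s" using xlt R(3) by (simp add: dist_norm norm_minus_commute)
    moreover have "norm (- b) \<le> e" using b e1 by simp
    ultimately show "\<exists>x b. x \<in> ball xb s \<and> norm b \<le> e \<and> y + b - \<mu> *\<^sub>R x \<in> partial_subdiff g x p" by blast
  qed
qed

text \<open>
  The prox-regular minorants at \<open>xn n\<close> bound the values at \<open>xn n\<close> from above. Lower semicontinuity carries
  these bounds to the limit, where they state that \<open>v\<close> has a quadratic minorant at \<open>x\<close>.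
\<close>

lemma partial_subdiff_closed:
  fixes g :: "'x::{real_inner, complete_space} \<Rightarrow> 'p::metric_space \<Rightarrow> ereal"
  assumes g_not_MInfty: "\<And>x p. g x p \<noteq> -\<infinity>"
    and g_lsc: "lower_semicontinuous (\<lambda>(x, p). g x p)"
    and pr: "prox_bounds g xb pb vh gb r l \<sigma> \<tau>"
    and p: "p \<in> ball pb \<sigma>" and xn: "\<And>n. xn n \<in> ball xb \<sigma>" and vn: "\<And>n. vn n \<in> ball vh \<sigma>"
    and sub: "\<And>n. vn n \<in> partial_subdiff g (xn n) p"
    and x: "xn \<longlonglongrightarrow> x" "x \<in> ball xb \<sigma>" and v: "vn \<longlonglongrightarrow> v"
  shows "v \<in> partial_subdiff g x p"
proof -
  note D = prox_boundsD[OF pr]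
  have "\<forall>n. \<exists>\<gamma>. g (xn n) p = ereal \<gamma> \<and>
      (\<forall>x\<in>ball xb \<sigma>. ereal (\<gamma> + vn n \<bullet> (x - xn n) - r / 2 * (norm (x - xn n))\<^sup>2) \<le> g x p)"
    using D(7)[OF xn p vn sub] by blast
  then obtain \<gamma> where \<gamma>: "\<And>n. g (xn n) p = ereal (\<gamma> n)" and
    minorant: "\<And>n x. x \<in> ball xb \<sigma> \<Longrightarrow>
      ereal (\<gamma> n + vn n \<bullet> (x - xn n) - r / 2 * (norm (x - xn n))\<^sup>2) \<le> g x p"
    by metis
  have limit: "g x p \<le> ereal (\<gamma>' - (v \<bullet> (x' - x) - r / 2 * (norm (x' - x))\<^sup>2))"
    if x': "x' \<in> ball xb \<sigma>" and g': "g x' p = ereal \<gamma>'" for x' \<gamma>'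
  proof -
    let ?a = "\<lambda>n. \<gamma>' - (vn n \<bullet> (x' - xn n) - r / 2 * (norm (x' - xn n))\<^sup>2)"
    have "(xn n, ?a n) \<in> epi (\<lambda>x. g x p)" for n
      using minorant[OF x', of n] g' by (simp add: epi_def \<gamma>)
    moreover have "(\<lambda>n. (xn n, ?a n)) \<longlonglongrightarrow> (x, \<gamma>' - (v \<bullet> (x' - x) - r / 2 * (norm (x' - x))\<^sup>2))"
      by (intro tendsto_intros x(1) v)
    ultimately have "(x, \<gamma>' - (v \<bullet> (x' - x) - r / 2 * (norm (x' - x))\<^sup>2)) \<in> epi (\<lambda>x. g x p)"
      by (rule closed_sequentially[OF closed_epi_slice[OF g_lsc]])
    then show ?thesis by (simp add: epi_def)
  qed
  have "g x p \<noteq> \<infinity>" using limit[OF xn[of 0] \<gamma>[of 0]] by auto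
  then obtain \<gamma>0 where \<gamma>0: "g x p = ereal \<gamma>0" using g_not_MInfty[of x p] by (cases "g x p") auto
  show ?thesis
    unfolding partial_subdiff_def
  proof (rule limiting_subdiff_if_quadratic_minorant[where M = "r / 2" and \<gamma> = \<gamma>0])
    show "g x p = ereal \<gamma>0" by (fact \<gamma>0)
    show "0 < \<sigma> - dist xb x" using x(2) by simp
    fix x' assume "x' \<in> ball x (\<sigma> - dist xb x)"
    then have x': "x' \<in> ball xb \<sigma>" using dist_triangle[of xb x' x] by simp
    show "ereal (\<gamma>0 + v \<bullet> (x' - x) - r / 2 * (norm (x' - x))\<^sup>2) \<le> g x' p"
    proof (cases "g x' p")
      case (real \<gamma>')
      show ?thesis using limit[OF x' real] by (simp add: real \<gamma>0)
    qed (use g_not_MInfty in auto)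
  qed
qed

text \<open>
  Adding \<open>\<mu> x\<close> with \<open>\<mu> > r\<close> makes the hypomonotone \<open>\<partial>g\<close> strongly monotone. This gives uniqueness and
  continuity of the solution, and it makes the solutions of the nearly solvable problems a Cauchy
  sequence.
\<close>

lemma localizes_prox:
  fixes g :: "'x::{real_inner, complete_space} \<Rightarrow> 'p::metric_space \<Rightarrow> ereal"
  assumes g_not_MInfty: "\<And>x p. g x p \<noteq> -\<infinity>"
    and g_lsc: "lower_semicontinuous (\<lambda>(x, p). g x p)"
    and pr: "prox_bounds g xb pb vh gb r l \<sigma> \<tau>"
    and lam: "r < \<mu>"
  obtains s \<rho> \<theta> C where
    "localizes (partial_subdiff g) (\<lambda>x p. \<mu> *\<^sub>R x) xb pb (vh + \<mu> *\<^sub>R xb) s \<rho> \<theta> (1 / (\<mu> - r)) C"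
proof -
  note D = prox_boundsD[OF pr]
  have lam0: "0 < \<mu>" using lam D(1) by simp
  obtain \<sigma>' C where \<sigma>': "0 < \<sigma>'" "\<sigma>' \<le> \<sigma>" and C: "0 \<le> C" and
    mono: "\<And>u1 u2 p1 p2 v1 v2. u1 \<in> ball xb \<sigma>' \<Longrightarrow> u2 \<in> ball xb \<sigma>' \<Longrightarrow> p1 \<in> ball pb \<sigma>' \<Longrightarrow>
      p2 \<in> ball pb \<sigma>' \<Longrightarrow> v1 \<in> ball vh \<sigma>' \<Longrightarrow> v2 \<in> ball vh \<sigma>' \<Longrightarrow>
      v1 \<in> partial_subdiff g u1 p1 \<Longrightarrow> v2 \<in> partial_subdiff g u2 p2 \<Longrightarrow>
      - r * (norm (u1 - u2))\<^sup>2 - C * dist p1 p2 \<le> (v1 - v2) \<bullet> (u1 - u2)"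
    using hypomonotone_across_parameters[OF pr] by blast
  define s where "s = min (\<sigma>' / 2) (\<sigma>' / (4 * \<mu>))"
  have "s \<le> \<sigma>' / (4 * \<mu>)" by (simp add: s_def)
  moreover have "0 < 4 * \<mu>" using lam0 by simp
  ultimately have "s * (4 * \<mu>) \<le> \<sigma>'" by (simp only: pos_le_divide_eq)
  then have s: "0 < s" "s \<le> \<sigma>' / 2" "\<mu> * s \<le> \<sigma>' / 4" using \<sigma>' lam0 by (auto simp: s_def mult.commute)
  have s2: "0 < s / 2" using s by simp
  obtain \<rho>1 where \<rho>1: "0 < \<rho>1" and
    solv: "\<And>p y e. p \<in> ball pb \<rho>1 \<Longrightarrow> y \<in> ball (vh + \<mu> *\<^sub>R xb) \<rho>1 \<Longrightarrow> 0 < e \<Longrightarrow>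
    \<exists>x b. x \<in> ball xb (s / 2) \<and> norm b \<le> e \<and> y + b - \<mu> *\<^sub>R x \<in> partial_subdiff g x p"
    using prox_problem_nearly_solvable[OF g_not_MInfty g_lsc pr lam s2] by blast
  define \<rho> where "\<rho> = min \<rho>1 (\<sigma>' / 4)"
  have \<rho>: "0 < \<rho>" "\<rho> \<le> \<rho>1" "\<rho> \<le> \<sigma>' / 4" using \<rho>1 \<sigma>' by (auto simp: \<rho>_def)
  have v_in: "y + b - \<mu> *\<^sub>R x \<in> ball vh \<sigma>'"
    if y: "y \<in> ball (vh + \<mu> *\<^sub>R xb) \<rho>" and b: "norm b \<le> \<sigma>' / 4" and x: "x \<in> ball xb s" for y b x
  proof -
    have "y + b - \<mu> *\<^sub>R x - vh = (y - (vh + \<mu> *\<^sub>R xb)) + (b + \<mu> *\<^sub>R (xb - x))"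
      by (simp add: algebra_simps)
    then have "norm (y + b - \<mu> *\<^sub>R x - vh) \<le> norm (y - (vh + \<mu> *\<^sub>R xb)) + (norm b + norm (\<mu> *\<^sub>R (xb - x)))"
      by (metis norm_triangle_le add_left_mono norm_triangle_ineq)
    moreover have "norm (\<mu> *\<^sub>R (xb - x)) \<le> \<mu> * s" using x lam0 by (simp add: dist_norm)
    ultimately show ?thesis using y b \<rho>(3) s(3) \<sigma>'(1) by (simp add: dist_norm norm_minus_commute)
  qed
  have v_in0: "y - \<mu> *\<^sub>R x \<in> ball vh \<sigma>'" if "y \<in> ball (vh + \<mu> *\<^sub>R xb) \<rho>" "x \<in> ball xb s" for y x
    using v_in[of y 0 x] that \<sigma>' by simp
  \<comment> \<open>Strong monotonicity of \<open>x \<mapsto> \<partial>g(x, p) + \<mu> x\<close>, up to an error coming from the parameters.\<close>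
  have est: "norm (x1 - x2) \<le> norm (y1 - y2) / (\<mu> - r) + sqrt (C / (\<mu> - r)) * sqrt (dist p1 p2)"
    if x: "x1 \<in> ball xb s" "x2 \<in> ball xb s" and p: "p1 \<in> ball pb \<sigma>'" "p2 \<in> ball pb \<sigma>'"
      and v: "y1 - \<mu> *\<^sub>R x1 \<in> ball vh \<sigma>'" "y2 - \<mu> *\<^sub>R x2 \<in> ball vh \<sigma>'"
      and sub: "y1 - \<mu> *\<^sub>R x1 \<in> partial_subdiff g x1 p1" "y2 - \<mu> *\<^sub>R x2 \<in> partial_subdiff g x2 p2"
    for x1 x2 y1 y2 p1 p2
  proof -
    have x': "x1 \<in> ball xb \<sigma>'" "x2 \<in> ball xb \<sigma>'" using x s(2) \<sigma>' by auto
    let ?n = "norm (x1 - x2)" and ?m = "norm (y1 - y2)"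
    have "- r * ?n\<^sup>2 - C * dist p1 p2 \<le> ((y1 - \<mu> *\<^sub>R x1) - (y2 - \<mu> *\<^sub>R x2)) \<bullet> (x1 - x2)"
      by (rule mono[OF x' p v sub])
    also have "\<dots> = (y1 - y2) \<bullet> (x1 - x2) - \<mu> * ?n\<^sup>2"
      by (simp add: power2_norm_eq_inner inner_diff_left inner_diff_right inner_commute algebra_simps)
    also have "(y1 - y2) \<bullet> (x1 - x2) \<le> ?m * ?n" by (rule norm_cauchy_schwarz)
    finally have "(\<mu> - r) * ?n\<^sup>2 \<le> ?m * ?n + C * dist p1 p2" by (simp add: algebra_simps)
    then have "?n\<^sup>2 \<le> (?m * ?n + C * dist p1 p2) / (\<mu> - r)"
      using lam by (subst pos_le_divide_eq) (auto simp: mult.commute)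
    then have q: "?n\<^sup>2 \<le> (?m / (\<mu> - r)) * ?n + C / (\<mu> - r) * dist p1 p2" by (simp add: add_divide_distrib)
    define a where "a = ?m / (\<mu> - r)"
    define w where "w = sqrt (C / (\<mu> - r) * dist p1 p2)"
    have nn: "0 \<le> a" "0 \<le> w" "w\<^sup>2 = C / (\<mu> - r) * dist p1 p2" using lam C by (auto simp: a_def w_def)
    have q': "?n\<^sup>2 \<le> a * ?n + w\<^sup>2" using q nn by (simp add: a_def)
    \<comment> \<open>A quadratic inequality \<open>n\<^sup>2 \<le> a n + w\<^sup>2\<close> gives \<open>n \<le> a + w\<close>; here \<open>w\<close> is the square root of a
      multiple of \<open>dist p1 p2\<close>.\<close>
    have "?n \<le> a + w"
    proof (rule ccontr)
      assume "\<not> ?n \<le> a + w"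
      then have "a + w < ?n" by simp
      then have "0 \<le> w * (?n - w)" "w < ?n - a" using nn by auto
      then have "w * w < ?n * (?n - a)" using nn \<open>a + w < ?n\<close>
        by (smt (verit) mult_left_mono mult_strict_mono)
      then show False using q' by (simp add: power2_eq_square algebra_simps)
    qed
    then show ?thesis unfolding a_def w_def real_sqrt_mult[of "C / (\<mu> - r)"] .
  qed
  have ex: "\<exists>x. x \<in> ball xb s \<and> y - \<mu> *\<^sub>R x \<in> partial_subdiff g x p"
    if p: "p \<in> ball pb \<rho>" and y: "y \<in> ball (vh + \<mu> *\<^sub>R xb) \<rho>" for p y
  proof -
    define \<epsilon> where "\<epsilon> n = min (\<sigma>' / 4) (inverse (real (Suc n)))" for n
    have \<epsilon>: "0 < \<epsilon> n" "\<epsilon> n \<le> \<sigma>' / 4" for n using \<sigma>' by (auto simp: \<epsilon>_def)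
    have "\<forall>n. \<exists>x b. x \<in> ball xb (s / 2) \<and> norm b \<le> \<epsilon> n \<and> y + b - \<mu> *\<^sub>R x \<in> partial_subdiff g x p"
      using solv[of p y] p y \<rho>(2) \<epsilon>(1) by auto
    then obtain xn bn where xn: "\<And>n. xn n \<in> ball xb (s / 2)" and bn: "\<And>n. norm (bn n) \<le> \<epsilon> n"
      and sub: "\<And>n. y + bn n - \<mu> *\<^sub>R xn n \<in> partial_subdiff g (xn n) p" by metis
    have xn': "xn n \<in> ball xb s" for n using xn[of n] s by auto
    have p': "p \<in> ball pb \<sigma>'" using p \<rho> \<sigma>' by simp
    have vn: "y + bn n - \<mu> *\<^sub>R xn n \<in> ball vh \<sigma>'" for n
      by (rule v_in[OF y order_trans[OF bn \<epsilon>(2)] xn'])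
    have "(\<lambda>n. inverse (real (Suc n))) \<longlonglongrightarrow> 0" by (rule LIMSEQ_inverse_real_of_nat)
    then have b0: "bn \<longlonglongrightarrow> 0"
      by (rule tendsto_0_le[where K = 1]) (use bn in \<open>auto simp: \<epsilon>_def intro!: always_eventually\<close>)
    have "Cauchy xn"
    proof (rule metric_CauchyI)
      fix e :: real assume e: "0 < e"
      have "0 < e * (\<mu> - r)" using e lam by simp
      with LIMSEQ_imp_Cauchy[OF b0] obtain N where
        N: "\<And>m n. N \<le> m \<Longrightarrow> N \<le> n \<Longrightarrow> dist (bn m) (bn n) < e * (\<mu> - r)"
        unfolding Cauchy_def by (meson)
      have "dist (xn m) (xn n) < e" if "N \<le> m" "N \<le> n" for m n
      proof -
        have "norm (xn m - xn n) \<le> norm ((y + bn m) - (y + bn n)) / (\<mu> - r) + sqrt (C / (\<mu> - r)) * sqrt (dist p p)"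
          by (rule est[OF xn' xn' p' p' vn vn sub sub])
        also have "\<dots> = dist (bn m) (bn n) / (\<mu> - r)" by (simp add: dist_norm)
        also have "\<dots> < e" using N[OF that] lam by (subst pos_divide_less_eq) auto
        finally show ?thesis by (simp add: dist_norm)
      qed
      then show "\<exists>N. \<forall>m\<ge>N. \<forall>n\<ge>N. dist (xn m) (xn n) < e" by blast
    qed
    then obtain x where x: "xn \<longlonglongrightarrow> x" using Cauchy_convergent convergent_def by blast
    have "x \<in> cball xb (s / 2)"
      using xn by (intro closed_sequentially[OF closed_cball _ x]) (simp add: less_imp_le)
    then have xs: "x \<in> ball xb s" using s by simp
    have "(\<lambda>n. y + bn n - \<mu> *\<^sub>R xn n) \<longlonglongrightarrow> y + 0 - \<mu> *\<^sub>R x" by (intro tendsto_intros b0 x)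
    then have "y + 0 - \<mu> *\<^sub>R x \<in> partial_subdiff g x p"
    proof (rule partial_subdiff_closed[OF g_not_MInfty g_lsc pr _ _ _ sub x, rotated 4])
      show "p \<in> ball pb \<sigma>" using p' \<sigma>' by simp
      show "xn n \<in> ball xb \<sigma>" for n using xn'[of n] s \<sigma>' by simp
      show "y + bn n - \<mu> *\<^sub>R xn n \<in> ball vh \<sigma>" for n using vn[of n] \<sigma>' by simp
      show "x \<in> ball xb \<sigma>" using xs s \<sigma>' by simp
    qed
    then show ?thesis using xs by auto
  qed
  have uniq: "x1 = x2"
    if p: "p \<in> ball pb \<rho>" and y: "y \<in> ball (vh + \<mu> *\<^sub>R xb) \<rho>"
      and x: "x1 \<in> ball xb s" "x2 \<in> ball xb s"
      and sub: "y - \<mu> *\<^sub>R x1 \<in> partial_subdiff g x1 p" "y - \<mu> *\<^sub>R x2 \<in> partial_subdiff g x2 p"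
    for p y x1 x2
  proof -
    have "p \<in> ball pb \<sigma>'" using p \<rho> \<sigma>' by simp
    from est[OF x this this v_in0[OF y x(1)] v_in0[OF y x(2)] sub] show ?thesis by simp
  qed
  define \<theta> where "\<theta> y p = (THE x. x \<in> ball xb s \<and> y - \<mu> *\<^sub>R x \<in> partial_subdiff g x p)" for y p
  have \<theta>: "\<theta> y p \<in> ball xb s" "y - \<mu> *\<^sub>R \<theta> y p \<in> partial_subdiff g (\<theta> y p) p"
    if "y \<in> ball (vh + \<mu> *\<^sub>R xb) \<rho>" "p \<in> ball pb \<rho>" for y p
  proof -
    have "\<exists>!x. x \<in> ball xb s \<and> y - \<mu> *\<^sub>R x \<in> partial_subdiff g x p"
      using ex[OF that(2,1)] uniq[OF that(2,1)] by blast
    from theI'[OF this] show "\<theta> y p \<in> ball xb s" "y - \<mu> *\<^sub>R \<theta> y p \<in> partial_subdiff g (\<theta> y p) p"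
      by (simp_all add: \<theta>_def)
  qed
  have \<theta>_eq: "x = \<theta> y p" if "y \<in> ball (vh + \<mu> *\<^sub>R xb) \<rho>" "p \<in> ball pb \<rho>" "x \<in> ball xb s"
    "y - \<mu> *\<^sub>R x \<in> partial_subdiff g x p" for x y p
    using uniq[OF that(2,1,3) \<theta>(1)[OF that(1,2)] that(4) \<theta>(2)[OF that(1,2)]] .
  have "localizes (partial_subdiff g) (\<lambda>x p. \<mu> *\<^sub>R x) xb pb (vh + \<mu> *\<^sub>R xb) s \<rho> \<theta> (1 / (\<mu> - r))
      (sqrt (C / (\<mu> - r)))"
    unfolding localizes_def
  proof (intro conjI ballI)
    show "0 \<le> 1 / (\<mu> - r)" "0 \<le> sqrt (C / (\<mu> - r))" using lam C by auto
    show "\<theta> (vh + \<mu> *\<^sub>R xb) pb = xb"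
      using \<rho>(1) s(1) D(6) by (intro \<theta>_eq[symmetric]) auto
    show "\<theta> y p \<in> ball xb s" if "y \<in> ball (vh + \<mu> *\<^sub>R xb) \<rho>" "p \<in> ball pb \<rho>" for y p
      by (rule \<theta>[OF that])
    show "y - \<mu> *\<^sub>R x \<in> partial_subdiff g x p \<longleftrightarrow> x = \<theta> y p"
      if "y \<in> ball (vh + \<mu> *\<^sub>R xb) \<rho>" "p \<in> ball pb \<rho>" "x \<in> ball xb s" for y p x
      using \<theta>_eq[OF that] \<theta>(2)[OF that(1,2)] by blast
    show "norm (\<theta> y p - \<theta> y' p') \<le> 1 / (\<mu> - r) * norm (y - y') + sqrt (C / (\<mu> - r)) * sqrt (dist p p')"
      if y: "y \<in> ball (vh + \<mu> *\<^sub>R xb) \<rho>" "y' \<in> ball (vh + \<mu> *\<^sub>R xb) \<rho>"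
        and p: "p \<in> ball pb \<rho>" "p' \<in> ball pb \<rho>" for y y' p p'
    proof -
      have "p \<in> ball pb \<sigma>'" "p' \<in> ball pb \<sigma>'" using p \<rho> \<sigma>' by auto
      from est[OF \<theta>(1)[OF y(1) p(1)] \<theta>(1)[OF y(2) p(2)] this
          v_in0[OF y(1) \<theta>(1)[OF y(1) p(1)]] v_in0[OF y(2) \<theta>(1)[OF y(2) p(2)]]
          \<theta>(2)[OF y(1) p(1)] \<theta>(2)[OF y(2) p(2)]]
      show ?thesis by simp
    qed
  qed (use s \<rho> in auto)
  then show thesis by (rule that)
qed

section \<open>Derivatives of the single-valued part\<close>

text \<open>
  The mean value inequality turns continuity of the partial derivative at the single point \<open>(xb, pb)\<close> into a
  Lipschitz estimate on a neighborhood.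
\<close>

lemma assumption_A1_local:
  fixes f :: "'x::real_inner \<Rightarrow> 'p::metric_space \<Rightarrow> 'x"
  assumes A1: "assumption_A1 f xb pb" and e: "0 < e"
  obtains s l where "0 < s" and "0 \<le> l"
    and "\<And>x p. x \<in> ball xb s \<Longrightarrow> p \<in> ball pb s \<Longrightarrow>
      ((\<lambda>y. f y p) has_derivative blinfun_apply (partial_grad f x p)) (at x)"
    and "\<And>x p. x \<in> ball xb s \<Longrightarrow> p \<in> ball pb s \<Longrightarrow>
      norm (partial_grad f x p - partial_grad f xb pb) \<le> e"
    and "\<And>x x' p. x \<in> ball xb s \<Longrightarrow> x' \<in> ball xb s \<Longrightarrow> p \<in> ball pb s \<Longrightarrow>
      norm (f x p - f x' p) \<le> (norm (partial_grad f xb pb) + e) * norm (x - x')"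
    and "\<And>x p p'. x \<in> ball xb s \<Longrightarrow> p \<in> ball pb s \<Longrightarrow> p' \<in> ball pb s \<Longrightarrow>
      norm (f x p - f x p') \<le> l * dist p p'"
proof -
  have diff: "\<forall>\<^sub>F (x, p) in nhds (xb, pb). (\<lambda>y. f y p) differentiable (at x)"
    and cont: "isCont (\<lambda>(x, p). partial_grad f x p) (xb, pb)"
    using A1 by (auto simp: assumption_A1_def)
  obtain U Q l where U: "xb \<in> interior U" and Q: "pb \<in> interior Q" and l: "0 < l" and
    lip: "\<And>x p1 p2. x \<in> U \<Longrightarrow> p1 \<in> Q \<Longrightarrow> p2 \<in> Q \<Longrightarrow> norm (f x p1 - f x p2) \<le> l * dist p1 p2"
    using A1 unfolding assumption_A1_def by blast
  obtain d1 where d1: "0 < d1"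
    "\<And>x p. dist (x, p) (xb, pb) < d1 \<Longrightarrow> (\<lambda>y. f y p) differentiable (at x)"
    using diff unfolding eventually_nhds_metric by auto
  obtain d2 where d2: "0 < d2"
    "\<And>x p. dist (x, p) (xb, pb) < d2 \<Longrightarrow> dist (partial_grad f x p) (partial_grad f xb pb) < e"
    using cont e unfolding continuous_at_eps_delta by (metis (mono_tags, lifting) case_prod_conv)
  obtain d3 where d3: "0 < d3" "ball xb d3 \<subseteq> U" using U by (auto simp: mem_interior)
  obtain d4 where d4: "0 < d4" "ball pb d4 \<subseteq> Q" using Q by (auto simp: mem_interior)
  define s where "s = min (min (d1 / 2) (d2 / 2)) (min d3 d4)"
  have s: "0 < s" "s \<le> d1 / 2" "s \<le> d2 / 2" "s \<le> d3" "s \<le> d4" using d1(1) d2(1) d3(1) d4(1) by (auto simp: s_def)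
  have near: "dist (x, p) (xb, pb) < d1" "dist (x, p) (xb, pb) < d2"
    if "x \<in> ball xb s" "p \<in> ball pb s" for x p
  proof -
    have "dist (x, p) (xb, pb) \<le> dist x xb + dist p pb"
      unfolding dist_Pair_Pair by (rule sqrt_sum_squares_le_sum) auto
    then show "dist (x, p) (xb, pb) < d1" "dist (x, p) (xb, pb) < d2"
      using that s by (auto simp: dist_commute)
  qed
  have der: "((\<lambda>y. f y p) has_derivative blinfun_apply (partial_grad f x p)) (at x)"
    if "x \<in> ball xb s" "p \<in> ball pb s" for x p
  proof -
    have "((\<lambda>y. f y p) has_derivative frechet_derivative (\<lambda>y. f y p) (at x)) (at x)"
      using d1(2)[OF near(1)[OF that]] by (simp add: frechet_derivative_works)
    moreover from this have "bounded_linear (frechet_derivative (\<lambda>y. f y p) (at x))"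
      by (rule has_derivative_bounded_linear)
    ultimately show ?thesis by (simp add: partial_grad_def bounded_linear_Blinfun_apply)
  qed
  have grad: "norm (partial_grad f x p - partial_grad f xb pb) \<le> e"
    if "x \<in> ball xb s" "p \<in> ball pb s" for x p
    using d2(2)[OF near(2)[OF that]] by (simp add: dist_norm)
  show thesis
  proof (rule that[of s l])
    show "norm (f x p - f x' p) \<le> (norm (partial_grad f xb pb) + e) * norm (x - x')"
      if x: "x \<in> ball xb s" "x' \<in> ball xb s" and p: "p \<in> ball pb s" for x x' p
    proof (rule differentiable_bound[of "ball xb s" "\<lambda>y. f y p" "\<lambda>x. blinfun_apply (partial_grad f x p)"])
      show "((\<lambda>y. f y p) has_derivative blinfun_apply (partial_grad f y p)) (at y within ball xb s)"
        if "y \<in> ball xb s" for y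
        using der[OF that p] by (rule has_derivative_at_withinI)
      show "onorm (blinfun_apply (partial_grad f y p)) \<le> norm (partial_grad f xb pb) + e"
        if "y \<in> ball xb s" for y
        using grad[OF that p] norm_triangle_sub[of "partial_grad f y p" "partial_grad f xb pb"]
        by (simp flip: norm_blinfun.rep_eq)
    qed (use x in auto)
    show "norm (f x p - f x p') \<le> l * dist p p'"
      if "x \<in> ball xb s" "p \<in> ball pb s" "p' \<in> ball pb s" for x p p'
    proof (rule lip)
      show "x \<in> U" by (rule subsetD[OF d3(2)]) (use that(1) s(4) in simp)
      show "p \<in> Q" by (rule subsetD[OF d4(2)]) (use that(2) s(5) in simp)
      show "p' \<in> Q" by (rule subsetD[OF d4(2)]) (use that(3) s(5) in simp)
    qed
  qed (use s(1) l der grad in auto)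
qed

lemma has_derivative_estimates:
  fixes \<phi> :: "'x::real_normed_vector \<Rightarrow> 'y::real_normed_vector"
  assumes der: "(\<phi> has_derivative blinfun_apply D) (at x)" and e: "0 < e"
  obtains d where "0 < d" and "\<And>x'. norm (x' - x) < d \<Longrightarrow>
      norm (\<phi> x' - \<phi> x - blinfun_apply D (x' - x)) \<le> e * norm (x' - x)"
    and "\<And>x'. norm (x' - x) < d \<Longrightarrow> norm (\<phi> x' - \<phi> x) \<le> (norm D + e) * norm (x' - x)"
proof -
  obtain d where d: "0 < d" and est: "\<And>x'. norm (x' - x) < d \<Longrightarrow>
      norm (\<phi> x' - \<phi> x - blinfun_apply D (x' - x)) \<le> e * norm (x' - x)"
    using der e unfolding has_derivative_at_alt by blast
  have "norm (\<phi> x' - \<phi> x) \<le> (norm D + e) * norm (x' - x)" if "norm (x' - x) < d" for x'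
    using est[OF that] norm_blinfun[of D "x' - x"]
      norm_triangle_sub[of "\<phi> x' - \<phi> x" "blinfun_apply D (x' - x)"] by (simp add: algebra_simps)
  then show thesis using that d est by blast
qed

section \<open>Coderivatives and strong monotonicity\<close>

text \<open>
  A scalarization \<open>\<zeta> \<bullet> K\<close> of the inverse \<open>K\<close> of \<open>\<phi> + F\<close> has the proximal subgradient \<open>a\<close> at \<open>y\<close> if and only if
  \<open>\<zeta> \<bullet> \<Delta>x \<ge> a \<bullet> \<Delta>y\<close>, up to second order, for \<open>\<Delta>y = \<Delta>v + \<Delta>\<phi>\<close> along the graph of \<open>F\<close>. Linearizing \<open>\<phi>\<close>
  turns this into an inequality between \<open>\<Delta>x\<close> and \<open>\<Delta>v\<close>, that is, into a normal to the graph.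
\<close>

lemma regular_coderivative_of_proximal_subgradient:
  fixes F :: "'x::real_inner \<Rightarrow> 'x set"
  assumes v: "v \<in> F x" and der: "(\<phi> has_derivative blinfun_apply D) (at x)"
    and y: "y = v + \<phi> x" and d0: "0 < d0" and Ky: "K y = x"
    and K: "\<And>x' y'. x' \<in> ball x d0 \<Longrightarrow> y' \<in> ball y d0 \<Longrightarrow> y' - \<phi> x' \<in> F x' \<Longrightarrow> x' = K y'"
    and prox: "\<And>y'. y' \<in> ball y d0 \<Longrightarrow>
      \<zeta> \<bullet> K y + a \<bullet> (y' - y) - M * (norm (y' - y))\<^sup>2 \<le> \<zeta> \<bullet> K y'"
    and z: "\<And>q. z \<bullet> q = a \<bullet> blinfun_apply D q - \<zeta> \<bullet> q"
  shows "z \<in> regular_coderivative F x v (- a)"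
proof -
  have "(z, a) \<in> regular_normal_cone (gph F) (x, v)"
    unfolding regular_normal_cone_iff
  proof (intro conjI allI impI)
    show "(x, v) \<in> gph F" using v by (simp add: gph_def)
    fix e :: real assume e: "0 < e"
    \<comment> \<open>Half of \<open>e\<close> pays for the linearization of \<open>\<phi>\<close>, the other half for the quadratic term.\<close>
    define e1 where "e1 = e / (2 * (norm a + 1))"
    have na: "0 < 2 * (norm a + 1)" by (simp add: add_nonneg_pos)
    have e1: "0 < e1" using e na by (simp add: e1_def)
    have "norm a * e1 \<le> (norm a + 1) * e1" using e1 by simp
    also have "(norm a + 1) * e1 = e / 2"
    proof -
      have "e1 * (2 * (norm a + 1)) = e" unfolding e1_def using na by (metis less_irrefl nonzero_eq_divide_eq)
      then show ?thesis by (simp add: algebra_simps)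
    qed
    finally have ae1: "norm a * e1 \<le> e / 2" .
    obtain d1 where d1: "0 < d1" and est: "\<And>x'. norm (x' - x) < d1 \<Longrightarrow>
        norm (\<phi> x' - \<phi> x - blinfun_apply D (x' - x)) \<le> e1 * norm (x' - x)"
      and lip: "\<And>x'. norm (x' - x) < d1 \<Longrightarrow> norm (\<phi> x' - \<phi> x) \<le> (norm D + e1) * norm (x' - x)"
      using has_derivative_estimates[OF der e1] by blast
    define B where "B = 1 + norm D + e1"
    have B: "1 \<le> B" using e1 by (simp add: B_def)
    define M' where "M' = \<bar>M\<bar> * B\<^sup>2 + 1"
    have M': "0 < M'" by (simp add: M'_def add_nonneg_pos)
    define d where "d = Min {d0, d0 / B, d1, e / (2 * M')}"
    have "0 < d0 / B" "0 < e / (2 * M')" using d0 B e M' by auto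
    then have d: "0 < d" "d \<le> d0" "d \<le> d0 / B" "d \<le> d1" "d \<le> e / (2 * M')"
      using d0 d1 by (simp_all add: d_def)
    have dB: "d * B \<le> d0" using d(3) B by (simp add: pos_le_divide_eq)
    have "0 < 2 * M'" using M' by simp
    with d(5) have dM: "d * (2 * M') \<le> e" by (simp only: pos_le_divide_eq)
    have "(z, a) \<bullet> (w - (x, v)) \<le> e * norm (w - (x, v))"
      if w: "w \<in> gph F" and wd: "dist w (x, v) < d" for w
    proof -
      obtain x' v' where w': "w = (x', v')" by (cases w)
      have v': "v' \<in> F x'" using w by (simp add: w' gph_def)
      define n where "n = norm (w - (x, v))"
      have n: "0 \<le> n" "n < d" using wd by (auto simp: n_def dist_norm)
      have nx: "norm (x' - x) \<le> n" and nv: "norm (v' - v) \<le> n"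
        using norm_fst_le[of "x' - x" "v' - v"] norm_snd_le[of "v' - v" "x' - x"] by (auto simp: n_def w')
      have x'd1: "norm (x' - x) < d1" using nx n d(4) by linarith
      define y' where "y' = v' + \<phi> x'"
      have dy: "y' - y = (v' - v) + (\<phi> x' - \<phi> x)" by (simp add: y'_def y)
      have "norm (y' - y) \<le> n + (norm D + e1) * n"
      proof -
        have "norm (y' - y) \<le> norm (v' - v) + norm (\<phi> x' - \<phi> x)" unfolding dy by (rule norm_triangle_ineq)
        also have "\<dots> \<le> n + (norm D + e1) * n"
          using nv order_trans[OF lip[OF x'd1] mult_left_mono[OF nx, of "norm D + e1"]] e1
          by (intro add_mono) auto
        finally show ?thesis .
      qed
      then have ny: "norm (y' - y) \<le> B * n" by (simp add: B_def algebra_simps)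
      have "B * n < B * d" using n B by simp
      then have y'_in: "y' \<in> ball y d0" using ny dB by (simp add: dist_norm norm_minus_commute mult.commute)
      have x'_in: "x' \<in> ball x d0" using nx n d(2) by (simp add: dist_norm norm_minus_commute)
      have "x' = K y'" by (rule K[OF x'_in y'_in]) (simp add: y'_def v')
      then have p: "a \<bullet> (y' - y) - \<zeta> \<bullet> (x' - x) \<le> M * (norm (y' - y))\<^sup>2"
        using prox[OF y'_in] Ky by (simp add: inner_diff_right)
      also have "\<dots> \<le> \<bar>M\<bar> * (B * n)\<^sup>2"
        using ny by (intro mult_mono power_mono) auto
      also have "\<dots> = (\<bar>M\<bar> * B\<^sup>2) * n * n" by (simp add: power2_eq_square)
      also have "\<dots> \<le> M' * d * n"
        using n M' by (intro mult_right_mono mult_mono) (auto simp: M'_def)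
      also have "\<dots> \<le> e / 2 * n"
      proof (rule mult_right_mono)
        show "M' * d \<le> e / 2" using dM by (simp add: algebra_simps)
      qed (fact n(1))
      finally have q: "a \<bullet> (y' - y) - \<zeta> \<bullet> (x' - x) \<le> e / 2 * n" .
      define \<delta> where "\<delta> = \<phi> x' - \<phi> x - blinfun_apply D (x' - x)"
      have n\<delta>: "norm \<delta> \<le> e1 * n"
        unfolding \<delta>_def by (rule order_trans[OF est[OF x'd1] mult_left_mono[OF nx]]) (use e1 in simp)
      have "- (a \<bullet> \<delta>) \<le> norm a * norm \<delta>" using norm_cauchy_schwarz[of "- a" \<delta>] by simp
      also have "\<dots> \<le> norm a * (e1 * n)"
        using n\<delta> by (rule mult_left_mono) simp
      also have "\<dots> \<le> e / 2 * n" using mult_right_mono[OF ae1 n(1)] by (simp add: mult.assoc)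
      finally have q': "- (a \<bullet> \<delta>) \<le> e / 2 * n" .
      have "v' - v = (y' - y) - \<delta> - blinfun_apply D (x' - x)" by (simp add: dy \<delta>_def)
      then have "a \<bullet> (v' - v) = a \<bullet> (y' - y) - a \<bullet> \<delta> - a \<bullet> blinfun_apply D (x' - x)"
        by (simp only: inner_diff_right)
      moreover have "(z, a) \<bullet> (w - (x, v)) = z \<bullet> (x' - x) + a \<bullet> (v' - v)" by (simp add: w' inner_Pair)
      ultimately have "(z, a) \<bullet> (w - (x, v)) = a \<bullet> (y' - y) - \<zeta> \<bullet> (x' - x) - a \<bullet> \<delta>"
        unfolding z by linarith
      then show ?thesis using q q' by (simp add: n_def[symmetric])
    qed
    then show "\<exists>d>0. \<forall>w\<in>gph F. dist w (x, v) < d \<longrightarrow> (z, a) \<bullet> (w - (x, v)) \<le> e * norm (w - (x, v))"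
      using d(1) by blast
  qed
  then show ?thesis by (simp add: regular_coderivative_def)
qed

text \<open>
  Put \<open>T = 2c K - id\<close>. If \<open>b\<close> is a proximal subgradient of \<open>\<zeta> \<bullet> T\<close>, then \<open>a = (b + \<zeta>) / (2c)\<close> is one of \<open>\<zeta> \<bullet> K\<close>,
  and \<open>c norm a ^ 2 \<le> \<zeta> \<bullet> a\<close> is equivalent to \<open>norm b \<le> norm \<zeta>\<close>. So \<open>\<zeta> \<bullet> T\<close> is Lipschitz with
  modulus \<open>norm \<zeta>\<close>. Choosing \<open>\<zeta> = T y2 - T y1\<close> shows that \<open>T\<close> is nonexpansive, and expanding squares gives
  the conclusion.
\<close>

lemma inverse_strongly_monotone_if_coderivative_bound:
  fixes F :: "'x::{real_inner, complete_space} \<Rightarrow> 'x set"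
  assumes R: "0 < R" and c: "0 < c" and U: "open U"
    and K_in: "\<And>y. y \<in> ball y0 R \<Longrightarrow> K y \<in> U"
    and K: "\<And>y x. y \<in> ball y0 R \<Longrightarrow> x \<in> U \<Longrightarrow> y - \<phi> x \<in> F x \<longleftrightarrow> x = K y"
    and lip: "\<And>y y'. y \<in> ball y0 R \<Longrightarrow> y' \<in> ball y0 R \<Longrightarrow> norm (K y - K y') \<le> L * norm (y - y')"
    and L: "0 \<le> L"
    and der: "\<And>y. y \<in> ball y0 R \<Longrightarrow> (\<phi> has_derivative blinfun_apply (D (K y))) (at (K y))"
    and cod: "\<And>y a z. y \<in> ball y0 R \<Longrightarrow> z \<in> regular_coderivative F (K y) (y - \<phi> (K y)) (- a) \<Longrightarrow>
      c * (norm a)\<^sup>2 \<le> a \<bullet> blinfun_apply (D (K y)) a - z \<bullet> a"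
    and y1: "y1 \<in> ball y0 (R / 10)" and y2: "y2 \<in> ball y0 (R / 10)"
  shows "c * (norm (K y1 - K y2))\<^sup>2 \<le> (y1 - y2) \<bullet> (K y1 - K y2)"
proof -
  define T where "T y = (2 * c) *\<^sub>R K y - y" for y
  have nonexp: "\<zeta> \<bullet> T y2 - \<zeta> \<bullet> T y1 \<le> norm \<zeta> * norm (y2 - y1)" for \<zeta>
  proof (rule lipschitz_if_proximal_subgradients_bounded[of y0 "R / 2" "\<lambda>y. \<zeta> \<bullet> T y"
        "- (norm \<zeta> * (2 * c * (norm (K y0) + L * R) + norm y0 + R))"])
    have sub: "cball y0 (R / 2) \<subseteq> ball y0 R" using R by auto
    have "L-lipschitz_on (ball y0 R) K" using lip L by (intro lipschitz_onI) (auto simp: dist_norm)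
    then have "continuous_on (ball y0 R) K" by (rule lipschitz_on_continuous_on)
    then have "continuous_on (cball y0 (R / 2)) K" by (rule continuous_on_subset[OF _ sub])
    then show "continuous_on (cball y0 (R / 2)) (\<lambda>y. \<zeta> \<bullet> T y)"
      unfolding T_def by (intro continuous_intros)
    show "- (norm \<zeta> * (2 * c * (norm (K y0) + L * R) + norm y0 + R)) \<le> \<zeta> \<bullet> T y" if y: "y \<in> cball y0 (R / 2)" for y
    proof -
      have yR: "y \<in> ball y0 R" using y sub by blast
      then have ny: "norm (y - y0) \<le> R" by (simp add: dist_norm norm_minus_commute)
      have "norm (K y - K y0) \<le> L * norm (y - y0)" using yR R by (intro lip) auto
      also have "\<dots> \<le> L * R" using ny L by (intro mult_left_mono) auto
      finally have "norm (K y) \<le> norm (K y0) + L * R" using norm_triangle_sub[of "K y" "K y0"] by linarith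
      then have "2 * c * norm (K y) \<le> 2 * c * (norm (K y0) + L * R)" using c by (intro mult_left_mono) auto
      moreover have "norm y \<le> norm y0 + R" using ny norm_triangle_sub[of y y0] by linarith
      moreover have "norm (T y) \<le> 2 * c * norm (K y) + norm y"
        using norm_triangle_ineq4[of "(2 * c) *\<^sub>R K y" y] c by (simp add: T_def)
      ultimately have "norm \<zeta> * norm (T y) \<le> norm \<zeta> * (2 * c * (norm (K y0) + L * R) + norm y0 + R)"
        by (intro mult_left_mono) auto
      then show ?thesis using norm_cauchy_schwarz[of "- \<zeta>" "T y"] by simp
    qed
    show "norm b \<le> norm \<zeta>"
      if y: "y \<in> ball y0 (R / 2)" and r: "0 < r" and prox: "\<And>y'. y' \<in> ball y r \<Longrightarrow>
        \<zeta> \<bullet> T y + b \<bullet> (y' - y) - M * (norm (y' - y))\<^sup>2 \<le> \<zeta> \<bullet> T y'" for y b M r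
    proof -
      have yR: "y \<in> ball y0 R" using y R by simp
      define a where "a = (1 / (2 * c)) *\<^sub>R (b + \<zeta>)"
      have b: "b = (2 * c) *\<^sub>R a - \<zeta>" using c by (simp add: a_def)
      obtain d1 where d1: "0 < d1" "ball (K y) d1 \<subseteq> U"
        using U K_in[OF yR] by (meson open_contains_ball)
      define d0 where "d0 = Min {r, d1, R - dist y0 y}"
      have d0: "0 < d0" "d0 \<le> r" "d0 \<le> d1" "d0 \<le> R - dist y0 y" using r d1 yR by (auto simp: d0_def)
      have "bounded_linear (\<lambda>q. a \<bullet> blinfun_apply (D (K y)) q - \<zeta> \<bullet> q)"
        by (intro bounded_linear_sub bounded_linear_inner_right
            bounded_linear_compose[OF bounded_linear_inner_right] blinfun.bounded_linear_right)
      then obtain z where z: "\<And>q. a \<bullet> blinfun_apply (D (K y)) q - \<zeta> \<bullet> q = z \<bullet> q"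
        using riesz_representation by blast
      have ball_R: "y' \<in> ball y0 R" if "y' \<in> ball y d0" for y'
        using that d0(4) dist_triangle[of y0 y' y] by simp
      have "z \<in> regular_coderivative F (K y) (y - \<phi> (K y)) (- a)"
      proof (rule regular_coderivative_of_proximal_subgradient[where \<phi> = \<phi> and K = K and y = y
            and M = "M / (2 * c)" and \<zeta> = \<zeta>, OF _ der[OF yR] _ d0(1)])
        show "y - \<phi> (K y) \<in> F (K y)" using K[OF yR K_in[OF yR]] by simp
        show "x' = K y'" if "x' \<in> ball (K y) d0" "y' \<in> ball y d0" "y' - \<phi> x' \<in> F x'" for x' y'
        proof -
          have "x' \<in> U" by (rule subsetD[OF d1(2)]) (use that(1) d0(3) in simp)
          then show ?thesis using K[OF ball_R[OF that(2)]] that(3) by blast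
        qed
        show "\<zeta> \<bullet> K y + a \<bullet> (y' - y) - M / (2 * c) * (norm (y' - y))\<^sup>2 \<le> \<zeta> \<bullet> K y'" if "y' \<in> ball y d0" for y'
        proof -
          have "y' \<in> ball y r" using that d0(2) by simp
          from prox[OF this]
          have "2 * c * (\<zeta> \<bullet> K y + a \<bullet> (y' - y)) - M * (norm (y' - y))\<^sup>2 \<le> 2 * c * (\<zeta> \<bullet> K y')"
            by (simp add: T_def b inner_diff_left inner_diff_right algebra_simps)
          moreover have "2 * c * (M / (2 * c) * (norm (y' - y))\<^sup>2) = M * (norm (y' - y))\<^sup>2" using c by simp
          ultimately have "2 * c * (\<zeta> \<bullet> K y + a \<bullet> (y' - y) - M / (2 * c) * (norm (y' - y))\<^sup>2) \<le> 2 * c * (\<zeta> \<bullet> K y')"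
            by (simp add: algebra_simps)
          then show ?thesis using c by simp
        qed
      qed (use z in auto)
      from cod[OF yR this] have "c * (norm a)\<^sup>2 \<le> \<zeta> \<bullet> a" using z[of a] by simp
      then have "4 * c * (c * (norm a)\<^sup>2) \<le> 4 * c * (\<zeta> \<bullet> a)" using c by (intro mult_left_mono) auto
      then have "(norm b)\<^sup>2 \<le> (norm \<zeta>)\<^sup>2"
        unfolding b by (simp add: power2_norm_eq_inner inner_diff_left inner_diff_right inner_commute algebra_simps)
      then show ?thesis by (rule power2_le_imp_le) simp
    qed
  qed (use R y1 y2 in auto)
  define w where "w = T y2 - T y1"
  have "norm w * norm w \<le> norm w * norm (y2 - y1)"
    using nonexp[of w] by (simp add: w_def inner_diff_right[symmetric] power2_norm_eq_inner[symmetric] power2_eq_square)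
  then have "norm w \<le> norm (y2 - y1)" by (cases "w = 0") auto
  then have "(norm w)\<^sup>2 \<le> (norm (y2 - y1))\<^sup>2" by (rule power_mono) simp
  then have "4 * c * (c * (norm (K y1 - K y2))\<^sup>2) \<le> 4 * c * ((y1 - y2) \<bullet> (K y1 - K y2))"
    unfolding w_def T_def
    by (simp add: power2_norm_eq_inner inner_diff_left inner_diff_right inner_commute algebra_simps)
  then show ?thesis using c by simp
qed

text \<open>
  The normal cone inequality along \<open>y + t h\<close> reads \<open>\<zeta> \<bullet> \<Delta>x \<le> t (w \<bullet> h) + o(t)\<close>, and stability reads
  \<open>2\<kappa> \<Delta>x = t h - q\<close> with \<open>norm q \<le> t norm h\<close>. Together they give
  \<open>(\<zeta> - 2\<kappa> w) \<bullet> h \<le> norm \<zeta> norm h\<close>, and for \<open>h = \<zeta> - 2\<kappa> w\<close> this is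
  \<open>norm h \<le> norm \<zeta>\<close>.
\<close>

lemma coderivative_bound_of_stable_inverse:
  fixes F :: "'x::{real_inner, complete_space} \<Rightarrow> 'x set"
  assumes \<kappa>: "0 < \<kappa>" and der: "(\<phi> has_derivative blinfun_apply D) (at u)"
    and y: "y = v + \<phi> u" and d0: "0 < d0" and \<Theta>y: "\<Theta> y = u"
    and \<Theta>: "\<And>y'. y' \<in> ball y d0 \<Longrightarrow> y' - \<phi> (\<Theta> y') \<in> F (\<Theta> y')"
    and stable: "\<And>y'. y' \<in> ball y d0 \<Longrightarrow> norm ((y' - y) - (2 * \<kappa>) *\<^sub>R (\<Theta> y' - u)) \<le> norm (y' - y)"
    and z: "z \<in> regular_coderivative F u v w"
  shows "\<kappa> * (norm w)\<^sup>2 \<le> z \<bullet> w + w \<bullet> blinfun_apply D w"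
proof -
  have cone: "(z, - w) \<in> regular_normal_cone (gph F) (u, v)" using z by (simp add: regular_coderivative_def)
  have "bounded_linear (\<lambda>q. z \<bullet> q + w \<bullet> blinfun_apply D q)"
    by (intro bounded_linear_add bounded_linear_inner_right
        bounded_linear_compose[OF bounded_linear_inner_right] blinfun.bounded_linear_right)
  then obtain \<zeta> where \<zeta>: "\<And>q. z \<bullet> q + w \<bullet> blinfun_apply D q = \<zeta> \<bullet> q"
    using riesz_representation by blast
  define h where "h = \<zeta> - (2 * \<kappa>) *\<^sub>R w"
  have "norm h \<le> norm \<zeta>"
  proof (cases "h = 0")
    case False
    \<comment> \<open>\<open>B\<close> bounds the displacement of the graph point relative to the displacement \<open>m\<close> of \<open>y\<close>.\<close>
    define B where "B = 1 + (1 + (norm D + 1)) / \<kappa>"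
    have B: "0 < B" using \<kappa> by (simp add: B_def add_pos_nonneg)
    define c where "c = 2 * \<kappa> * (norm w / \<kappa> + B)"
    have c: "0 < c" using \<kappa> B by (simp add: c_def add_nonneg_pos)
    have step: "norm h \<le> norm \<zeta> + e * c" if e: "0 < e" "e \<le> 1" for e
    proof -
      obtain d where d: "0 < d" and near: "\<And>q. q \<in> gph F \<Longrightarrow> dist q (u, v) < d \<Longrightarrow>
          (z, - w) \<bullet> (q - (u, v)) \<le> e * norm (q - (u, v))"
        using cone e(1) unfolding regular_normal_cone_iff by blast
      obtain d1 where d1: "0 < d1" and est: "\<And>x'. norm (x' - u) < d1 \<Longrightarrow>
          norm (\<phi> x' - \<phi> u - blinfun_apply D (x' - u)) \<le> e * norm (x' - u)"
        and lip: "\<And>x'. norm (x' - u) < d1 \<Longrightarrow> norm (\<phi> x' - \<phi> u) \<le> (norm D + e) * norm (x' - u)"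
        using has_derivative_estimates[OF der e(1)] by blast
      define m where "m = Min {d0 / 2, d / (2 * B), d1 * \<kappa> / 2}"
      have m: "0 < m" "m \<le> d0 / 2" "m \<le> d / (2 * B)" "m \<le> d1 * \<kappa> / 2"
        using d0 d B d1 \<kappa> by (auto simp: m_def)
      define t where "t = m / norm h"
      have t: "0 < t" "t * norm h = m" using m(1) False by (auto simp: t_def)
      define y' where "y' = y + t *\<^sub>R h"
      define x' where "x' = \<Theta> y'"
      define v' where "v' = y' - \<phi> x'"
      have dy: "y' - y = t *\<^sub>R h" "norm (y' - y) = m" using t by (auto simp: y'_def)
      have y'_in: "y' \<in> ball y d0" using dy(2) m d0 by (simp add: dist_norm norm_minus_commute)
      define q where "q = (y' - y) - (2 * \<kappa>) *\<^sub>R (x' - u)"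
      have q: "norm q \<le> m" using stable[OF y'_in] dy(2) by (simp add: q_def x'_def)
      have two: "(2 * \<kappa>) *\<^sub>R (x' - u) = t *\<^sub>R h - q" by (simp add: q_def dy(1))
      have "2 * \<kappa> * norm (x' - u) = norm (t *\<^sub>R h - q)" using two \<kappa> by (metis abs_of_pos norm_scaleR mult_pos_pos zero_less_numeral)
      also have "\<dots> \<le> 2 * m" using norm_triangle_ineq4[of "t *\<^sub>R h" q] q dy by simp
      finally have nx: "norm (x' - u) \<le> m / \<kappa>" using \<kappa> by (simp add: pos_le_divide_eq mult.commute)
      have "m / \<kappa> \<le> d1 / 2" using m(4) \<kappa> by (simp add: pos_divide_le_eq)
      then have nx1: "norm (x' - u) < d1" using nx d1 by linarith
      have dv: "v' - v = (y' - y) - (\<phi> x' - \<phi> u)" by (simp add: v'_def y)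
      have "norm (\<phi> x' - \<phi> u) \<le> (norm D + 1) * (m / \<kappa>)"
        by (rule order_trans[OF lip[OF nx1]]) (use e nx \<kappa> m in \<open>intro mult_mono; simp\<close>)
      then have nv: "norm (v' - v) \<le> m + (norm D + 1) * (m / \<kappa>)"
        using norm_triangle_ineq4[of "y' - y" "\<phi> x' - \<phi> u"] dy(2) unfolding dv by linarith
      have "norm ((x', v') - (u, v)) \<le> norm (x' - u) + norm (v' - v)" by (simp add: norm_Pair_le)
      also have "\<dots> \<le> m / \<kappa> + (m + (norm D + 1) * (m / \<kappa>))" using nx nv by linarith
      also have "\<dots> = B * m" by (simp add: B_def algebra_simps add_divide_distrib)
      finally have n: "norm ((x', v') - (u, v)) \<le> B * m" .
      have "B * m \<le> d / 2" using m(3) B by (simp add: pos_le_divide_eq mult.commute mult.left_commute)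
      then have "dist (x', v') (u, v) < d" using n d by (simp add: dist_norm)
      moreover have "(x', v') \<in> gph F" using \<Theta>[OF y'_in] by (simp add: gph_def v'_def x'_def)
      ultimately have "(z, - w) \<bullet> ((x', v') - (u, v)) \<le> e * norm ((x', v') - (u, v))" using near by blast
      also have "\<dots> \<le> e * (B * m)" using n e by (intro mult_left_mono) auto
      finally have 1: "z \<bullet> (x' - u) - w \<bullet> (v' - v) \<le> e * (B * m)" by (simp add: inner_Pair)
      define \<delta> where "\<delta> = \<phi> x' - \<phi> u - blinfun_apply D (x' - u)"
      have n\<delta>: "norm \<delta> \<le> e * (m / \<kappa>)"
        unfolding \<delta>_def by (rule order_trans[OF est[OF nx1] mult_left_mono[OF nx]]) (use e in simp)
      have "- (w \<bullet> \<delta>) \<le> norm w * norm \<delta>" using norm_cauchy_schwarz[of "- w" \<delta>] by simp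
      also have "\<dots> \<le> norm w * (e * (m / \<kappa>))"
        using n\<delta> by (rule mult_left_mono) simp
      finally have 2: "- (w \<bullet> \<delta>) \<le> norm w * (e * (m / \<kappa>))" .
      have "v' - v = t *\<^sub>R h - \<delta> - blinfun_apply D (x' - u)" by (simp add: dv dy(1) \<delta>_def)
      then have "w \<bullet> (v' - v) = t * (w \<bullet> h) - w \<bullet> \<delta> - w \<bullet> blinfun_apply D (x' - u)"
        by (simp only: inner_diff_right inner_scaleR_right)
      with 1 have "\<zeta> \<bullet> (x' - u) - t * (w \<bullet> h) + w \<bullet> \<delta> \<le> e * (B * m)"
        unfolding \<zeta>[symmetric] by linarith
      with 2 have "\<zeta> \<bullet> (x' - u) \<le> t * (w \<bullet> h) + (e * (B * m) + norm w * (e * (m / \<kappa>)))" by linarith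
      then have "2 * \<kappa> * (\<zeta> \<bullet> (x' - u)) \<le> 2 * \<kappa> * (t * (w \<bullet> h) + (e * (B * m) + norm w * (e * (m / \<kappa>))))"
        using \<kappa> by (intro mult_left_mono) auto
      also have "2 * \<kappa> * (\<zeta> \<bullet> (x' - u)) = t * (\<zeta> \<bullet> h) - \<zeta> \<bullet> q"
        using arg_cong[OF two, of "\<lambda>a. \<zeta> \<bullet> a"] by (simp add: inner_diff_right)
      also have "2 * \<kappa> * (t * (w \<bullet> h) + (e * (B * m) + norm w * (e * (m / \<kappa>))))
          = t * (2 * \<kappa> * (w \<bullet> h)) + m * (e * c)"
        using \<kappa> by (simp add: c_def field_simps)
      finally have "t * (h \<bullet> h) \<le> \<zeta> \<bullet> q + m * (e * c)"
        by (simp add: h_def inner_diff_left inner_diff_right inner_commute algebra_simps)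
      moreover have "\<zeta> \<bullet> q \<le> norm \<zeta> * m"
        using norm_cauchy_schwarz[of \<zeta> q] mult_left_mono[OF q, of "norm \<zeta>"] by simp
      moreover have "t * (h \<bullet> h) = m * norm h"
        using t(2) by (simp add: power2_norm_eq_inner[symmetric] power2_eq_square mult.assoc[symmetric])
      ultimately have "m * norm h \<le> m * (norm \<zeta> + e * c)" by (simp add: algebra_simps)
      then show ?thesis using m(1) by simp
    qed
    show ?thesis
    proof (rule field_le_epsilon)
      fix \<epsilon> :: real assume \<epsilon>: "0 < \<epsilon>"
      define e where "e = min 1 (\<epsilon> / c)"
      have "e \<le> \<epsilon> / c" by (simp add: e_def)
      then have "e * c \<le> \<epsilon>" using c by (simp only: pos_le_divide_eq)
      moreover have "0 < e" "e \<le> 1" using \<epsilon> c by (auto simp: e_def)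
      ultimately show "norm h \<le> norm \<zeta> + \<epsilon>" using step[of e] by linarith
    qed
  qed simp
  then have "(norm h)\<^sup>2 \<le> (norm \<zeta>)\<^sup>2" by (rule power_mono) simp
  then have "4 * \<kappa> * (\<kappa> * (norm w)\<^sup>2) \<le> 4 * \<kappa> * (\<zeta> \<bullet> w)"
    unfolding h_def
    by (simp add: power2_norm_eq_inner inner_diff_left inner_diff_right inner_commute algebra_simps)
  then have "\<kappa> * (norm w)\<^sup>2 \<le> \<zeta> \<bullet> w" using \<kappa> by simp
  then show ?thesis by (simp add: \<zeta>)
qed

section \<open>Stability and the coderivative condition\<close>

lemma mem_solution_map_iff: "x \<in> solution_map f g v p \<longleftrightarrow> v - f x p \<in> partial_subdiff g x p"
proof -
  have "v - f x p \<in> partial_subdiff g x p \<Longrightarrow> v \<in> (\<lambda>s. f x p + s) ` partial_subdiff g x p"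
    by (rule image_eqI[where x = "v - f x p"]) simp_all
  then show ?thesis by (auto simp: solution_map_def)
qed

text \<open>
  The Lipschitz modulus of a localization in \<open>y\<close> may be determined for each parameter separately, because the
  Hoelder estimate can be applied with \<open>y\<close> fixed.
\<close>

lemma localizes_improve_modulus:
  assumes loc: "localizes T M xb pb yb s \<rho> \<theta> L C" and \<rho>': "0 < \<rho>'" "\<rho>' \<le> \<rho>" and L': "0 \<le> L'"
    and lip: "\<And>y y' p. y \<in> ball yb \<rho>' \<Longrightarrow> y' \<in> ball yb \<rho>' \<Longrightarrow> p \<in> ball pb \<rho>' \<Longrightarrow>
      norm (\<theta> y p - \<theta> y' p) \<le> L' * norm (y - y')"
  shows "localizes T M xb pb yb s \<rho>' \<theta> L' C"
proof -
  note D = localizesD[OF loc]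
  have sub: "y \<in> ball yb \<rho>" if "y \<in> ball yb \<rho>'" for y using that \<rho>'(2) by simp
  have subp: "p \<in> ball pb \<rho>" if "p \<in> ball pb \<rho>'" for p using that \<rho>'(2) by simp
  show ?thesis
    unfolding localizes_def
  proof (intro conjI ballI)
    show "norm (\<theta> y p - \<theta> y' p') \<le> L' * norm (y - y') + C * sqrt (dist p p')"
      if y: "y \<in> ball yb \<rho>'" "y' \<in> ball yb \<rho>'" and p: "p \<in> ball pb \<rho>'" "p' \<in> ball pb \<rho>'" for y y' p p'
    proof -
      have "norm (\<theta> y' p - \<theta> y' p') \<le> L * norm (y' - y') + C * sqrt (dist p p')"
        by (rule D(8)[OF sub[OF y(2)] sub[OF y(2)] subp[OF p(1)] subp[OF p(2)]])
      moreover have "norm (\<theta> y p - \<theta> y' p') \<le> norm (\<theta> y p - \<theta> y' p) + norm (\<theta> y' p - \<theta> y' p')"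
        using norm_triangle_ineq[of "\<theta> y p - \<theta> y' p" "\<theta> y' p - \<theta> y' p'"] by simp
      ultimately show ?thesis using lip[OF y p(1)] by simp
    qed
    show "\<theta> y p \<in> ball xb s" if "y \<in> ball yb \<rho>'" "p \<in> ball pb \<rho>'" for y p
      by (rule D(6)[OF sub[OF that(1)] subp[OF that(2)]])
    show "y - M x p \<in> T x p \<longleftrightarrow> x = \<theta> y p"
      if "y \<in> ball yb \<rho>'" "p \<in> ball pb \<rho>'" "x \<in> ball xb s" for y p x
      by (rule D(7)[OF sub[OF that(1)] subp[OF that(2)] that(3)])
  qed (use D(1,4,5) \<rho>'(1) L' in auto)
qed

lemma stable_iff_strongly_monotone:
  fixes a b :: "'x::real_inner"
  assumes "0 < \<kappa>"
  shows "norm (a - (2 * \<kappa>) *\<^sub>R b) \<le> norm a \<longleftrightarrow> \<kappa> * (norm b)\<^sup>2 \<le> a \<bullet> b"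
proof -
  have "norm (a - (2 * \<kappa>) *\<^sub>R b) \<le> norm a \<longleftrightarrow> (norm (a - (2 * \<kappa>) *\<^sub>R b))\<^sup>2 \<le> (norm a)\<^sup>2"
    by (simp add: power2_le_iff_abs_le)
  also have "\<dots> \<longleftrightarrow> 4 * \<kappa> * (\<kappa> * (norm b)\<^sup>2) \<le> 4 * \<kappa> * (a \<bullet> b)"
    by (simp add: power2_norm_eq_inner inner_diff_left inner_diff_right inner_commute algebra_simps)
  also have "\<dots> \<longleftrightarrow> \<kappa> * (norm b)\<^sup>2 \<le> a \<bullet> b" using assms by simp
  finally show ?thesis .
qed

lemma coderivative_condition_if_stable:
  fixes f :: "'x::{real_inner, complete_space} \<Rightarrow> 'p::metric_space \<Rightarrow> 'x"
  assumes A1: "assumption_A1 f xb pb" and vh: "vh = vb - f xb pb"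
    and stable: "hoelderian_fully_stable (solution_map f g) vb pb xb \<kappa> l"
    and \<kappa>0: "0 < \<kappa>0" "\<kappa>0 < \<kappa>"
  shows "\<exists>\<eta>>0. coderivative_condition f g xb pb vh \<eta> \<kappa>0"
proof -
  have \<kappa>: "0 < \<kappa>" using \<kappa>0 by simp
  obtain V Q U \<theta> where loc: "single_valued_localization (solution_map f g) vb pb xb V Q U \<theta>"
    and est: "\<And>v1 p1 v2 p2. v1 \<in> V \<Longrightarrow> p1 \<in> Q \<Longrightarrow> v2 \<in> V \<Longrightarrow> p2 \<in> Q \<Longrightarrow>
        norm ((v1 - v2) - (2 * \<kappa>) *\<^sub>R (\<theta> v1 p1 - \<theta> v2 p2)) \<le> norm (v1 - v2) + l * sqrt (dist p1 p2)"
    using stable unfolding hoelderian_fully_stable_def by blast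
  have \<theta>: "v \<in> V \<and> p \<in> Q \<and> x = \<theta> v p \<longleftrightarrow> x \<in> solution_map f g v p \<and> v \<in> V \<and> p \<in> Q \<and> x \<in> U" for v p x
    using loc unfolding single_valued_localization_def set_eq_iff by fastforce
  have "vb \<in> interior V" "pb \<in> interior Q" "xb \<in> interior U"
    using loc unfolding single_valued_localization_def by auto
  then obtain e1 e2 e3 where e: "0 < e1" "ball vb e1 \<subseteq> V" "0 < e2" "ball pb e2 \<subseteq> Q" "0 < e3" "ball xb e3 \<subseteq> U"
    by (meson mem_interior)
  let ?A = "partial_grad f xb pb"
  define \<epsilon> where "\<epsilon> = \<kappa> - \<kappa>0"
  have \<epsilon>: "0 < \<epsilon>" using \<kappa>0 by (simp add: \<epsilon>_def)
  obtain s L where s: "0 < s" and L: "0 \<le> L" and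
    der: "\<And>x p. x \<in> ball xb s \<Longrightarrow> p \<in> ball pb s \<Longrightarrow>
      ((\<lambda>y. f y p) has_derivative blinfun_apply (partial_grad f x p)) (at x)" and
    grad: "\<And>x p. x \<in> ball xb s \<Longrightarrow> p \<in> ball pb s \<Longrightarrow> norm (partial_grad f x p - ?A) \<le> \<epsilon>" and
    lipx: "\<And>x x' p. x \<in> ball xb s \<Longrightarrow> x' \<in> ball xb s \<Longrightarrow> p \<in> ball pb s \<Longrightarrow>
      norm (f x p - f x' p) \<le> (norm ?A + \<epsilon>) * norm (x - x')" and
    lipp: "\<And>x p p'. x \<in> ball xb s \<Longrightarrow> p \<in> ball pb s \<Longrightarrow> p' \<in> ball pb s \<Longrightarrow>
      norm (f x p - f x p') \<le> L * dist p p'"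
    using assumption_A1_local[OF A1 \<epsilon>] by blast
  define m where "m = norm ?A + \<epsilon>"
  have m: "0 < m" using \<epsilon> by (simp add: m_def add_nonneg_pos)
  \<comment> \<open>On a ball of radius \<open>\<eta>\<close> the values \<open>v + f u p\<close> stay within \<open>B * \<eta>\<close> of \<open>vb\<close>.\<close>
  define B where "B = 1 + m + L"
  have B: "0 < B" using m L by (simp add: B_def)
  define \<eta> where "\<eta> = Min {s / 2, e2 / 2, e3 / 2, e1 / (2 * B)}"
  have \<eta>: "0 < \<eta>" "\<eta> \<le> s / 2" "\<eta> \<le> e2 / 2" "\<eta> \<le> e3 / 2" "\<eta> \<le> e1 / (2 * B)"
    using s e(1,3,5) B by (auto simp: \<eta>_def)
  have "0 < 2 * B" using B by simp
  with \<eta>(5) have \<eta>B: "\<eta> * (2 * B) \<le> e1" by (simp only: pos_le_divide_eq)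
  have "\<kappa>0 * (norm w)\<^sup>2 \<le> blinfun_apply ?A w \<bullet> w + z \<bullet> w"
    if v: "v \<in> partial_subdiff g u p" and u: "u \<in> cball xb \<eta>" and p: "p \<in> cball pb \<eta>" and vn: "v \<in> cball vh \<eta>"
      and z: "z \<in> regular_coderivative (\<lambda>x. partial_subdiff g x p) u v w" for u p v w z
  proof -
    have us: "u \<in> ball xb s" and ps: "p \<in> ball pb s" and uU: "u \<in> ball xb e3" and pQ: "p \<in> ball pb e2"
      using u p \<eta> s e by auto
    define y where "y = v + f u p"
    have "y - vb = (v - vh) + ((f u p - f xb p) + (f xb p - f xb pb))" by (simp add: y_def vh)
    then have "norm (y - vb) \<le> norm (v - vh) + (norm (f u p - f xb p) + norm (f xb p - f xb pb))"
      by (metis norm_triangle_le add_left_mono norm_triangle_ineq)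
    moreover have "norm (f u p - f xb p) \<le> m * norm (u - xb)"
      unfolding m_def using us ps s by (intro lipx) auto
    moreover have "m * norm (u - xb) \<le> m * \<eta>"
      using u m by (intro mult_left_mono) (auto simp: dist_norm norm_minus_commute)
    moreover have "norm (f xb p - f xb pb) \<le> L * dist p pb" using ps s by (intro lipp) auto
    moreover have "L * dist p pb \<le> L * \<eta>" using p L by (intro mult_left_mono) (auto simp: dist_commute)
    ultimately have "norm (y - vb) \<le> B * \<eta>"
      using vn by (simp add: B_def algebra_simps dist_norm norm_minus_commute)
    also have "\<dots> < e1" using \<eta>B e(1) by (simp add: algebra_simps)
    finally have y_in: "y \<in> ball vb e1" by (simp add: dist_norm norm_minus_commute)
    define d0 where "d0 = e1 - dist vb y"
    have d0: "0 < d0" using y_in by (simp add: d0_def)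
    have inV: "y' \<in> V" if "y' \<in> ball y d0" for y'
    proof (rule subsetD[OF e(2)])
      show "y' \<in> ball vb e1" using that dist_triangle[of vb y' y] by (simp add: d0_def)
    qed
    have yV: "y \<in> V" using inV d0 by simp
    have inQ: "p \<in> Q" by (rule subsetD[OF e(4) pQ])
    have "u \<in> U" by (rule subsetD[OF e(6) uU])
    moreover have "u \<in> solution_map f g y p" using v by (simp add: mem_solution_map_iff y_def)
    ultimately have \<theta>y: "\<theta> y p = u" using \<theta>[of y p u] yV inQ by blast
    have "\<kappa> * (norm w)\<^sup>2 \<le> z \<bullet> w + w \<bullet> blinfun_apply (partial_grad f u p) w"
    proof (rule coderivative_bound_of_stable_inverse[where F = "\<lambda>x. partial_subdiff g x p" and
          \<Theta> = "\<lambda>y. \<theta> y p" and v = v and u = u and y = y, OF \<kappa> der[OF us ps] _ d0 \<theta>y])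
      show "y' - f (\<theta> y' p) p \<in> partial_subdiff g (\<theta> y' p) p" if "y' \<in> ball y d0" for y'
        using \<theta>[of y' p "\<theta> y' p"] inV[OF that] inQ by (simp add: mem_solution_map_iff)
      show "norm ((y' - y) - (2 * \<kappa>) *\<^sub>R (\<theta> y' p - u)) \<le> norm (y' - y)" if "y' \<in> ball y d0" for y'
        using est[OF inV[OF that] inQ yV inQ] by (simp add: \<theta>y)
    qed (use z in \<open>auto simp: y_def\<close>)
    moreover have "w \<bullet> blinfun_apply (partial_grad f u p) w \<le> blinfun_apply ?A w \<bullet> w + \<epsilon> * (norm w)\<^sup>2"
    proof -
      have "w \<bullet> blinfun_apply (partial_grad f u p - ?A) w \<le> norm w * norm (blinfun_apply (partial_grad f u p - ?A) w)"
        by (rule norm_cauchy_schwarz)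
      also have "\<dots> \<le> norm w * (norm (partial_grad f u p - ?A) * norm w)"
        by (intro mult_left_mono norm_blinfun) auto
      also have "\<dots> \<le> norm w * (\<epsilon> * norm w)"
        using grad[OF us ps] by (intro mult_left_mono mult_right_mono) auto
      finally show ?thesis
        by (simp add: blinfun.diff_left inner_diff_right inner_commute power2_eq_square algebra_simps)
    qed
    ultimately show ?thesis by (simp add: \<epsilon>_def algebra_simps)
  qed
  then have "coderivative_condition f g xb pb vh \<eta> \<kappa>0"
    unfolding coderivative_condition_def gph_partial_subdiff_def by auto
  then show ?thesis using \<eta>(1) by blast
qed

text \<open>
  The coderivative condition involves the derivative of \<open>f\<close> at the reference point, whereas the inverse
  of \<open>\<mu> x + f(x, p) + \<partial>g(x, p)\<close> calls for the derivative at the solution. The loss \<open>\<kappa>0 - \<kappa>\<close> pays for the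
  difference.
\<close>

lemma resolvent_strongly_monotone:
  fixes f :: "'x::{real_inner, complete_space} \<Rightarrow> 'p::metric_space \<Rightarrow> 'x"
  assumes A1: "assumption_A1 f xb pb"
    and cod: "coderivative_condition f g xb pb vh \<eta> \<kappa>0" and \<eta>: "0 < \<eta>"
    and \<kappa>: "0 < \<kappa>" "\<kappa> < \<kappa>0" and \<mu>: "0 \<le> \<mu>"
    and yb: "yb = vh + \<mu> *\<^sub>R xb + f xb pb"
    and loc: "localizes (partial_subdiff g) (\<lambda>x p. \<mu> *\<^sub>R x + f x p) xb pb yb s \<rho> \<theta> L C"
  obtains \<rho>' where "0 < \<rho>'" and "\<rho>' \<le> \<rho>"
    and "\<And>y1 y2 p. y1 \<in> ball yb \<rho>' \<Longrightarrow> y2 \<in> ball yb \<rho>' \<Longrightarrow> p \<in> ball pb \<rho>' \<Longrightarrow>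
      (\<mu> + \<kappa>) * (norm (\<theta> y1 p - \<theta> y2 p))\<^sup>2 \<le> (y1 - y2) \<bullet> (\<theta> y1 p - \<theta> y2 p)"
proof -
  let ?A = "partial_grad f xb pb"
  define \<epsilon> where "\<epsilon> = \<kappa>0 - \<kappa>"
  have \<epsilon>: "0 < \<epsilon>" using \<kappa> by (simp add: \<epsilon>_def)
  obtain s1 l where s1: "0 < s1" and l: "0 \<le> l" and
    der: "\<And>x p. x \<in> ball xb s1 \<Longrightarrow> p \<in> ball pb s1 \<Longrightarrow>
      ((\<lambda>y. f y p) has_derivative blinfun_apply (partial_grad f x p)) (at x)" and
    grad: "\<And>x p. x \<in> ball xb s1 \<Longrightarrow> p \<in> ball pb s1 \<Longrightarrow> norm (partial_grad f x p - ?A) \<le> \<epsilon>" and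
    lipx: "\<And>x x' p. x \<in> ball xb s1 \<Longrightarrow> x' \<in> ball xb s1 \<Longrightarrow> p \<in> ball pb s1 \<Longrightarrow>
      norm (f x p - f x' p) \<le> (norm ?A + \<epsilon>) * norm (x - x')" and
    lipp: "\<And>x p p'. x \<in> ball xb s1 \<Longrightarrow> p \<in> ball pb s1 \<Longrightarrow> p' \<in> ball pb s1 \<Longrightarrow>
      norm (f x p - f x p') \<le> l * dist p p'"
    using assumption_A1_local[OF A1 \<epsilon>] by blast
  define m where "m = norm ?A + \<epsilon>"
  have m: "0 < m" using \<epsilon> by (simp add: m_def add_nonneg_pos)
  define s2 where "s2 = Min {s, s1, \<eta>, \<eta> / (2 * (\<mu> + m))}"
  have "0 < 2 * (\<mu> + m)" using \<mu> m by simp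
  then have s2: "0 < s2" "s2 \<le> s" "s2 \<le> s1" "s2 \<le> \<eta>" and "s2 \<le> \<eta> / (2 * (\<mu> + m))"
    using localizesD(1)[OF loc] s1 \<eta> by (auto simp: s2_def)
  with \<open>0 < 2 * (\<mu> + m)\<close> have "s2 * (2 * (\<mu> + m)) \<le> \<eta>" by (simp only: pos_le_divide_eq)
  then have ms2: "(\<mu> + m) * s2 \<le> \<eta> / 2" by (simp add: algebra_simps)
  define \<rho>0 where "\<rho>0 = Min {s1, \<eta>, \<eta> / (2 * (1 + l))}"
  have \<rho>0: "0 < \<rho>0" "\<rho>0 \<le> s1" "\<rho>0 \<le> \<eta>" and "\<rho>0 \<le> \<eta> / (2 * (1 + l))"
    using s1 \<eta> l by (auto simp: \<rho>0_def)
  moreover have "0 < 2 * (1 + l)" using l by simp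
  ultimately have "\<rho>0 * (2 * (1 + l)) \<le> \<eta>" by (simp only: pos_le_divide_eq)
  then have l\<rho>0: "(1 + l) * \<rho>0 \<le> \<eta> / 2" by (simp add: algebra_simps)
  obtain R where R: "R \<le> \<rho>" "R \<le> \<rho>0" and
    loc2: "localizes (partial_subdiff g) (\<lambda>x p. \<mu> *\<^sub>R x + f x p) xb pb yb s2 R \<theta> L C"
    using localizes_shrink[OF loc s2(1,2) \<rho>0(1)] by blast
  note D = localizesD[OF loc2]
  show thesis
  proof (rule that[of "R / 10"])
    fix y1 y2 p
    assume y: "y1 \<in> ball yb (R / 10)" "y2 \<in> ball yb (R / 10)" and p10: "p \<in> ball pb (R / 10)"
    have p: "p \<in> ball pb R" using p10 D(2) by simp
    have ps1: "p \<in> ball pb s1" and p\<eta>: "p \<in> cball pb \<eta>" using p R \<rho>0 by auto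
    have xs1: "\<theta> y p \<in> ball xb s1" if "y \<in> ball yb R" for y using D(6)[OF that p] s2(3) by simp
    have diff: "((\<lambda>x. \<mu> *\<^sub>R x + f x p) has_derivative
        blinfun_apply (\<mu> *\<^sub>R id_blinfun + partial_grad f (\<theta> y p) p)) (at (\<theta> y p))" if "y \<in> ball yb R" for y
    proof -
      have "((\<lambda>x. \<mu> *\<^sub>R x + f x p) has_derivative
          (\<lambda>q. \<mu> *\<^sub>R q + blinfun_apply (partial_grad f (\<theta> y p) p) q)) (at (\<theta> y p))"
        by (intro derivative_intros der[OF xs1[OF that] ps1])
      moreover have "(\<lambda>q. \<mu> *\<^sub>R q + blinfun_apply (partial_grad f (\<theta> y p) p) q) =
          blinfun_apply (\<mu> *\<^sub>R id_blinfun + partial_grad f (\<theta> y p) p)"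
        by (simp add: fun_eq_iff blinfun.add_left blinfun.scaleR_left)
      ultimately show ?thesis by (simp only:)
    qed
    have cod_y: "(\<mu> + \<kappa>) * (norm a)\<^sup>2 \<le>
        a \<bullet> blinfun_apply (\<mu> *\<^sub>R id_blinfun + partial_grad f (\<theta> y p) p) a - z \<bullet> a"
      if y: "y \<in> ball yb R" and z: "z \<in> regular_coderivative (\<lambda>x. partial_subdiff g x p)
        (\<theta> y p) (y - (\<mu> *\<^sub>R \<theta> y p + f (\<theta> y p) p)) (- a)" for y a z
    proof -
      let ?x = "\<theta> y p"
      define v where "v = y - (\<mu> *\<^sub>R ?x + f ?x p)"
      have x: "?x \<in> ball xb s2" by (rule D(6)[OF y p])
      have v: "v \<in> partial_subdiff g ?x p" unfolding v_def using D(7)[OF y p x] by simp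
      have "v - vh = (y - yb) - (\<mu> *\<^sub>R (?x - xb) + ((f ?x p - f xb p) + (f xb p - f xb pb)))"
        by (simp add: v_def yb algebra_simps)
      then have "norm (v - vh) \<le> norm (y - yb) + norm (\<mu> *\<^sub>R (?x - xb) + ((f ?x p - f xb p) + (f xb p - f xb pb)))"
        by (simp only: norm_triangle_ineq4)
      also have "\<dots> \<le> norm (y - yb) + (norm (\<mu> *\<^sub>R (?x - xb)) + (norm (f ?x p - f xb p) + norm (f xb p - f xb pb)))"
        by (intro add_left_mono order_trans[OF norm_triangle_ineq] norm_triangle_ineq)
      also have "\<dots> \<le> R + (\<mu> * s2 + (m * s2 + l * R))"
      proof (intro add_mono)
        show "norm (y - yb) \<le> R" using y by (simp add: dist_norm norm_minus_commute)
        have nx: "norm (?x - xb) \<le> s2" using x by (simp add: dist_norm norm_minus_commute)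
        show "norm (\<mu> *\<^sub>R (?x - xb)) \<le> \<mu> * s2" using nx \<mu> by (simp add: mult_left_mono)
        have "norm (f ?x p - f xb p) \<le> m * norm (?x - xb)"
          unfolding m_def using xs1[OF y] ps1 s1 by (intro lipx) auto
        also have "\<dots> \<le> m * s2" using nx m by (intro mult_left_mono) auto
        finally show "norm (f ?x p - f xb p) \<le> m * s2" .
        have "norm (f xb p - f xb pb) \<le> l * dist p pb" using ps1 s1 by (intro lipp) auto
        also have "\<dots> \<le> l * R" using p l by (intro mult_left_mono) (auto simp: dist_commute)
        finally show "norm (f xb p - f xb pb) \<le> l * R" .
      qed
      also have "\<dots> = (1 + l) * R + (\<mu> + m) * s2" by (simp add: algebra_simps)
      also have "\<dots> \<le> \<eta>"
      proof -
        have "(1 + l) * R \<le> (1 + l) * \<rho>0" using R(2) l by (intro mult_left_mono) auto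
        then show ?thesis using l\<rho>0 ms2 by linarith
      qed
      finally have "v \<in> cball vh \<eta>" by (simp add: dist_norm norm_minus_commute)
      moreover have "?x \<in> cball xb \<eta>" using x s2(4) by simp
      ultimately have "(?x, p, v) \<in> gph_partial_subdiff g \<inter> cball xb \<eta> \<times> cball pb \<eta> \<times> cball vh \<eta>"
        using v p\<eta> by (simp add: gph_partial_subdiff_def)
      then have "\<kappa>0 * (norm (- a))\<^sup>2 \<le> blinfun_apply ?A (- a) \<bullet> (- a) + z \<bullet> (- a)"
        using cod z unfolding coderivative_condition_def v_def[symmetric] by blast
      then have 1: "\<kappa>0 * (norm a)\<^sup>2 \<le> blinfun_apply ?A a \<bullet> a - z \<bullet> a" by (simp add: blinfun.minus_right)
      have "blinfun_apply (?A - partial_grad f ?x p) a \<bullet> a \<le> norm (blinfun_apply (?A - partial_grad f ?x p) a) * norm a"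
        by (rule norm_cauchy_schwarz)
      also have "\<dots> \<le> (norm (?A - partial_grad f ?x p) * norm a) * norm a"
        by (intro mult_right_mono norm_blinfun) auto
      also have "\<dots> \<le> (\<epsilon> * norm a) * norm a"
        using grad[OF xs1[OF y] ps1] by (intro mult_right_mono) (auto simp: norm_minus_commute)
      finally have "blinfun_apply ?A a \<bullet> a \<le> a \<bullet> blinfun_apply (partial_grad f ?x p) a + \<epsilon> * (norm a)\<^sup>2"
        by (simp add: blinfun.diff_left inner_diff_left inner_commute power2_eq_square algebra_simps)
      with 1 show ?thesis
        by (simp add: \<epsilon>_def blinfun.add_left blinfun.scaleR_left inner_add_right
            power2_norm_eq_inner[symmetric] algebra_simps)
    qed
    show "(\<mu> + \<kappa>) * (norm (\<theta> y1 p - \<theta> y2 p))\<^sup>2 \<le> (y1 - y2) \<bullet> (\<theta> y1 p - \<theta> y2 p)"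
    proof (rule inverse_strongly_monotone_if_coderivative_bound[where F = "\<lambda>x. partial_subdiff g x p"
          and K = "\<lambda>y. \<theta> y p" and \<phi> = "\<lambda>x. \<mu> *\<^sub>R x + f x p" and U = "ball xb s2" and ?y0.0 = yb and R = R
          and D = "\<lambda>x. \<mu> *\<^sub>R id_blinfun + partial_grad f x p" and L = L, OF D(2) _ open_ball _ _ _ D(3) diff cod_y y])
      show "0 < \<mu> + \<kappa>" using \<mu> \<kappa> by simp
      show "\<theta> y p \<in> ball xb s2" if "y \<in> ball yb R" for y by (rule D(6)[OF that p])
      show "y - (\<mu> *\<^sub>R x + f x p) \<in> partial_subdiff g x p \<longleftrightarrow> x = \<theta> y p" if "y \<in> ball yb R" "x \<in> ball xb s2" for y x
        by (rule D(7)[OF that(1) p that(2)])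
      show "norm (\<theta> y p - \<theta> y' p) \<le> L * norm (y - y')" if "y \<in> ball yb R" "y' \<in> ball yb R" for y y'
        using D(8)[OF that p p] by simp
    qed
  qed (use R D(2) in auto)
qed

text \<open>
  The localization is built in three stages, for \<open>\<mu> x + \<partial>g\<close>, \<open>\<mu> x + f + \<partial>g\<close> and \<open>f + \<partial>g\<close>. The
  second stage needs \<open>\<mu> - r\<close> to exceed the Lipschitz modulus \<open>m\<close> of \<open>f\<close>, and the third the
  sharp modulus \<open>1 / (\<mu> + \<kappa>)\<close>, which the coderivative condition provides.
\<close>

lemma stable_if_coderivative_condition:
  fixes f :: "'x::{real_inner, complete_space} \<Rightarrow> 'p::metric_space \<Rightarrow> 'x" and g :: "'x \<Rightarrow> 'p \<Rightarrow> ereal"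
  assumes g_not_MInfty: "\<And>x p. g x p \<noteq> -\<infinity>"
    and g_lsc: "lower_semicontinuous (\<lambda>(x, p). g x p)"
    and solution: "xb \<in> solution_map f g vb pb"
    and A1: "assumption_A1 f xb pb" and vh: "vh = vb - f xb pb"
    and A2: "parametrically_continuously_prox_regular g xb pb vh"
    and A3: "assumption_A3 g xb pb"
    and cod: "coderivative_condition f g xb pb vh \<eta> \<kappa>0" and \<eta>: "0 < \<eta>"
    and \<kappa>: "0 < \<kappa>" "\<kappa> < \<kappa>0"
  shows "\<exists>l. hoelderian_fully_stable (solution_map f g) vb pb xb \<kappa> l"
proof -
  have "vh \<in> partial_subdiff g xb pb" using solution by (simp add: mem_solution_map_iff vh)
  then obtain gb r l \<sigma> \<tau> where pr: "prox_bounds g xb pb vh gb r l \<sigma> \<tau>"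
    using prox_bounds_exist[OF g_not_MInfty _ A2 A3] by blast
  let ?A = "partial_grad f xb pb"
  obtain s1 lf where s1: "0 < s1" and lf: "0 \<le> lf" and
    lipx: "\<And>x x' p. x \<in> ball xb s1 \<Longrightarrow> x' \<in> ball xb s1 \<Longrightarrow> p \<in> ball pb s1 \<Longrightarrow>
      norm (f x p - f x' p) \<le> (norm ?A + 1) * norm (x - x')" and
    lipp: "\<And>x p p'. x \<in> ball xb s1 \<Longrightarrow> p \<in> ball pb s1 \<Longrightarrow> p' \<in> ball pb s1 \<Longrightarrow>
      norm (f x p - f x p') \<le> lf * dist p p'"
    by (rule assumption_A1_local[OF A1 zero_less_one]) (rule that; assumption)
  define m where "m = norm ?A + 1"
  have m: "0 < m" by (simp add: m_def add_nonneg_pos)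
  define \<mu> where "\<mu> = r + m + 1"
  have \<mu>: "0 < \<mu>" "r < \<mu>" using prox_boundsD(1)[OF pr] m by (auto simp: \<mu>_def)
  obtain s0 \<rho>0 \<theta>0 C0 where
    loc0: "localizes (partial_subdiff g) (\<lambda>x p. \<mu> *\<^sub>R x) xb pb (vh + \<mu> *\<^sub>R xb) s0 \<rho>0 \<theta>0 (1 / (\<mu> - r)) C0"
    using localizes_prox[OF g_not_MInfty g_lsc pr \<mu>(2)] by blast
  define yb where "yb = vh + \<mu> *\<^sub>R xb + f xb pb"
  have contraction: "1 / (\<mu> - r) * m < 1" using m by (simp add: \<mu>_def)
  have "\<exists>s2 \<rho>2 \<theta> L C2. localizes (partial_subdiff g) (\<lambda>x p. \<mu> *\<^sub>R x + f x p) xb pb yb s2 \<rho>2 \<theta> L C2"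
    unfolding yb_def
  proof (rule localizes_perturb[OF loc0 s1 less_imp_le[OF m] contraction lf, where N = f])
    show "norm (f x p - f x' p) \<le> m * norm (x - x')"
      if "x \<in> ball xb s1" "x' \<in> ball xb s1" "p \<in> ball pb s1" for x x' p
      unfolding m_def by (rule lipx[OF that])
  qed (rule lipp, assumption+, blast)
  then obtain s2 \<rho>2 \<theta> L C2
    where loc2: "localizes (partial_subdiff g) (\<lambda>x p. \<mu> *\<^sub>R x + f x p) xb pb yb s2 \<rho>2 \<theta> L C2"
    by blast
  obtain \<rho>3 where \<rho>3: "0 < \<rho>3" "\<rho>3 \<le> \<rho>2" and
    mono: "\<And>y1 y2 p. y1 \<in> ball yb \<rho>3 \<Longrightarrow> y2 \<in> ball yb \<rho>3 \<Longrightarrow> p \<in> ball pb \<rho>3 \<Longrightarrow>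
      (\<mu> + \<kappa>) * (norm (\<theta> y1 p - \<theta> y2 p))\<^sup>2 \<le> (y1 - y2) \<bullet> (\<theta> y1 p - \<theta> y2 p)"
    using resolvent_strongly_monotone[OF A1 cod \<eta> \<kappa> less_imp_le[OF \<mu>(1)] yb_def loc2] by blast
  have pos: "0 < \<mu> + \<kappa>" using \<mu> \<kappa> by simp
  have "norm (\<theta> y p - \<theta> y' p) \<le> 1 / (\<mu> + \<kappa>) * norm (y - y')"
    if y: "y \<in> ball yb \<rho>3" "y' \<in> ball yb \<rho>3" and p: "p \<in> ball pb \<rho>3" for y y' p
  proof -
    have "(\<mu> + \<kappa>) * norm (\<theta> y p - \<theta> y' p) * norm (\<theta> y p - \<theta> y' p) \<le> norm (y - y') * norm (\<theta> y p - \<theta> y' p)"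
      using order_trans[OF mono[OF y p] norm_cauchy_schwarz] by (simp add: power2_eq_square mult.assoc)
    then have "(\<mu> + \<kappa>) * norm (\<theta> y p - \<theta> y' p) \<le> norm (y - y')"
      by (cases "\<theta> y p = \<theta> y' p") auto
    then show ?thesis using pos by (simp add: pos_le_divide_eq mult.commute)
  qed
  then have loc3: "localizes (partial_subdiff g) (\<lambda>x p. \<mu> *\<^sub>R x + f x p) xb pb yb s2 \<rho>3 \<theta> (1 / (\<mu> + \<kappa>)) C2"
    using pos by (intro localizes_improve_modulus[OF loc2 \<rho>3]) auto
  have contraction': "1 / (\<mu> + \<kappa>) * \<mu> < 1" using \<mu> \<kappa> by simp
  have "\<exists>s4 \<rho>4 \<theta>4 L4 C4. localizes (partial_subdiff g) (\<lambda>x p. (\<mu> *\<^sub>R x + f x p) + - (\<mu> *\<^sub>R x))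
      xb pb (yb + - (\<mu> *\<^sub>R xb)) s4 \<rho>4 \<theta>4 L4 C4"
  proof (rule localizes_perturb[OF loc3 zero_less_one less_imp_le[OF \<mu>(1)] contraction' order_refl,
        where N = "\<lambda>x p. - (\<mu> *\<^sub>R x)"])
    show "norm (- (\<mu> *\<^sub>R x) - - (\<mu> *\<^sub>R x')) \<le> \<mu> * norm (x - x')" for x x'
    proof -
      have "- (\<mu> *\<^sub>R x) - - (\<mu> *\<^sub>R x') = \<mu> *\<^sub>R (x' - x)" by (simp add: algebra_simps)
      then show ?thesis using \<mu>(1) by (simp add: norm_minus_commute)
    qed
  qed (simp, blast)
  moreover have "(\<lambda>x p. (\<mu> *\<^sub>R x + f x p) + - (\<mu> *\<^sub>R x)) = f" "yb + - (\<mu> *\<^sub>R xb) = vb"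
    by (simp_all add: fun_eq_iff yb_def vh)
  ultimately obtain s4 \<rho>4 \<theta>4 L4 C4 where loc4: "localizes (partial_subdiff g) f xb pb vb s4 \<rho>4 \<theta>4 L4 C4"
    by auto
  note D3 = localizesD[OF loc3]
  define s5 where "s5 = Min {s4, s2, \<rho>3 / (2 * \<mu>)}"
  have s5: "0 < s5" "s5 \<le> s4" "s5 \<le> s2" "s5 \<le> \<rho>3 / (2 * \<mu>)"
    using localizesD(1)[OF loc4] D3(1) \<rho>3(1) \<mu>(1) by (auto simp: s5_def)
  have "0 < 2 * \<mu>" using \<mu> by simp
  with s5(4) have "s5 * (2 * \<mu>) \<le> \<rho>3" by (simp only: pos_le_divide_eq)
  then have \<mu>s5: "\<mu> * s5 \<le> \<rho>3 / 2" by (simp add: algebra_simps)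
  have "0 < \<rho>3 / 2" using \<rho>3 by simp
  then obtain \<rho>5 where \<rho>5: "\<rho>5 \<le> \<rho>3 / 2" and loc5: "localizes (partial_subdiff g) f xb pb vb s5 \<rho>5 \<theta>4 L4 C4"
    using localizes_shrink[OF loc4 s5(1,2)] by blast
  note D = localizesD[OF loc5]
  \<comment> \<open>The solution at \<open>v\<close> is the resolvent at \<open>v + \<mu> x\<close>.\<close>
  have resolvent: "v + \<mu> *\<^sub>R \<theta>4 v p \<in> ball yb \<rho>3" "\<theta> (v + \<mu> *\<^sub>R \<theta>4 v p) p = \<theta>4 v p"
    if v: "v \<in> ball vb \<rho>5" and p: "p \<in> ball pb \<rho>5" for v p
  proof -
    let ?x = "\<theta>4 v p"
    have x: "?x \<in> ball xb s5" by (rule D(6)[OF v p])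
    have "(v + \<mu> *\<^sub>R ?x) - yb = (v - vb) + \<mu> *\<^sub>R (?x - xb)" by (simp add: yb_def vh algebra_simps)
    then have "norm ((v + \<mu> *\<^sub>R ?x) - yb) \<le> norm (v - vb) + norm (\<mu> *\<^sub>R (?x - xb))"
      by (simp only: norm_triangle_ineq)
    then have "norm ((v + \<mu> *\<^sub>R ?x) - yb) \<le> norm (v - vb) + \<mu> * norm (?x - xb)"
      using \<mu>(1) by (simp only: norm_scaleR abs_of_pos)
    also have "\<dots> < \<rho>3 / 2 + \<rho>3 / 2"
    proof (rule add_less_le_mono)
      show "norm (v - vb) < \<rho>3 / 2" using v \<rho>5 by (simp add: dist_norm norm_minus_commute)
      have "\<mu> * norm (?x - xb) \<le> \<mu> * s5"
        using x \<mu>(1) by (intro mult_left_mono) (auto simp: dist_norm norm_minus_commute)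
      then show "\<mu> * norm (?x - xb) \<le> \<rho>3 / 2" using \<mu>s5 by linarith
    qed
    finally show y: "v + \<mu> *\<^sub>R ?x \<in> ball yb \<rho>3" by (simp add: dist_norm norm_minus_commute)
    have p3: "p \<in> ball pb \<rho>3" using p \<rho>5 \<rho>3(1) by simp
    have xs2: "?x \<in> ball xb s2" using x s5(3) by simp
    have "v - f ?x p \<in> partial_subdiff g ?x p" using D(7)[OF v p x] by simp
    then have "(v + \<mu> *\<^sub>R ?x) - (\<mu> *\<^sub>R ?x + f ?x p) \<in> partial_subdiff g ?x p" by simp
    then show "\<theta> (v + \<mu> *\<^sub>R ?x) p = ?x" using D3(7)[OF y p3 xs2] by simp
  qed
  have stable: "norm ((v1 - v2) - (2 * \<kappa>) *\<^sub>R (\<theta>4 v1 p - \<theta>4 v2 p)) \<le> norm (v1 - v2)"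
    if v: "v1 \<in> ball vb \<rho>5" "v2 \<in> ball vb \<rho>5" and p: "p \<in> ball pb \<rho>5" for v1 v2 p
  proof -
    let ?x1 = "\<theta>4 v1 p" and ?x2 = "\<theta>4 v2 p"
    have p3: "p \<in> ball pb \<rho>3" using p \<rho>5 \<rho>3(1) by simp
    have "(\<mu> + \<kappa>) * (norm (?x1 - ?x2))\<^sup>2 \<le> ((v1 + \<mu> *\<^sub>R ?x1) - (v2 + \<mu> *\<^sub>R ?x2)) \<bullet> (?x1 - ?x2)"
      using mono[OF resolvent(1)[OF v(1) p] resolvent(1)[OF v(2) p] p3]
      by (simp only: resolvent(2)[OF v(1) p] resolvent(2)[OF v(2) p])
    also have "\<dots> = (v1 - v2) \<bullet> (?x1 - ?x2) + \<mu> * (norm (?x1 - ?x2))\<^sup>2"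
      by (simp add: power2_norm_eq_inner inner_diff_left inner_diff_right inner_add_left inner_add_right
          inner_commute algebra_simps)
    finally show ?thesis unfolding stable_iff_strongly_monotone[OF \<kappa>(1)] by (simp add: algebra_simps)
  qed
  have "single_valued_localization (solution_map f g) vb pb xb (ball vb \<rho>5) (ball pb \<rho>5) (ball xb s5) \<theta>4"
    unfolding single_valued_localization_def
  proof (intro conjI ballI)
    show "\<theta>4 v p \<in> ball xb s5" if "v \<in> ball vb \<rho>5" "p \<in> ball pb \<rho>5" for v p by (rule D(6)[OF that])
    have "x = \<theta>4 v p \<longleftrightarrow> x \<in> solution_map f g v p \<and> x \<in> ball xb s5"
      if "v \<in> ball vb \<rho>5" "p \<in> ball pb \<rho>5" for v p x
      using D(6,7)[OF that] by (auto simp only: mem_solution_map_iff)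
    then show "{(v, p, x). v \<in> ball vb \<rho>5 \<and> p \<in> ball pb \<rho>5 \<and> x = \<theta>4 v p} =
        {(v, p, x). x \<in> solution_map f g v p} \<inter> ball vb \<rho>5 \<times> ball pb \<rho>5 \<times> ball xb s5"
      by (auto simp del: mem_ball)
  qed (use D(1,2) in auto)
  moreover have "norm ((v1 - v2) - (2 * \<kappa>) *\<^sub>R (\<theta>4 v1 p1 - \<theta>4 v2 p2))
      \<le> norm (v1 - v2) + (2 * \<kappa> * C4 + 1) * sqrt (dist p1 p2)"
    if v: "v1 \<in> ball vb \<rho>5" "v2 \<in> ball vb \<rho>5" and p: "p1 \<in> ball pb \<rho>5" "p2 \<in> ball pb \<rho>5" for v1 v2 p1 p2
  proof -
    have "(v1 - v2) - (2 * \<kappa>) *\<^sub>R (\<theta>4 v1 p1 - \<theta>4 v2 p2) =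
        ((v1 - v2) - (2 * \<kappa>) *\<^sub>R (\<theta>4 v1 p1 - \<theta>4 v2 p1)) - (2 * \<kappa>) *\<^sub>R (\<theta>4 v2 p1 - \<theta>4 v2 p2)"
      by (simp add: algebra_simps)
    then have "norm ((v1 - v2) - (2 * \<kappa>) *\<^sub>R (\<theta>4 v1 p1 - \<theta>4 v2 p2)) \<le>
        norm ((v1 - v2) - (2 * \<kappa>) *\<^sub>R (\<theta>4 v1 p1 - \<theta>4 v2 p1)) + norm ((2 * \<kappa>) *\<^sub>R (\<theta>4 v2 p1 - \<theta>4 v2 p2))"
      by (simp only: norm_triangle_ineq4)
    also have "\<dots> \<le> norm (v1 - v2) + 2 * \<kappa> * (C4 * sqrt (dist p1 p2))"
      using stable[OF v p(1)] D(8)[OF v(2) v(2) p] \<kappa>(1) by (intro add_mono) auto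
    also have "\<dots> \<le> norm (v1 - v2) + (2 * \<kappa> * C4 + 1) * sqrt (dist p1 p2)"
      by (simp add: algebra_simps)
    finally show ?thesis .
  qed
  \<comment> \<open>The summand \<open>1\<close> makes the modulus positive also when \<open>C4 = 0\<close>.\<close>
  moreover have "0 < 2 * \<kappa> * C4 + 1" using \<kappa>(1) D(4) by (simp add: add_nonneg_pos)
  ultimately have "hoelderian_fully_stable (solution_map f g) vb pb xb \<kappa> (2 * \<kappa> * C4 + 1)"
    unfolding hoelderian_fully_stable_def using solution \<kappa>(1) by blast
  then show ?thesis by blast
qed

theorem theorem4p2:
  fixes f :: "'x::{real_inner, complete_space} \<Rightarrow> 'p::metric_space \<Rightarrow> 'x"
    and g :: "'x \<Rightarrow> 'p \<Rightarrow> ereal"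
    and xb vb vh :: 'x and pb :: 'p
    and S :: "'x \<Rightarrow> 'p \<Rightarrow> 'x set"
  defines "S \<equiv> solution_map f g"
    and "vh \<equiv> vb - f xb pb"
  assumes g_not_MInfty: "\<And>x p. g x p \<noteq> -\<infinity>"
    and g_lsc: "lower_semicontinuous (\<lambda>(x, p). g x p)"
    and solution: "xb \<in> S vb pb"
    and A1: "assumption_A1 f xb pb"
    and A2: "parametrically_continuously_prox_regular g xb pb vh"
    and A3: "assumption_A3 g xb pb"
  shows
    "(\<forall>\<kappa> l. hoelderian_fully_stable S vb pb xb \<kappa> l \<longrightarrow>
        (\<forall>\<kappa>0. 0 < \<kappa>0 \<and> \<kappa>0 < \<kappa> \<longrightarrow>
          (\<exists>\<eta>>0. coderivative_condition f g xb pb vh \<eta> \<kappa>0))) \<and>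
     (\<forall>\<eta> \<kappa>0. \<eta> > 0 \<and> \<kappa>0 > 0 \<and> coderivative_condition f g xb pb vh \<eta> \<kappa>0 \<longrightarrow>
        (\<forall>\<kappa>. 0 < \<kappa> \<and> \<kappa> < \<kappa>0 \<longrightarrow>
          (\<exists>l. hoelderian_fully_stable S vb pb xb \<kappa> l))) \<and>
     (\<forall>\<eta> \<kappa>0. \<eta> > 0 \<and> \<kappa>0 > 0 \<and> coderivative_condition f g xb pb vh \<eta> \<kappa>0 \<longrightarrow>
        (\<exists>\<kappa> l. hoelderian_fully_stable S vb pb xb \<kappa> l) \<and>
        (\<forall>\<kappa> l. hoelderian_fully_stable S vb pb xb \<kappa> l \<longrightarrow>
          (\<exists>V Q U \<theta>. single_valued_localization S vb pb xb V Q U \<theta> \<and>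
            (\<forall>v1\<in>V. \<forall>p1\<in>Q. \<forall>v2\<in>V. \<forall>p2\<in>Q.
              norm (\<theta> v1 p1 - \<theta> v2 p2)
                \<le> 1 / \<kappa> * norm (v1 - v2) + l / (2 * \<kappa>) * sqrt (dist p1 p2)))))"
proof -
  have vh: "vh = vb - f xb pb" by (simp add: vh_def)
  have sol: "xb \<in> solution_map f g vb pb" using solution by (simp add: S_def)
  have i_ii: "\<exists>\<eta>>0. coderivative_condition f g xb pb vh \<eta> \<kappa>0"
    if "hoelderian_fully_stable S vb pb xb \<kappa> l" "0 < \<kappa>0" "\<kappa>0 < \<kappa>" for \<kappa> l \<kappa>0
    using coderivative_condition_if_stable[OF A1 vh _ that(2,3)] that(1) by (simp add: S_def)
  have ii_i: "\<exists>l. hoelderian_fully_stable S vb pb xb \<kappa> l"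
    if "0 < \<eta>" "coderivative_condition f g xb pb vh \<eta> \<kappa>0" "0 < \<kappa>" "\<kappa> < \<kappa>0" for \<eta> \<kappa>0 \<kappa>
    unfolding S_def
    by (rule stable_if_coderivative_condition[OF g_not_MInfty g_lsc sol A1 vh A2 A3 that(2,1,3,4)])
  have hoelder: "\<exists>V Q U \<theta>. single_valued_localization S vb pb xb V Q U \<theta> \<and>
      (\<forall>v1\<in>V. \<forall>p1\<in>Q. \<forall>v2\<in>V. \<forall>p2\<in>Q. norm (\<theta> v1 p1 - \<theta> v2 p2)
        \<le> 1 / \<kappa> * norm (v1 - v2) + l / (2 * \<kappa>) * sqrt (dist p1 p2))"
    if stable: "hoelderian_fully_stable S vb pb xb \<kappa> l" for \<kappa> l
  proof -
    have \<kappa>: "0 < \<kappa>" using stable by (simp add: hoelderian_fully_stable_def)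
    obtain V Q U \<theta> where loc: "single_valued_localization S vb pb xb V Q U \<theta>" and
      est: "\<And>v1 p1 v2 p2. v1 \<in> V \<Longrightarrow> p1 \<in> Q \<Longrightarrow> v2 \<in> V \<Longrightarrow> p2 \<in> Q \<Longrightarrow>
        norm ((v1 - v2) - (2 * \<kappa>) *\<^sub>R (\<theta> v1 p1 - \<theta> v2 p2)) \<le> norm (v1 - v2) + l * sqrt (dist p1 p2)"
      using stable unfolding hoelderian_fully_stable_def by blast
    have "norm (\<theta> v1 p1 - \<theta> v2 p2) \<le> 1 / \<kappa> * norm (v1 - v2) + l / (2 * \<kappa>) * sqrt (dist p1 p2)"
      if "v1 \<in> V" "p1 \<in> Q" "v2 \<in> V" "p2 \<in> Q" for v1 p1 v2 p2
    proof -
      let ?d = "\<theta> v1 p1 - \<theta> v2 p2"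
      have "norm ((2 * \<kappa>) *\<^sub>R ?d) \<le> norm ((v1 - v2) - (2 * \<kappa>) *\<^sub>R ?d) + norm (v1 - v2)"
        using norm_triangle_ineq4[of "v1 - v2" "(v1 - v2) - (2 * \<kappa>) *\<^sub>R ?d"] by simp
      then have "2 * \<kappa> * norm ?d \<le> 2 * norm (v1 - v2) + l * sqrt (dist p1 p2)"
        using est[OF that] \<kappa> by simp
      then show ?thesis using \<kappa> by (simp add: field_simps)
    qed
    then show ?thesis using loc by blast
  qed
  show ?thesis
  proof (intro conjI allI impI)
    show "\<exists>\<eta>>0. coderivative_condition f g xb pb vh \<eta> \<kappa>0"
      if "hoelderian_fully_stable S vb pb xb \<kappa> l" "0 < \<kappa>0 \<and> \<kappa>0 < \<kappa>" for \<kappa> l \<kappa>0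
      using i_ii that by blast
    show "\<exists>l. hoelderian_fully_stable S vb pb xb \<kappa> l"
      if "0 < \<eta> \<and> 0 < \<kappa>0 \<and> coderivative_condition f g xb pb vh \<eta> \<kappa>0" "0 < \<kappa> \<and> \<kappa> < \<kappa>0" for \<eta> \<kappa>0 \<kappa>
      using ii_i that by blast
    show "\<exists>\<kappa> l. hoelderian_fully_stable S vb pb xb \<kappa> l"
      if "0 < \<eta> \<and> 0 < \<kappa>0 \<and> coderivative_condition f g xb pb vh \<eta> \<kappa>0" for \<eta> \<kappa>0
      using ii_i[of \<eta> \<kappa>0 "\<kappa>0 / 2"] that by auto
    show "\<exists>V Q U \<theta>. single_valued_localization S vb pb xb V Q U \<theta> \<and>
      (\<forall>v1\<in>V. \<forall>p1\<in>Q. \<forall>v2\<in>V. \<forall>p2\<in>Q. norm (\<theta> v1 p1 - \<theta> v2 p2)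
        \<le> 1 / \<kappa> * norm (v1 - v2) + l / (2 * \<kappa>) * sqrt (dist p1 p2))"
      if "hoelderian_fully_stable S vb pb xb \<kappa> l" for \<kappa> l
      by (rule hoelder[OF that])
  qed
qed

end
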